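(* Let $A$ be a local principal ideal commutative ring of length $\ell\in\mathbb{N}\cup\{\infty\}$ with maximal ideal $\mathfrak{m}$ and finite residue field of cardinality $q$. Let $A_\imath=A/\mathfrak{m}^\imath$, let $$s_{M_3}(\imath)=|\mathrm{Sim}(M_3(A_\imath))|=\epsilon T^{\imath-1}v_{M_3},\qquad s_{\mathrm{GL}_3}(\imath)=|\mathrm{Sim}(\mathrm{GL}_3(A_\imath))|=\epsilon T^{\imath-1}v_{\mathrm{GL}_3}$$ be the numbers of similarity classes at level $\imath$, where $$\epsilon=(1,1,1,1),\quad T=\begin{bmatrix} q&0&0&0\\ q^2-q&q^2&0&0\\ q&0&q^2&0\\ q^3&q^3&q^3+q&q^3\end{bmatrix},\quad v_{M_3}=\begin{bmatrix} q\\ q^2-q\\ q\\ q^3\end{bmatrix},\quad v_{\mathrm{GL}_3}=\begin{bmatrix} q-1\\ (q-1)(q-2)\\ q-1\\ q^3-q^2\end{bmatrix}.$$ Then $$\sum_{\imath=0}^{\infty}s_{M_3}(\imath)z^\imath=\frac{1}{(q-1)(q^2-1)}\left(\frac{q^3+q^{-1}}{1-q^3z}-\frac{q^2+q+1+q^{-1}}{1-q^2z}+\frac{2}{1-qz}\right),$$ $$\sum_{\imath=0}^{\infty}s_{\mathrm{GL}_3}(\imath)z^\imath=\frac{1}{q^2-1}\left(\frac{q^2-1+2q^{-2}}{1-q^3z}-\frac{q+q^{-1}+2q^{-2}}{1-q^2z}+\frac{2q^{-1}}{1-qz}\right).$$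
   Context: The length $\ell$ of $A$ is the smallest positive integer with $\mathfrak{m}^\ell=0$ ($\ell=\infty$ if there is none). The quotients $A_\imath$ are the levels $1\le\imath\le\ell$, and the class-count reading of $s_{M_3}(\imath)$, $s_{\mathrm{GL}_3}(\imath)$ refers to these; the expressions $\epsilon T^{\imath-1}v$ make sense for every integer $\imath\ge 0$ because $T$ is invertible over $\mathbb{Q}$. Two matrices $\alpha,\alpha'\in M_3(R)$ over a commutative ring $R$ are similar if $X\alpha=\alpha'X$ for some $X\in\mathrm{GL}_3(R)$; $\mathrm{Sim}(M_3(R))$ is the set of similarity classes in $M_3(R)$, and $\mathrm{Sim}(\mathrm{GL}_3(R))$ is the set of similarity classes of invertible matrices, i.e. conjugacy classes in $\mathrm{GL}_3(R)$. *)

theory Defs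
  imports
    "HOL-Algebra.Ideal_Product"
    "HOL-Algebra.QuotRing"
    "HOL-Computational_Algebra.Formal_Power_Series"
    "HOL-Library.Extended_Nat"
    "Jordan_Normal_Form.Matrix"
begin

definition local_principal_ideal_ring :: "('a, 'b) ring_scheme \<Rightarrow> 'a set \<Rightarrow> bool" where
  "local_principal_ideal_ring A \<mm> \<longleftrightarrow>
     cring A \<and> maximalideal \<mm> A \<and> (\<forall>J. maximalideal J A \<longrightarrow> J = \<mm>) \<and>
     (\<forall>I. ideal I A \<longrightarrow> principalideal I A)"

text \<open>The infimum of the empty set is \<open>\<infinity>\<close> in \<^typ>\<open>enat\<close>.\<close>

definition pir_length :: "('a, 'b) ring_scheme \<Rightarrow> 'a set \<Rightarrow> enat" where
  "pir_length A \<mm> = Inf (enat ` {l. 0 < l \<and> \<mm> [^]\<^bsub>ideals_set A\<^esub> l = {\<zero>\<^bsub>A\<^esub>}})"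

definition level :: "('a, 'b) ring_scheme \<Rightarrow> 'a set \<Rightarrow> nat \<Rightarrow> 'a set ring" where
  "level A \<mm> i = A Quot (\<mm> [^]\<^bsub>ideals_set A\<^esub> i)"

text \<open>The library's \<^const>\<open>ring_mat\<close> needs entries from a type class, so matrices over a
  carrier-based ring get their own ring structure (on the same type of matrices).\<close>

definition matrix_ring :: "nat \<Rightarrow> ('a, 'b) ring_scheme \<Rightarrow> 'a mat ring" where
  "matrix_ring n R =
     \<lparr>carrier = {a \<in> carrier_mat n n. \<forall>i<n. \<forall>j<n. a $$ (i, j) \<in> carrier R},
      monoid.mult = (\<lambda>a b. mat n n (\<lambda>(i, j). \<Oplus>\<^bsub>R\<^esub>k\<in>{..<n}. a $$ (i, k) \<otimes>\<^bsub>R\<^esub> b $$ (k, j))),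
      one = mat n n (\<lambda>(i, j). if i = j then \<one>\<^bsub>R\<^esub> else \<zero>\<^bsub>R\<^esub>),
      zero = mat n n (\<lambda>_. \<zero>\<^bsub>R\<^esub>),
      add = (\<lambda>a b. mat n n (\<lambda>(i, j). a $$ (i, j) \<oplus>\<^bsub>R\<^esub> b $$ (i, j)))\<rparr>"

abbreviation M3 :: "('a, 'b) ring_scheme \<Rightarrow> 'a mat set" where
  "M3 R \<equiv> carrier (matrix_ring 3 R)"

abbreviation GL3 :: "('a, 'b) ring_scheme \<Rightarrow> 'a mat set" where
  "GL3 R \<equiv> Units (matrix_ring 3 R)"

definition similarity3 :: "('a, 'b) ring_scheme \<Rightarrow> 'a mat rel" where
  "similarity3 R = {(a, a'). a \<in> M3 R \<and> a' \<in> M3 R \<and>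
     (\<exists>X\<in>GL3 R. X \<otimes>\<^bsub>matrix_ring 3 R\<^esub> a = a' \<otimes>\<^bsub>matrix_ring 3 R\<^esub> X)}"

definition Sim_M3 :: "('a, 'b) ring_scheme \<Rightarrow> 'a mat set set" where
  "Sim_M3 R = M3 R // similarity3 R"

definition Sim_GL3 :: "('a, 'b) ring_scheme \<Rightarrow> 'a mat set set" where
  "Sim_GL3 R = GL3 R // similarity3 R"

definition eps_vec :: "rat vec" where
  "eps_vec = vec_of_list [1, 1, 1, 1]"

definition T_mat :: "rat \<Rightarrow> rat mat" where
  "T_mat q = mat_of_rows_list 4
     [[q,       0,   0,       0],
      [q^2 - q, q^2, 0,       0],
      [q,       0,   q^2,     0],
      [q^3,     q^3, q^3 + q, q^3]]"

definition v_M3 :: "rat \<Rightarrow> rat vec" where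
  "v_M3 q = vec_of_list [q, q^2 - q, q, q^3]"

definition v_GL3 :: "rat \<Rightarrow> rat vec" where
  "v_GL3 q = vec_of_list [q - 1, (q - 1) * (q - 2), q - 1, q^3 - q^2]"

text \<open>The exponent is an integer: at \<open>i = 0\<close> the inverse of \<open>T\<close> over the rationals occurs.
  In particular the value at \<open>0\<close> is given by this expression and is not a class number
  (for \<open>GL\<^sub>3\<close> it is \<open>1 - 1/q\<close>).\<close>

definition T_power :: "rat \<Rightarrow> int \<Rightarrow> rat mat" where
  "T_power q k = T_mat q [^]\<^bsub>ring_mat TYPE(rat) 4 ()\<^esub> k"

definition s_M3 :: "rat \<Rightarrow> nat \<Rightarrow> rat" where
  "s_M3 q i = eps_vec \<bullet> (T_power q (int i - 1) *\<^sub>v v_M3 q)"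

definition s_GL3 :: "rat \<Rightarrow> nat \<Rightarrow> rat" where
  "s_GL3 q i = eps_vec \<bullet> (T_power q (int i - 1) *\<^sub>v v_GL3 q)"

end

(* By Burnside's lemma the number of similarity classes at level i is the number of pairs (X, a)
with X invertible and [X, a] = 0, divided by the order of the group.  These pairs are counted one
level at a time.  For a modulo m^i let C(a) be the set of the residues modulo m of the matrices
that commute with a.  It is all of M_3 if a is scalar, or five-dimensional if the first
non-scalar part of a is, modulo m and up to a scalar, a semisimple or a nilpotent matrix of rank
one, or else three-dimensional.  The trace form makes C(a) orthogonal to the leading coefficients
of the commutators [X, a] that vanish modulo m^i, and the dimensions are complementary.  Hence for
a lift a' = a + p^i b the set C(a') is the radical of the alternating form p^(-i) tr(a'[X, Y])
on C(a).  If C(a) is all of M_3, this is the form of b over the residue field.  If C(a) is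
five-dimensional, the form lives on the three-dimensional quotient by the span of 1 and a further
central element; as b varies, every alternating form on this quotient occurs equally often,
and a nonzero one has a radical of dimension three in C(a).  If C(a) is three-dimensional, the form
lives on a one-dimensional quotient and vanishes.  The numbers of lifts of each kind, weighted by
the numbers of invertible elements of C(a), form the matrix T. *)

theory Submission
  imports Defs "HOL-Library.Poly_Mapping" "HOL-Library.Product_Plus" "HOL-Algebra.Free_Abelian_Groups" "HOL-Algebra.Ring_Divisibility"
begin

section \<open>Fibre counting for additive maps between finite quotients\<close>

section \<open>Counting with transversals\<close>

text \<open>The quotients of A by the powers of \<mm> have carriers but no types, while the matrix
  algebra needs a type class. Each of them is therefore written as a type modulo an ideal
  \<open>K\<close>, the type being a free commutative ring, and quotients are handled through
  representatives, so that one type of matrices serves all levels.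

  The induction weighs a matrix by its whole centralizer, but only C(a) is controlled. This
  suffices: reduction modulo \<mm> on the centralizer at level i+1 has the residue set as its image
  and a copy of the centralizer at level i as its kernel. The order of the centralizer and the
  number of its invertible elements thus share a factor, which cancels.

  The complementary dimensions in the duality come from counting alone: domain and kernel of X ->
  [X, a] on multiples of p are expressed by centralizer orders of lower levels.

  The two five-dimensional types have lifts of the same shape but different entries q^3 and q^3 + q
  of T, because the span of 1 and the central element contains (q-1)^2 invertible elements in the
  semisimple case and q(q-1) in the nilpotent one.\<close>

definition add_subgroup :: "'a::ab_group_add set \<Rightarrow> bool" where
  "add_subgroup K \<longleftrightarrow> 0 \<in> K \<and> (\<forall>x\<in>K. \<forall>y\<in>K. x - y \<in> K)"

lemma add_subgroupD:
  assumes "add_subgroup K"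
  shows "0 \<in> K" "x \<in> K \<Longrightarrow> y \<in> K \<Longrightarrow> x - y \<in> K" "x \<in> K \<Longrightarrow> - x \<in> K"
    "x \<in> K \<Longrightarrow> y \<in> K \<Longrightarrow> x + y \<in> K"
proof -
  show 0: "0 \<in> K" and d: "x \<in> K \<Longrightarrow> y \<in> K \<Longrightarrow> x - y \<in> K" for x y
    using assms by (auto simp: add_subgroup_def)
  show m: "- x \<in> K" if "x \<in> K" for x using d[OF 0 that] by simp
  show "x \<in> K \<Longrightarrow> y \<in> K \<Longrightarrow> x + y \<in> K"
    using d[of x "- y"] m[of y] by simp
qed

lemma add_subgroup_diff_commute: "add_subgroup K \<Longrightarrow> x - y \<in> K \<longleftrightarrow> y - x \<in> K"
  using add_subgroupD(3)[of K "x - y"] add_subgroupD(3)[of K "y - x"] by auto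

lemma add_subgroup_cong:
  assumes "add_subgroup H" "x - y \<in> H"
  shows "x \<in> H \<longleftrightarrow> y \<in> H"
  using add_subgroupD(2)[OF assms(1), of x "x - y"] add_subgroupD(4)[OF assms(1), of "x - y" y] assms(2)
  by auto

text \<open>Quotients by varying subgroups cannot each be a type, so a set of representatives stands
  for the quotient by \<open>K\<close>, and subsets of the quotient become subsets of
  \<open>T\<close>.\<close>

definition transversal :: "'a::ab_group_add set \<Rightarrow> 'a set \<Rightarrow> bool" where
  "transversal K T \<longleftrightarrow> add_subgroup K \<and> (\<forall>x. \<exists>!t. t \<in> T \<and> x - t \<in> K)"

definition rep :: "'a::ab_group_add set \<Rightarrow> 'a set \<Rightarrow> 'a \<Rightarrow> 'a" where
  "rep K T x = (THE t. t \<in> T \<and> x - t \<in> K)"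

context
  fixes K T :: "'a::ab_group_add set"
  assumes T: "transversal K T"
begin

lemma transversal_subgroup: "add_subgroup K"
  using T by (simp add: transversal_def)

lemma rep: "rep K T x \<in> T" "x - rep K T x \<in> K"
  using theI'[of "\<lambda>t. t \<in> T \<and> x - t \<in> K"] T by (auto simp: transversal_def rep_def)

lemma rep_eqI: "t \<in> T \<Longrightarrow> x - t \<in> K \<Longrightarrow> rep K T x = t"
  using T rep[of x] unfolding transversal_def by blast

lemma transversal_inj: "s \<in> T \<Longrightarrow> t \<in> T \<Longrightarrow> s - t \<in> K \<Longrightarrow> s = t"
  using rep_eqI[of t s] rep_eqI[of s s] add_subgroupD(1)[OF transversal_subgroup] by simp

lemma rep_eq_iff: "rep K T x = rep K T y \<longleftrightarrow> x - y \<in> K"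
proof
  assume "rep K T x = rep K T y"
  then show "x - y \<in> K"
    using add_subgroupD(2)[OF transversal_subgroup rep(2)[of x] rep(2)[of y]] by simp
next
  assume "x - y \<in> K"
  then show "rep K T x = rep K T y"
    using add_subgroupD(4)[OF transversal_subgroup \<open>x - y \<in> K\<close> rep(2)[of y]]
    by (intro rep_eqI rep) simp
qed

end

text \<open>Translation by \<open>x0\<close>, followed by reduction to \<open>T1\<close>, carries
  one fibre to the other; the inverse translates back.\<close>

lemma card_fibre:
  fixes f :: "'m::ab_group_add \<Rightarrow> 'n::ab_group_add"
  assumes H: "add_subgroup H" and K1: "K1 \<subseteq> H" and T1: "transversal K1 T1"
    and f: "\<And>x y. f (x - y) = f x - f y" and fK: "f ` K1 \<subseteq> K2" and K2: "add_subgroup K2"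
    and x0: "x0 \<in> H"
  shows "card {x \<in> H \<inter> T1. f x - f x0 \<in> K2} = card {x \<in> H \<inter> T1. f x \<in> K2}"
proof -
  note sub = transversal_subgroup[OF T1]
  have fp: "f (x + y) = f x + f y" for x y
    using f[of "x + y" y] by (simp add: algebra_simps)
  have repH: "rep K1 T1 x \<in> H \<longleftrightarrow> x \<in> H" for x
    using add_subgroup_cong[OF H, of x "rep K1 T1 x"] rep(2)[OF T1, of x] K1 by auto
  have repf: "f (rep K1 T1 x) - d \<in> K2 \<longleftrightarrow> f x - d \<in> K2" for x d
    using add_subgroup_cong[OF K2, of "f x - d" "f (rep K1 T1 x) - d"] rep(2)[OF T1, of x] fK f[of x "rep K1 T1 x"]
    by auto
  have repf0: "f (rep K1 T1 x) \<in> K2 \<longleftrightarrow> f x \<in> K2" for x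
    using repf[of x 0] by simp
  have "bij_betw (\<lambda>x. rep K1 T1 (x - x0)) {x \<in> H \<inter> T1. f x - f x0 \<in> K2} {x \<in> H \<inter> T1. f x \<in> K2}"
  proof (rule bij_betwI[where g = "\<lambda>x. rep K1 T1 (x + x0)"])
    show "(\<lambda>x. rep K1 T1 (x - x0)) \<in> {x \<in> H \<inter> T1. f x - f x0 \<in> K2} \<rightarrow> {x \<in> H \<inter> T1. f x \<in> K2}"
      using add_subgroupD(2)[OF H] x0 by (auto simp: repH repf0 f rep[OF T1])
    show "(\<lambda>x. rep K1 T1 (x + x0)) \<in> {x \<in> H \<inter> T1. f x \<in> K2} \<rightarrow> {x \<in> H \<inter> T1. f x - f x0 \<in> K2}"
      using add_subgroupD(4)[OF H] x0 by (auto simp: repH repf fp rep[OF T1])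
  next
    fix x assume "x \<in> {x \<in> H \<inter> T1. f x - f x0 \<in> K2}"
    then show "rep K1 T1 (rep K1 T1 (x - x0) + x0) = x"
      using rep(2)[OF T1, of "x - x0"] add_subgroup_diff_commute[OF sub, of "x - x0" "rep K1 T1 (x - x0)"]
      by (intro rep_eqI[OF T1]) (auto simp: algebra_simps)
  next
    fix x assume "x \<in> {x \<in> H \<inter> T1. f x \<in> K2}"
    then show "rep K1 T1 (rep K1 T1 (x + x0) - x0) = x"
      using rep(2)[OF T1, of "x + x0"] add_subgroup_diff_commute[OF sub, of "x + x0" "rep K1 T1 (x + x0)"]
      by (intro rep_eqI[OF T1]) (auto simp: algebra_simps)
  qed
  then show ?thesis by (rule bij_betw_same_card)
qed

text \<open>\<open>f\<close> induces a homomorphism of the quotients by \<open>K1\<close> and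
  \<open>K2\<close>, all of whose nonempty fibres have the size of the kernel. \<open>P\<close> may
  select only entire fibres, which is what \<open>Q\<close> expresses. Reduction to residues, linear
  functionals and commutator maps are all counted in this way.\<close>

lemma card_fibres:
  fixes f :: "'m::ab_group_add \<Rightarrow> 'n::ab_group_add"
  assumes H: "add_subgroup H" and K1: "K1 \<subseteq> H" and T1: "transversal K1 T1" "finite T1"
    and f: "\<And>x y. f (x - y) = f x - f y" and fK: "f ` K1 \<subseteq> K2" and T2: "transversal K2 T2" "finite T2"
    and PQ: "\<And>x d. x \<in> H \<Longrightarrow> f x - d \<in> K2 \<Longrightarrow> P x \<longleftrightarrow> Q d"
  shows "card {x \<in> H \<inter> T1. P x} =
    card {d \<in> T2. Q d \<and> (\<exists>x\<in>H. f x - d \<in> K2)} * card {x \<in> H \<inter> T1. f x \<in> K2}"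
proof -
  note K2 = transversal_subgroup[OF T2(1)]
  let ?D = "{d \<in> T2. Q d \<and> (\<exists>x\<in>H. f x - d \<in> K2)}"
  have "{x \<in> H \<inter> T1. P x} = (\<Union>d\<in>?D. {x \<in> H \<inter> T1. f x - d \<in> K2})" (is "_ = ?U")
  proof (intro equalityI subsetI)
    fix x assume x: "x \<in> {x \<in> H \<inter> T1. P x}"
    then have "rep K2 T2 (f x) \<in> ?D" using PQ[of x "rep K2 T2 (f x)"] rep[OF T2(1), of "f x"] by auto
    then show "x \<in> ?U" using x rep(2)[OF T2(1), of "f x"] by blast
  next
    fix x assume "x \<in> ?U"
    then show "x \<in> {x \<in> H \<inter> T1. P x}" using PQ by blast
  qed
  also have "card \<dots> = (\<Sum>d\<in>?D. card {x \<in> H \<inter> T1. f x - d \<in> K2})"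
  proof (rule card_UN_disjoint)
    show "\<forall>i\<in>?D. \<forall>j\<in>?D. i \<noteq> j \<longrightarrow> {x \<in> H \<inter> T1. f x - i \<in> K2} \<inter> {x \<in> H \<inter> T1. f x - j \<in> K2} = {}"
    proof (intro ballI impI)
      fix i j assume ij: "i \<in> ?D" "j \<in> ?D" "i \<noteq> j"
      have False if "f x - i \<in> K2" "f x - j \<in> K2" for x
        using ij transversal_inj[OF T2(1), of i j] add_subgroupD(2)[OF K2 that(2) that(1)] by simp
      then show "{x \<in> H \<inter> T1. f x - i \<in> K2} \<inter> {x \<in> H \<inter> T1. f x - j \<in> K2} = {}" by blast
    qed
  qed (use T1 T2 in auto)
  also have "\<dots> = (\<Sum>d\<in>?D. card {x \<in> H \<inter> T1. f x \<in> K2})"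
  proof (rule sum.cong[OF refl])
    fix d assume "d \<in> ?D"
    then obtain x0 where x0: "x0 \<in> H" "f x0 - d \<in> K2" by blast
    have "f x - d \<in> K2 \<longleftrightarrow> f x - f x0 \<in> K2" for x
      using add_subgroup_cong[OF K2, of "f x - d" "f x - f x0"] x0(2) by (simp add: algebra_simps)
    then show "card {x \<in> H \<inter> T1. f x - d \<in> K2} = card {x \<in> H \<inter> T1. f x \<in> K2}"
      using card_fibre[OF H K1 T1(1) f fK K2 x0(1)] by simp
  qed
  finally show ?thesis by simp
qed

section \<open>Matrix algebra over a commutative ring: determinant, trace form, commutators\<close>

section \<open>Three by three matrices\<close>

text \<open>The matrices in the theorem are arrays over a carrier-based ring.  The arguments below take
  place over a commutative ring that is a type, where its \<open>3 \<times> 3\<close> matrices can be made a type in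
  class \<^class>\<open>ring_1\<close>.\<close>

datatype 'a mat3 = Mat3 (m11: 'a) (m12: 'a) (m13: 'a) (m21: 'a) (m22: 'a) (m23: 'a)
  (m31: 'a) (m32: 'a) (m33: 'a)

instantiation mat3 :: (comm_ring_1) ring_1
begin

definition "0 = Mat3 0 0 0 0 0 0 0 0 0"
definition "1 = Mat3 1 0 0 0 1 0 0 0 1"
definition "X + Y = Mat3 (m11 X + m11 Y) (m12 X + m12 Y) (m13 X + m13 Y)
  (m21 X + m21 Y) (m22 X + m22 Y) (m23 X + m23 Y) (m31 X + m31 Y) (m32 X + m32 Y) (m33 X + m33 Y)"
definition "X - Y = Mat3 (m11 X - m11 Y) (m12 X - m12 Y) (m13 X - m13 Y)
  (m21 X - m21 Y) (m22 X - m22 Y) (m23 X - m23 Y) (m31 X - m31 Y) (m32 X - m32 Y) (m33 X - m33 Y)"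
definition "- X = Mat3 (- m11 X) (- m12 X) (- m13 X) (- m21 X) (- m22 X) (- m23 X)
  (- m31 X) (- m32 X) (- m33 X)"
definition "X * Y = Mat3
  (m11 X * m11 Y + m12 X * m21 Y + m13 X * m31 Y)
  (m11 X * m12 Y + m12 X * m22 Y + m13 X * m32 Y)
  (m11 X * m13 Y + m12 X * m23 Y + m13 X * m33 Y)
  (m21 X * m11 Y + m22 X * m21 Y + m23 X * m31 Y)
  (m21 X * m12 Y + m22 X * m22 Y + m23 X * m32 Y)
  (m21 X * m13 Y + m22 X * m23 Y + m23 X * m33 Y)
  (m31 X * m11 Y + m32 X * m21 Y + m33 X * m31 Y)
  (m31 X * m12 Y + m32 X * m22 Y + m33 X * m32 Y)
  (m31 X * m13 Y + m32 X * m23 Y + m33 X * m33 Y)"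

lemmas mat3_defs = zero_mat3_def one_mat3_def plus_mat3_def minus_mat3_def uminus_mat3_def times_mat3_def

instance
  by standard (simp_all add: mat3_defs algebra_simps)

end

lemma mat3_sel [simp]:
  fixes X Y :: "'a::comm_ring_1 mat3"
  shows "m11 (0::'a mat3) = 0" "m12 (0::'a mat3) = 0" "m13 (0::'a mat3) = 0"
    "m21 (0::'a mat3) = 0" "m22 (0::'a mat3) = 0" "m23 (0::'a mat3) = 0"
    "m31 (0::'a mat3) = 0" "m32 (0::'a mat3) = 0" "m33 (0::'a mat3) = 0"
    "m11 (1::'a mat3) = 1" "m12 (1::'a mat3) = 0" "m13 (1::'a mat3) = 0"
    "m21 (1::'a mat3) = 0" "m22 (1::'a mat3) = 1" "m23 (1::'a mat3) = 0"
    "m31 (1::'a mat3) = 0" "m32 (1::'a mat3) = 0" "m33 (1::'a mat3) = 1"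
    "m11 (X + Y) = m11 X + m11 Y" "m12 (X + Y) = m12 X + m12 Y" "m13 (X + Y) = m13 X + m13 Y"
    "m21 (X + Y) = m21 X + m21 Y" "m22 (X + Y) = m22 X + m22 Y" "m23 (X + Y) = m23 X + m23 Y"
    "m31 (X + Y) = m31 X + m31 Y" "m32 (X + Y) = m32 X + m32 Y" "m33 (X + Y) = m33 X + m33 Y"
    "m11 (X - Y) = m11 X - m11 Y" "m12 (X - Y) = m12 X - m12 Y" "m13 (X - Y) = m13 X - m13 Y"
    "m21 (X - Y) = m21 X - m21 Y" "m22 (X - Y) = m22 X - m22 Y" "m23 (X - Y) = m23 X - m23 Y"
    "m31 (X - Y) = m31 X - m31 Y" "m32 (X - Y) = m32 X - m32 Y" "m33 (X - Y) = m33 X - m33 Y"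
    "m11 (- X) = - m11 X" "m12 (- X) = - m12 X" "m13 (- X) = - m13 X"
    "m21 (- X) = - m21 X" "m22 (- X) = - m22 X" "m23 (- X) = - m23 X"
    "m31 (- X) = - m31 X" "m32 (- X) = - m32 X" "m33 (- X) = - m33 X"
    "m11 (X * Y) = m11 X * m11 Y + m12 X * m21 Y + m13 X * m31 Y"
    "m12 (X * Y) = m11 X * m12 Y + m12 X * m22 Y + m13 X * m32 Y"
    "m13 (X * Y) = m11 X * m13 Y + m12 X * m23 Y + m13 X * m33 Y"
    "m21 (X * Y) = m21 X * m11 Y + m22 X * m21 Y + m23 X * m31 Y"
    "m22 (X * Y) = m21 X * m12 Y + m22 X * m22 Y + m23 X * m32 Y"
    "m23 (X * Y) = m21 X * m13 Y + m22 X * m23 Y + m23 X * m33 Y"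
    "m31 (X * Y) = m31 X * m11 Y + m32 X * m21 Y + m33 X * m31 Y"
    "m32 (X * Y) = m31 X * m12 Y + m32 X * m22 Y + m33 X * m32 Y"
    "m33 (X * Y) = m31 X * m13 Y + m32 X * m23 Y + m33 X * m33 Y"
  by (simp_all add: mat3_defs)

lemma mat3_eq_iff: "X = Y \<longleftrightarrow> m11 X = m11 Y \<and> m12 X = m12 Y \<and> m13 X = m13 Y
  \<and> m21 X = m21 Y \<and> m22 X = m22 Y \<and> m23 X = m23 Y \<and> m31 X = m31 Y \<and> m32 X = m32 Y \<and> m33 X = m33 Y"
  by (cases X; cases Y) auto

definition sc :: "'a::comm_ring_1 \<Rightarrow> 'a mat3" where
  "sc c = Mat3 c 0 0 0 c 0 0 0 c"

lemma sc_sel [simp]: "m11 (sc c) = c" "m12 (sc c) = 0" "m13 (sc c) = 0" "m21 (sc c) = 0"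
  "m22 (sc c) = c" "m23 (sc c) = 0" "m31 (sc c) = 0" "m32 (sc c) = 0" "m33 (sc c) = c"
  by (simp_all add: sc_def)

lemma sc_0 [simp]: "sc 0 = 0" and sc_1 [simp]: "sc 1 = 1"
  and sc_add: "sc (a + b) = sc a + sc b" and sc_diff: "sc (a - b) = sc a - sc b"
  and sc_mult: "sc (a * b) = sc a * sc b"
  and sc_commute: "X * sc a = sc a * X"
  by (simp_all add: mat3_eq_iff algebra_simps)

lemma sc_left_commute: "X * (sc a * Y) = sc a * (X * Y)"
  by (metis mult.assoc sc_commute)

definition tr3 :: "'a::comm_ring_1 mat3 \<Rightarrow> 'a" where
  "tr3 X = m11 X + m22 X + m33 X"

lemma tr3_0 [simp]: "tr3 0 = 0" and tr3_add: "tr3 (X + Y) = tr3 X + tr3 Y" and tr3_diff: "tr3 (X - Y) = tr3 X - tr3 Y"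
  and tr3_commute: "tr3 (X * Y) = tr3 (Y * X)"
  by (simp_all add: tr3_def algebra_simps)

definition det3 :: "'a::comm_ring_1 mat3 \<Rightarrow> 'a" where
  "det3 X = m11 X * (m22 X * m33 X - m23 X * m32 X) - m12 X * (m21 X * m33 X - m23 X * m31 X)
    + m13 X * (m21 X * m32 X - m22 X * m31 X)"

lemma det3_mult: "det3 (X * Y) = det3 X * det3 Y"
  by (simp add: det3_def algebra_simps)

lemma det3_1 [simp]: "det3 1 = 1"
  by (simp add: det3_def)

definition adj3 :: "'a::comm_ring_1 mat3 \<Rightarrow> 'a mat3" where
  "adj3 X = Mat3
    (m22 X * m33 X - m23 X * m32 X) (m13 X * m32 X - m12 X * m33 X) (m12 X * m23 X - m13 X * m22 X)
    (m23 X * m31 X - m21 X * m33 X) (m11 X * m33 X - m13 X * m31 X) (m13 X * m21 X - m11 X * m23 X)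
    (m21 X * m32 X - m22 X * m31 X) (m12 X * m31 X - m11 X * m32 X) (m11 X * m22 X - m12 X * m21 X)"

lemma adj3: "X * adj3 X = sc (det3 X)" "adj3 X * X = sc (det3 X)"
  by (simp_all add: mat3_eq_iff adj3_def det3_def algebra_simps)

definition comm :: "'a::ring \<Rightarrow> 'a \<Rightarrow> 'a" where
  "comm X Y = X * Y - Y * X"

lemma comm_add_left: "comm (X + Y) Z = comm X Z + comm Y Z"
  and comm_add_right: "comm X (Y + Z) = comm X Y + comm X Z"
  and comm_diff_left: "comm (X - Y) Z = comm X Z - comm Y Z"
  and comm_diff_right: "comm X (Y - Z) = comm X Y - comm X Z"
  and comm_self [simp]: "comm X X = 0"
  and comm_anti: "comm X Y = - comm Y X"
  by (simp_all add: comm_def algebra_simps)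

lemma comm_sc_mult_left: "comm (sc a * X) Y = sc a * comm X Y"
  and comm_sc_mult_right: "comm X (sc a * Y) = sc a * comm X Y"
  and comm_sc [simp]: "comm (sc a) X = 0" "comm X (sc a) = 0"
  and comm_zero [simp]: "comm X 0 = 0" "comm 0 X = 0"
  and comm_one [simp]: "comm X 1 = 0" "comm 1 X = 0"
  by (simp_all add: comm_def mat3_eq_iff algebra_simps)

text \<open>This makes the kernel of \<open>comm a\<close> orthogonal to its image.\<close>

lemma tr3_comm: "tr3 (comm X Y * Z) = tr3 (X * comm Y Z)"
  by (simp add: comm_def tr3_def algebra_simps)

definition mat3_of :: "'a set \<Rightarrow> 'a mat3 set" where
  "mat3_of I = {X. m11 X \<in> I \<and> m12 X \<in> I \<and> m13 X \<in> I \<and> m21 X \<in> I \<and> m22 X \<in> I \<and> m23 X \<in> I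
    \<and> m31 X \<in> I \<and> m32 X \<in> I \<and> m33 X \<in> I}"

lemma mat3_of_image:
  "mat3_of I = (\<lambda>(a,b,c,d,e,f,g,h,i). Mat3 a b c d e f g h i) ` (I \<times> I \<times> I \<times> I \<times> I \<times> I \<times> I \<times> I \<times> I)"
proof (intro equalityI subsetI)
  fix X assume "X \<in> mat3_of I"
  then show "X \<in> (\<lambda>(a,b,c,d,e,f,g,h,i). Mat3 a b c d e f g h i) ` (I \<times> I \<times> I \<times> I \<times> I \<times> I \<times> I \<times> I \<times> I)"
    by (intro image_eqI[where x = "(m11 X, m12 X, m13 X, m21 X, m22 X, m23 X, m31 X, m32 X, m33 X)"])
       (auto simp: mat3_of_def)
qed (auto simp: mat3_of_def)

lemma inj_Mat3: "inj_on (\<lambda>(a,b,c,d,e,f,g,h,i). Mat3 a b c d e f g h i) A"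
  by (auto simp: inj_on_def)

lemma finite_mat3_of: "finite I \<Longrightarrow> finite (mat3_of I)"
  by (simp add: mat3_of_image)

lemma card_mat3_of: "finite I \<Longrightarrow> card (mat3_of I) = card I ^ 9"
  by (simp add: mat3_of_image card_image[OF inj_Mat3] card_cartesian_product eval_nat_numeral mult.assoc)

lemma add_subgroup_mat3_of: "add_subgroup I \<Longrightarrow> add_subgroup (mat3_of (I :: 'a::comm_ring_1 set))"
  by (auto simp: add_subgroup_def mat3_of_def)

lemma transversal_mat3_of:
  fixes K :: "'a::comm_ring_1 set"
  assumes "transversal K T"
  shows "transversal (mat3_of K) (mat3_of T)"
proof -
  have "\<exists>!t. t \<in> mat3_of T \<and> x - t \<in> mat3_of K" for x :: "'a mat3"
  proof (rule ex1I)
    let ?r = "rep K T"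
    show "Mat3 (?r (m11 x)) (?r (m12 x)) (?r (m13 x)) (?r (m21 x)) (?r (m22 x)) (?r (m23 x))
        (?r (m31 x)) (?r (m32 x)) (?r (m33 x)) \<in> mat3_of T \<and> x - Mat3 (?r (m11 x)) (?r (m12 x)) (?r (m13 x))
        (?r (m21 x)) (?r (m22 x)) (?r (m23 x)) (?r (m31 x)) (?r (m32 x)) (?r (m33 x)) \<in> mat3_of K"
      using rep[OF assms] by (simp add: mat3_of_def)
  next
    fix t assume "t \<in> mat3_of T \<and> x - t \<in> mat3_of K"
    then show "t = Mat3 (rep K T (m11 x)) (rep K T (m12 x)) (rep K T (m13 x)) (rep K T (m21 x))
        (rep K T (m22 x)) (rep K T (m23 x)) (rep K T (m31 x)) (rep K T (m32 x)) (rep K T (m33 x))"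
      by (simp add: mat3_of_def mat3_eq_iff rep_eqI[OF assms, symmetric])
  qed
  then show ?thesis
    using add_subgroup_mat3_of transversal_subgroup[OF assms] by (auto simp: transversal_def)
qed

section \<open>Ideals, digit expansions and centralizers over a finite chain ring\<close>

section \<open>The levels of a local principal ideal ring\<close>

text \<open>The ideal K + (p^k), the preimage of the k-th power of the maximal ideal of the quotient
  by \<open>K\<close>.\<close>

definition lev :: "'a::comm_ring_1 set \<Rightarrow> 'a \<Rightarrow> nat \<Rightarrow> 'a set" where
  "lev K p k = {x. \<exists>y. x - p ^ k * y \<in> K}"

text \<open>The quotient by the ideal \<open>K\<close> is a local ring whose maximal ideal is
  generated by \<open>p\<close> and has exact nilpotency index \<open>L\<close>; \<open>S\<close>
  represents the residue field. Equality in this ring is congruence modulo \<open>J L\<close>, which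
  is \<open>K\<close>.\<close>

locale level_ring =
  fixes K :: "'a::comm_ring_1 set" and p :: 'a and L :: nat and S :: "'a set"
  assumes K_subgroup: "add_subgroup K"
    and K_mult: "x \<in> K \<Longrightarrow> a * x \<in> K"
    and L_pos: "1 \<le> L"
    and p_L: "p ^ L \<in> K" and p_L1: "p ^ (L - 1) \<notin> K"
    and lev1_inverse: "x \<notin> lev K p 1 \<Longrightarrow> \<exists>y. x * y - 1 \<in> lev K p 1"
    and S_transversal: "transversal (lev K p 1) S" and S_finite: "finite S" and S_0: "0 \<in> S"
begin

abbreviation J :: "nat \<Rightarrow> 'a set" where "J \<equiv> lev K p"

abbreviation q :: nat where "q \<equiv> card S"

lemma K_J: "x \<in> K \<Longrightarrow> x \<in> J k"
  by (auto simp: lev_def intro!: exI[of _ 0])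

lemma JI: "x - p ^ k * y \<in> K \<Longrightarrow> x \<in> J k"
  by (auto simp: lev_def)

lemma p_J [simp]: "p ^ k * y \<in> J k"
  by (rule JI[of _ _ y]) (simp add: add_subgroupD[OF K_subgroup])

lemma J_0 [simp]: "J 0 = UNIV"
proof -
  have "x - p ^ 0 * x \<in> K" for x using add_subgroupD(1)[OF K_subgroup] by simp
  then show ?thesis unfolding lev_def by blast
qed

lemma J_subgroup: "add_subgroup (J k)"
  unfolding add_subgroup_def
proof (intro conjI ballI)
  show "0 \<in> J k" by (rule K_J) (simp add: add_subgroupD[OF K_subgroup])
  fix x y assume "x \<in> J k" "y \<in> J k"
  then obtain u v where "x - p ^ k * u \<in> K" "y - p ^ k * v \<in> K" by (auto simp: lev_def)
  from add_subgroupD(2)[OF K_subgroup this] show "x - y \<in> J k"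
    by (intro JI[of _ _ "u - v"]) (simp add: algebra_simps)
qed

lemmas J_closed = add_subgroupD[OF J_subgroup]
lemmas J_cong = add_subgroup_cong[OF J_subgroup]

lemma J_mult: "x \<in> J k \<Longrightarrow> a * x \<in> J k"
proof -
  assume "x \<in> J k"
  then obtain u where "x - p ^ k * u \<in> K" by (auto simp: lev_def)
  from K_mult[OF this, of a] show ?thesis
    by (intro JI[of _ _ "a * u"]) (simp add: algebra_simps)
qed

lemma J_mult2: "x \<in> J k \<Longrightarrow> x * a \<in> J k"
  using J_mult[of x k a] by (simp add: mult.commute)

lemma J_prod: "x \<in> J k \<Longrightarrow> y \<in> J l \<Longrightarrow> x * y \<in> J (k + l)"
proof -
  assume "x \<in> J k" "y \<in> J l"
  then obtain u v where uv: "x - p ^ k * u \<in> K" "y - p ^ l * v \<in> K" by (auto simp: lev_def)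
  have "y * (x - p ^ k * u) + p ^ k * u * (y - p ^ l * v) \<in> K"
    using uv by (intro add_subgroupD(4)[OF K_subgroup] K_mult)
  then show ?thesis
    by (intro JI[of _ _ "u * v"]) (simp add: algebra_simps power_add)
qed

lemma J_anti: "k \<le> l \<Longrightarrow> x \<in> J l \<Longrightarrow> x \<in> J k"
proof -
  assume "k \<le> l" "x \<in> J l"
  then obtain m y where "l = k + m" "x - p ^ l * y \<in> K" by (auto simp: lev_def le_iff_add)
  then show ?thesis by (intro JI[of _ _ "p ^ m * y"]) (simp add: power_add mult.assoc)
qed

lemma J_L: "J L = K"
proof (intro equalityI subsetI)
  fix x assume "x \<in> J L"
  then obtain u where u: "x - p ^ L * u \<in> K" by (auto simp: lev_def)
  have "u * p ^ L \<in> K" by (rule K_mult[OF p_L])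
  from add_subgroupD(4)[OF K_subgroup u this] show "x \<in> K" by (simp add: mult.commute)
qed (rule K_J)

lemma J_decompose: "x \<in> J k \<Longrightarrow> \<exists>y. x - p ^ k * y \<in> K"
  by (auto simp: lev_def)

text \<open>Otherwise \<open>x\<close> would be invertible modulo \<open>J 1\<close> and
  \<open>p ^ k\<close> would lie in \<open>J (Suc k)\<close>. Substituting this membership into
  itself pushes \<open>p ^ k\<close> into every later level, hence into \<open>K\<close>, although
  p^(L-1) lies outside.\<close>

lemma J_cancel1:
  assumes "k < L" "p ^ k * x \<in> J (Suc k)"
  shows "x \<in> J 1"
proof (rule ccontr)
  assume "x \<notin> J 1"
  then obtain y where y: "x * y - 1 \<in> J 1" using lev1_inverse by blast
  have "p ^ k * (x * y - 1) \<in> J (k + 1)"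
    using p_J[of k 1] y by (intro J_prod) auto
  then have "y * (p ^ k * x) - p ^ k * (x * y - 1) \<in> J (Suc k)"
    using J_mult[OF assms(2), of y] by (intro J_closed) auto
  then have *: "p ^ k \<in> J (Suc k)" by (simp add: algebra_simps)
  have "p ^ k \<in> J (k + m)" for m
  proof (induction m)
    case 0
    show ?case using p_J[of k 1] by simp
  next
    case (Suc m)
    from * obtain u where "p ^ k - p ^ Suc k * u \<in> K" by (auto simp: lev_def)
    then have "p ^ k - p ^ Suc k * u \<in> J (k + Suc m)" by (rule K_J)
    moreover have "p ^ 1 * u * p ^ k \<in> J (1 + (k + m))"
      by (rule J_prod[OF p_J Suc])
    ultimately have "(p ^ k - p ^ Suc k * u) + p ^ 1 * u * p ^ k \<in> J (k + Suc m)"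
      using J_closed(4)[of "p ^ k - p ^ Suc k * u" "k + Suc m" "p ^ 1 * u * p ^ k"] by simp
    then show ?case by (simp add: algebra_simps)
  qed
  from this[of "L - k"] assms(1) have "p ^ k \<in> K" using J_L by simp
  then have "p ^ (L - 1 - k) * p ^ k \<in> K" by (rule K_mult)
  then show False using assms(1) p_L1 by (simp flip: power_add)
qed

lemma J_cancel:
  assumes "k + l \<le> L" "p ^ k * x \<in> J (k + l)"
  shows "x \<in> J l"
  using assms
proof (induction l)
  case (Suc l)
  then have "x \<in> J l" using J_anti[of "k + l" "k + Suc l"] by auto
  then obtain y where y: "x - p ^ l * y \<in> K" using J_decompose by blast
  have "p ^ k * x - p ^ k * (x - p ^ l * y) \<in> J (k + Suc l)"
    using Suc.prems(2) K_J[OF K_mult[OF y]] by (intro J_closed)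
  then have "p ^ (k + l) * y \<in> J (Suc (k + l))" by (simp add: algebra_simps power_add)
  then have "y \<in> J 1" using Suc.prems(1) by (intro J_cancel1[of "k + l"]) auto
  then have "p ^ l * y \<in> J (l + 1)" using p_J[of l 1] by (intro J_prod) auto
  then have "(x - p ^ l * y) + p ^ l * y \<in> J (Suc l)" using K_J[OF y] by (intro J_closed(4)) auto
  then show ?case by simp
qed simp

lemma J_scale: "x \<in> J l \<Longrightarrow> p ^ k * x \<in> J (k + l)"
  using p_J[of k 1] by (intro J_prod) auto

lemma J_scale_iff: "k + l \<le> L \<Longrightarrow> p ^ k * x \<in> J (k + l) \<longleftrightarrow> x \<in> J l"
  using J_cancel J_scale by blast

lemma one_notin_J1: "1 \<notin> J 1"
proof
  assume "1 \<in> J 1"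
  then have "p ^ (L - 1) * 1 \<in> J (L - 1 + 1)" by (rule J_scale)
  then show False using p_L1 L_pos J_L by simp
qed

lemma J1_prime: "x * y \<in> J 1 \<longleftrightarrow> x \<in> J 1 \<or> y \<in> J 1"
proof
  assume xy: "x * y \<in> J 1"
  show "x \<in> J 1 \<or> y \<in> J 1"
  proof (rule ccontr)
    assume "\<not> (x \<in> J 1 \<or> y \<in> J 1)"
    then obtain x' y' where "x * x' - 1 \<in> J 1" "y * y' - 1 \<in> J 1" using lev1_inverse by blast
    then have "x' * y' * (x * y) - ((y * y') * (x * x' - 1) + (y * y' - 1)) \<in> J 1"
      using J_closed(2)[OF J_mult[OF xy] J_closed(4)[OF J_mult]] by blast
    then show False using one_notin_J1 by (simp add: algebra_simps)
  qed
qed (auto intro: J_mult J_mult2)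

text \<open>Newton iteration: replacing y by y(2 - xy) turns the error xy - 1 into minus its square,
  so \<open>L - 1\<close> steps from an inverse modulo \<open>J 1\<close> reach
  \<open>K\<close>.\<close>

lemma unit_inverse:
  assumes "x \<notin> J 1"
  shows "\<exists>y. x * y - 1 \<in> K"
proof -
  have "\<exists>y. x * y - 1 \<in> J (Suc k)" for k
  proof (induction k)
    case (Suc k)
    then obtain y where y: "x * y - 1 \<in> J (Suc k)" by blast
    then have "(x * y - 1) * (x * y - 1) \<in> J (Suc k + Suc k)" by (intro J_prod)
    then have "- ((x * y - 1) * (x * y - 1)) \<in> J (Suc (Suc k))" by (intro J_closed J_anti[of "Suc (Suc k)" "Suc k + Suc k"]) auto
    moreover have "x * (y * (2 - x * y)) - 1 = - ((x * y - 1) * (x * y - 1))" by (simp add: algebra_simps)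
    ultimately have "x * (y * (2 - x * y)) - 1 \<in> J (Suc (Suc k))" by (metis (no_types))
    then show ?case by blast
  qed (use lev1_inverse[OF assms] in simp)
  from this[of "L - 1"] show ?thesis using L_pos J_L by simp
qed

subsection \<open>Digit expansions\<close>

fun dig :: "nat \<Rightarrow> 'a set" where
  "dig 0 = {0}"
| "dig (Suc k) = (\<lambda>(s, t). s + p * t) ` (S \<times> dig k)"

lemma dig_1: "dig 1 = S"
  by (auto simp: image_iff)

lemma finite_dig: "finite (dig k)"
  by (induction k) (auto simp: S_finite)

lemma zero_dig: "0 \<in> dig k"
  by (induction k) (use S_0 in \<open>force+\<close>)

lemma dig_transversal: "k \<le> L \<Longrightarrow> transversal (J k) (dig k)"
proof (induction k)
  case (Suc k)
  have IH: "transversal (J k) (dig k)" using Suc by simp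
  have "\<exists>!t. t \<in> dig (Suc k) \<and> x - t \<in> J (Suc k)" for x
  proof -
    obtain s where s: "s \<in> S" "x - s \<in> J 1" using rep[OF S_transversal] by blast
    obtain y where y: "x - s - p * y \<in> K" using J_decompose[OF s(2)] by auto
    obtain t where t: "t \<in> dig k" "y - t \<in> J k" using rep[OF IH] by blast
    have "p ^ 1 * (y - t) \<in> J (1 + k)" by (intro J_scale t)
    then have "(x - s - p * y) + p ^ 1 * (y - t) \<in> J (Suc k)" using K_J[OF y] by (intro J_closed(4)) auto
    then have ex: "x - (s + p * t) \<in> J (Suc k)" by (simp add: algebra_simps)
    show ?thesis
    proof (rule ex1I)
      show "s + p * t \<in> dig (Suc k) \<and> x - (s + p * t) \<in> J (Suc k)" using ex s t by force
    next
      fix w assume w: "w \<in> dig (Suc k) \<and> x - w \<in> J (Suc k)"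
      then obtain s' t' where w': "w = s' + p * t'" "s' \<in> S" "t' \<in> dig k" by auto
      have d: "(x - (s + p * t)) - (x - w) \<in> J (Suc k)" using J_closed(2)[OF ex] w by blast
      then have "(x - (s + p * t)) - (x - w) + p ^ 1 * (t - t') \<in> J 1"
        by (intro J_closed(4) p_J J_anti[OF _ d]) auto
      then have "s' - s \<in> J 1" by (simp add: w' algebra_simps)
      then have ss: "s' = s" using w'(2) s(1) transversal_inj[OF S_transversal, of s' s] by simp
      have "p ^ 1 * (t' - t) \<in> J (1 + k)" using d by (simp add: w' ss algebra_simps)
      then have "t' - t \<in> J k" using Suc.prems J_cancel[of 1 k] by simp
      then show "w = s + p * t" using w'(1,3) t(1) transversal_inj[OF IH, of t' t] ss by simp
    qed
  qed
  then show ?case using J_subgroup by (auto simp: transversal_def)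
qed (auto simp: transversal_def add_subgroup_def)

text \<open>The definition adds the new digit at the low end, which suits reduction modulo p; lifts
  to the next level need it at the high end.\<close>

lemma dig_Suc': "dig (Suc k) = (\<lambda>(s, t). s + p ^ k * t) ` (dig k \<times> S)"
proof (induction k)
  case 0
  show ?case by (auto simp: image_iff)
next
  case (Suc k)
  have iff: "x \<in> dig (Suc k) \<longleftrightarrow> (\<exists>t\<in>dig k. \<exists>u\<in>S. x = t + p ^ k * u)" for x
    unfolding Suc by auto
  have "x \<in> dig (Suc (Suc k)) \<longleftrightarrow> (\<exists>s\<in>S. \<exists>y\<in>dig (Suc k). x = s + p * y)" for x
    by (subst dig.simps(2)) auto
  moreover have "(\<exists>s\<in>S. \<exists>y\<in>dig (Suc k). x = s + p * y)
      \<longleftrightarrow> (\<exists>s\<in>S. \<exists>t\<in>dig k. \<exists>u\<in>S. x = s + p * (t + p ^ k * u))" for x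
    unfolding Bex_def iff by metis
  moreover have "s + p * (t + p ^ k * u) = (s + p * t) + p ^ Suc k * u" for s t u
    by (simp add: algebra_simps)
  moreover have "x \<in> dig (Suc k) \<longleftrightarrow> (\<exists>s\<in>S. \<exists>t\<in>dig k. x = s + p * t)" for x
    by (subst dig.simps(2)) auto
  ultimately have "x \<in> dig (Suc (Suc k)) \<longleftrightarrow> (\<exists>y\<in>dig (Suc k). \<exists>u\<in>S. x = y + p ^ Suc k * u)" for x
    unfolding Bex_def by metis
  then show ?case by (force simp del: dig.simps power_Suc)
qed

lemma bij_dig: "k < L \<Longrightarrow> bij_betw (\<lambda>(s, t). s + p ^ k * t) (dig k \<times> S) (dig (Suc k))"
  unfolding bij_betw_def
proof
  assume k: "k < L"
  have "s = s' \<and> t = t'" if st: "s \<in> dig k" "s' \<in> dig k" "t \<in> S" "t' \<in> S" and e: "s + p ^ k * t = s' + p ^ k * t'"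
    for s s' t t'
  proof -
    have "s - s' = p ^ k * (t' - t)" using e by (simp add: algebra_simps)
    then have s: "s = s'" using transversal_inj[OF dig_transversal[of k] st(1,2)] k by simp
    have "p ^ k * (t - t') = 0" using e s by (simp add: algebra_simps)
    then have "p ^ k * (t - t') \<in> J (Suc k)" using J_closed(1) by simp
    then show ?thesis using s transversal_inj[OF S_transversal st(3,4)] J_cancel1[OF k] by blast
  qed
  then show "inj_on (\<lambda>(s, t). s + p ^ k * t) (dig k \<times> S)" by (auto simp: inj_on_def)
qed (simp only: dig_Suc')

lemma card_dig: "k \<le> L \<Longrightarrow> card (dig k) = q ^ k"
proof (induction k)
  case (Suc k)
  then show ?case
    using bij_betw_same_card[OF bij_dig[of k]] by (simp add: card_cartesian_product mult.commute del: dig.simps)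
qed simp

text \<open>Here \<open>0 \<in> S\<close> matters: the lowest digit of a representative divisible by
  \<open>p\<close> represents the zero residue and so is 0 itself.\<close>

lemma dig_Suc_J1: "k < L \<Longrightarrow> dig (Suc k) \<inter> J 1 = (*) p ` dig k"
proof (intro equalityI subsetI)
  fix x assume k: "k < L" and x: "x \<in> dig (Suc k) \<inter> J 1"
  then obtain s t where st: "x = s + p * t" "s \<in> S" "t \<in> dig k" by auto
  have "x - p ^ 1 * t \<in> J 1" using x by (intro J_closed p_J) auto
  then have "s - 0 \<in> J 1" using st by simp
  then have "s = 0" using st S_0 transversal_inj[OF S_transversal] by blast
  then show "x \<in> (*) p ` dig k" using st by simp
next
  fix x assume "x \<in> (*) p ` dig k"
  then obtain t where t: "x = p * t" "t \<in> dig k" by auto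
  then show "x \<in> dig (Suc k) \<inter> J 1" using S_0 p_J[of 1 t] by force
qed

subsection \<open>Matrices modulo the levels\<close>

abbreviation JJ :: "nat \<Rightarrow> 'a mat3 set" where "JJ k \<equiv> mat3_of (J k)"
abbreviation Dig :: "nat \<Rightarrow> 'a mat3 set" where "Dig k \<equiv> mat3_of (dig k)"

lemma mat3_of_UNIV [simp]: "mat3_of UNIV = UNIV"
  by (auto simp: mat3_of_def)

lemma JJ_subgroup: "add_subgroup (JJ k)"
  by (intro add_subgroup_mat3_of J_subgroup)

lemmas JJ_closed = add_subgroupD[OF JJ_subgroup]
lemmas JJ_cong = add_subgroup_cong[OF JJ_subgroup]

lemma JJ_prod: "X \<in> JJ k \<Longrightarrow> Y \<in> JJ l \<Longrightarrow> X * Y \<in> JJ (k + l)"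
  by (auto simp: mat3_of_def intro!: J_closed J_prod)

lemma JJ_mult: "X \<in> JJ k \<Longrightarrow> A * X \<in> JJ k" and JJ_mult2: "X \<in> JJ k \<Longrightarrow> X * A \<in> JJ k"
  using JJ_prod[of A 0 X k] JJ_prod[of X k A 0] by simp_all

lemma JJ_comm: "X \<in> JJ k \<Longrightarrow> Y \<in> JJ l \<Longrightarrow> comm X Y \<in> JJ (k + l)"
  unfolding comm_def using JJ_prod[of X k Y l] JJ_prod[of Y l X k] by (auto intro!: JJ_closed simp: add.commute)

lemma JJ_comm_left: "X \<in> JJ k \<Longrightarrow> comm X Y \<in> JJ k"
  and JJ_comm_right: "X \<in> JJ k \<Longrightarrow> comm Y X \<in> JJ k"
  using JJ_comm[of X k Y 0] JJ_comm[of Y 0 X k] by simp_all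

lemma JJ_anti: "k \<le> l \<Longrightarrow> X \<in> JJ l \<Longrightarrow> X \<in> JJ k"
  using J_anti by (auto simp: mat3_of_def)

lemma sc_JJ: "a \<in> J k \<Longrightarrow> sc a \<in> JJ k"
  using J_closed(1) by (auto simp: mat3_of_def)

lemma sc_JJ_iff: "sc a \<in> JJ k \<longleftrightarrow> a \<in> J k"
  using J_closed(1) by (auto simp: mat3_of_def)

lemma sc_mult_JJ: "a \<in> J k \<Longrightarrow> sc a * X \<in> JJ k"
  using sc_JJ JJ_mult2 by blast

lemma JJ_scale_iff: "k + l \<le> L \<Longrightarrow> sc (p ^ k) * X \<in> JJ (k + l) \<longleftrightarrow> X \<in> JJ l"
  by (simp add: mat3_of_def J_scale_iff)

lemma JJ_scale: "X \<in> JJ l \<Longrightarrow> sc (p ^ k) * X \<in> JJ (k + l)"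
  by (simp add: mat3_of_def J_scale)

lemma pJJ: "sc (p ^ k) * X \<in> JJ k"
  by (simp add: mat3_of_def)

lemma JJ_decompose:
  assumes "X \<in> JJ k"
  obtains Y where "X - sc (p ^ k) * Y \<in> JJ L"
proof -
  have "\<forall>x\<in>J k. \<exists>y. x - p ^ k * y \<in> J L" using J_decompose J_L by auto
  then obtain d where d: "\<And>x. x \<in> J k \<Longrightarrow> x - p ^ k * d x \<in> J L" by metis
  show ?thesis
    by (rule that[of "Mat3 (d (m11 X)) (d (m12 X)) (d (m13 X)) (d (m21 X)) (d (m22 X)) (d (m23 X))
      (d (m31 X)) (d (m32 X)) (d (m33 X))"]) (use assms in \<open>simp add: mat3_of_def d\<close>)
qed

lemma tr3_J: "X \<in> JJ k \<Longrightarrow> tr3 X \<in> J k"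
  unfolding tr3_def by (intro J_closed) (auto simp: mat3_of_def)

lemma Dig_transversal: "k \<le> L \<Longrightarrow> transversal (JJ k) (Dig k)"
  by (intro transversal_mat3_of dig_transversal)

lemma finite_Dig: "finite (Dig k)"
  by (intro finite_mat3_of finite_dig)

lemma card_Dig: "k \<le> L \<Longrightarrow> card (Dig k) = q ^ (9 * k)"
  by (simp add: card_mat3_of finite_dig card_dig power_mult[symmetric] mult.commute)

lemmas Dig1_transversal = Dig_transversal[OF L_pos]

text \<open>Splits a representative at level k+1 into its reduction and the coefficient of p^k.
  Surjectivity follows from injectivity, since both sides have q^(9(k+1)) elements.\<close>

lemma bij_Dig:
  assumes k: "k < L"
  shows "bij_betw (\<lambda>(X, Y). X + sc (p ^ k) * Y) (Dig k \<times> Dig 1) (Dig (Suc k))"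
proof -
  have inj: "inj_on (\<lambda>(X, Y). X + sc (p ^ k) * Y) (Dig k \<times> Dig 1)"
  proof (intro inj_onI, clarify)
    fix X Y X' Y' assume X: "X \<in> Dig k" "X' \<in> Dig k" and Y: "Y \<in> Dig 1" "Y' \<in> Dig 1"
      and e: "X + sc (p ^ k) * Y = X' + sc (p ^ k) * Y'"
    have "X - X' = sc (p ^ k) * (Y' - Y)" using e by (simp add: algebra_simps)
    then have XX: "X = X'" using transversal_inj[OF Dig_transversal[of k] X] pJJ k by simp
    have "sc (p ^ k) * (Y - Y') \<in> JJ (k + 1)" using e XX JJ_closed(1) by (simp add: algebra_simps)
    then show "X = X' \<and> Y = Y'"
      using XX transversal_inj[OF Dig1_transversal Y] k JJ_scale_iff[of k 1] by simp
  qed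
  have sub: "(\<lambda>(X, Y). X + sc (p ^ k) * Y) ` (Dig k \<times> Dig 1) \<subseteq> Dig (Suc k)"
    unfolding dig_1 by (clarsimp simp: mat3_of_def simp del: dig.simps) (auto simp: dig_Suc' simp del: dig.simps)
  have "card (Dig k \<times> Dig 1) = card (Dig (Suc k))"
    using k L_pos by (simp add: card_cartesian_product card_Dig power_add del: dig.simps One_nat_def)
  then show ?thesis
    using inj sub card_image[OF inj] card_subset_eq[OF finite_Dig sub] by (auto simp: bij_betw_def)
qed

lemma sum_Dig_Suc:
  assumes "k < L"
  shows "(\<Sum>a\<in>Dig (Suc k). F a) = (\<Sum>a\<in>Dig k. \<Sum>b\<in>Dig 1. F (a + sc (p ^ k) * b))"
proof -
  have "(\<Sum>a\<in>Dig (Suc k). F a) = (\<Sum>(a, b)\<in>Dig k \<times> Dig 1. F (a + sc (p ^ k) * b))"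
    by (subst sum.reindex_bij_betw[OF bij_Dig[OF assms], symmetric]) (simp add: case_prod_unfold)
  then show ?thesis by (simp add: sum.cartesian_product)
qed

lemma Dig_Suc_JJ1:
  assumes k: "k < L"
  shows "Dig (Suc k) \<inter> JJ 1 = (\<lambda>X. sc p * X) ` Dig k"
proof -
  have "\<forall>x\<in>dig (Suc k) \<inter> J 1. \<exists>y\<in>dig k. x = p * y" using dig_Suc_J1[OF k] by auto
  then obtain d where d: "\<And>x. x \<in> dig (Suc k) \<Longrightarrow> x \<in> J 1 \<Longrightarrow> d x \<in> dig k \<and> x = p * d x" by (metis IntI)
  show ?thesis
  proof (intro equalityI subsetI)
    fix X assume X: "X \<in> Dig (Suc k) \<inter> JJ 1"
    show "X \<in> (\<lambda>X. sc p * X) ` Dig k"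
      by (rule image_eqI[of _ _ "Mat3 (d (m11 X)) (d (m12 X)) (d (m13 X)) (d (m21 X)) (d (m22 X)) (d (m23 X))
          (d (m31 X)) (d (m32 X)) (d (m33 X))"])
        (use X d in \<open>auto simp: mat3_of_def mat3_eq_iff simp del: dig.simps\<close>)
  next
    fix X assume "X \<in> (\<lambda>X. sc p * X) ` Dig k"
    moreover have "p * x \<in> dig (Suc k) \<inter> J 1" if "x \<in> dig k" for x using dig_Suc_J1[OF k] that by blast
    ultimately show "X \<in> Dig (Suc k) \<inter> JJ 1" by (auto simp: mat3_of_def simp del: dig.simps)
  qed
qed

lemma inj_scale_Dig:
  assumes k: "k < L"
  shows "inj_on (\<lambda>X. sc p * X) (Dig k)"
proof (rule inj_onI)
  fix X Y assume XY: "X \<in> Dig k" "Y \<in> Dig k" "sc p * X = sc p * Y"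
  then have "sc (p ^ 1) * (X - Y) \<in> JJ (1 + k)" using JJ_closed(1) by (simp add: algebra_simps)
  then show "X = Y" using XY transversal_inj[OF Dig_transversal[of k]] k by (simp only: JJ_scale_iff)
qed

subsection \<open>Centralizers\<close>

text \<open>A matrix is invertible modulo a positive level iff its determinant is a unit of the
  residue field, so a single set serves all levels.\<close>

definition GL :: "'a mat3 set" where
  "GL = {X. det3 X \<notin> J 1}"

definition cent :: "nat \<Rightarrow> 'a mat3 \<Rightarrow> 'a mat3 set" where
  "cent k a = {X. comm X a \<in> JJ k}"

text \<open>The set C(a) of the overview, stored as its full preimage among all matrices and hence
  closed under adding elements of \<open>JJ 1\<close>.\<close>

definition rcent :: "nat \<Rightarrow> 'a mat3 \<Rightarrow> 'a mat3 set" where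
  "rcent k a = {X. \<exists>Y\<in>cent k a. X - Y \<in> JJ 1}"

definition ncent :: "nat \<Rightarrow> 'a mat3 \<Rightarrow> nat" where
  "ncent k a = card (cent k a \<inter> Dig k)"

definition ngcent :: "nat \<Rightarrow> 'a mat3 \<Rightarrow> nat" where
  "ngcent k a = card (cent k a \<inter> Dig k \<inter> GL)"

lemma det3_cong: "X - Y \<in> JJ k \<Longrightarrow> det3 X - det3 Y \<in> J k"
proof -
  assume d: "X - Y \<in> JJ k"
  have c: "a * b - a' * b' \<in> J k" if "a - a' \<in> J k" "b - b' \<in> J k" for a b a' b'
  proof -
    have "b * (a - a') + a' * (b - b') \<in> J k" using that by (intro J_closed(4) J_mult)
    then show ?thesis by (simp add: algebra_simps)
  qed
  have m: "(a - b) - (a' - b') \<in> J k" if "a - a' \<in> J k" "b - b' \<in> J k" for a b a' b'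
    using J_closed(2)[OF that] by (simp add: algebra_simps)
  have p: "(a + b) - (a' + b') \<in> J k" if "a - a' \<in> J k" "b - b' \<in> J k" for a b a' b'
    using J_closed(4)[OF that] by (simp add: algebra_simps)
  show ?thesis
    unfolding det3_def using d by (intro c m p) (auto simp: mat3_of_def)
qed

lemma GL_cong: "X - Y \<in> JJ 1 \<Longrightarrow> X \<in> GL \<longleftrightarrow> Y \<in> GL"
  using J_cong[OF det3_cong] by (simp add: GL_def)

lemma cent_subgroup: "add_subgroup (cent k a)"
  using JJ_closed(1,2) by (auto simp only: add_subgroup_def cent_def comm_diff_left comm_zero mem_Collect_eq)

lemma JJ_cent: "X \<in> JJ k \<Longrightarrow> X \<in> cent k a"
  by (simp add: cent_def JJ_comm_left)

lemma cent_sc: "X \<in> cent k a \<Longrightarrow> sc c * X \<in> cent k a"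
  by (auto simp: cent_def comm_sc_mult_left JJ_mult)

lemma cent_cong: "a - b \<in> JJ k \<Longrightarrow> cent k a = cent k b"
proof -
  assume "a - b \<in> JJ k"
  then have "comm X a - comm X b \<in> JJ k" for X by (simp add: JJ_comm_right flip: comm_diff_right)
  then show ?thesis using JJ_cong unfolding cent_def by blast
qed

lemma cent_anti: "k \<le> l \<Longrightarrow> cent l a \<subseteq> cent k a"
  using JJ_anti by (auto simp: cent_def)

lemma rcent_subgroup: "add_subgroup (rcent k a)"
  unfolding add_subgroup_def
proof (intro conjI ballI)
  show "0 \<in> rcent k a" using JJ_closed(1) by (auto simp: rcent_def cent_def intro!: exI[of _ 0])
  fix X Y assume "X \<in> rcent k a" "Y \<in> rcent k a"
  then obtain X' Y' where "X' \<in> cent k a" "Y' \<in> cent k a" "X - X' \<in> JJ 1" "Y - Y' \<in> JJ 1"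
    by (auto simp: rcent_def)
  then show "X - Y \<in> rcent k a"
    using add_subgroupD(2)[OF cent_subgroup, of X' k a Y'] JJ_closed(2)[of "X - X'" 1 "Y - Y'"]
    by (auto simp: rcent_def algebra_simps intro!: bexI[of _ "X' - Y'"])
qed

lemma cent_rcent: "X \<in> cent k a \<Longrightarrow> X \<in> rcent k a"
  using JJ_closed(1) by (auto simp: rcent_def intro!: bexI[of _ X])

lemma JJ1_rcent: "X \<in> JJ 1 \<Longrightarrow> X \<in> rcent k a"
  by (auto simp: rcent_def cent_def JJ_closed intro!: exI[of _ 0])

lemma rcent_sc: "X \<in> rcent k a \<Longrightarrow> sc c * X \<in> rcent k a"
proof -
  assume "X \<in> rcent k a"
  then obtain Y where Y: "Y \<in> cent k a" "X - Y \<in> JJ 1" by (auto simp: rcent_def)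
  have "sc c * X - sc c * Y \<in> JJ 1" using JJ_mult[OF Y(2), of "sc c"] by (simp add: right_diff_distrib)
  then show ?thesis using cent_sc[OF Y(1)] by (auto simp: rcent_def)
qed

lemma rcent_cong: "a - b \<in> JJ k \<Longrightarrow> rcent k a = rcent k b"
  by (simp add: rcent_def cent_cong)

lemma rcent_anti: "k \<le> l \<Longrightarrow> rcent l a \<subseteq> rcent k a"
  using cent_anti by (fastforce simp: rcent_def)

lemma rcent_saturated: "X - Y \<in> JJ 1 \<Longrightarrow> X \<in> rcent k a \<longleftrightarrow> Y \<in> rcent k a"
  using add_subgroup_cong[OF rcent_subgroup] JJ1_rcent by blast

text \<open>Because [pX, a] = p[X, a], the multiples of p that commute with \<open>a\<close> at
  level k+1 are the p-fold multiples of what commutes at level k.\<close>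

lemma cent_kernel:
  assumes k: "k < L"
  shows "card {X \<in> cent (Suc k) a \<inter> Dig (Suc k). X \<in> JJ 1} = ncent k a"
proof -
  have "{X \<in> cent (Suc k) a \<inter> Dig (Suc k). X \<in> JJ 1} = (\<lambda>X. sc p * X) ` (cent k a \<inter> Dig k)"
  proof -
    have *: "sc p * X \<in> cent (Suc k) a \<longleftrightarrow> X \<in> cent k a" for X
      using JJ_scale_iff[of 1 k "comm X a"] k by (simp add: cent_def comm_sc_mult_left)
    have "{X \<in> cent (Suc k) a \<inter> Dig (Suc k). X \<in> JJ 1} = cent (Suc k) a \<inter> (Dig (Suc k) \<inter> JJ 1)" by fast
    also have "\<dots> = (\<lambda>X. sc p * X) ` (cent k a \<inter> Dig k)"
      unfolding Dig_Suc_JJ1[OF k] using * by fast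
    finally show ?thesis .
  qed
  then show ?thesis
    unfolding ncent_def using inj_scale_Dig[OF k] by (simp add: card_image inj_on_subset)
qed

text \<open>Reduction modulo p maps the centralizer at level k+1 onto \<open>rcent (Suc k) a\<close>
  with the kernel just counted. The condition \<open>U\<close> on residues is later trivial or
  invertibility, so \<open>ncent\<close> and \<open>ngcent\<close> share the factor
  \<open>ncent k a\<close>.\<close>

lemma ncent_Suc_filter:
  assumes k: "k < L" and U: "\<And>X Y. X - Y \<in> JJ 1 \<Longrightarrow> X \<in> U \<longleftrightarrow> Y \<in> U"
  shows "card {X \<in> cent (Suc k) a \<inter> Dig (Suc k). X \<in> U} = card (rcent (Suc k) a \<inter> Dig 1 \<inter> U) * ncent k a"
proof -
  have "card {X \<in> cent (Suc k) a \<inter> Dig (Suc k). X \<in> U}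
    = card {d \<in> Dig 1. d \<in> U \<and> (\<exists>x\<in>cent (Suc k) a. x - d \<in> JJ 1)} *
      card {X \<in> cent (Suc k) a \<inter> Dig (Suc k). X \<in> JJ 1}"
    by (rule card_fibres[where f = "\<lambda>x. x" and ?K1.0 = "JJ (Suc k)"])
       (use k U JJ_anti[of 1 "Suc k"] in \<open>auto simp: cent_subgroup JJ_cent finite_Dig Dig_transversal Dig1_transversal simp del: dig.simps\<close>)
  also have "{d \<in> Dig 1. d \<in> U \<and> (\<exists>x\<in>cent (Suc k) a. x - d \<in> JJ 1)} = rcent (Suc k) a \<inter> Dig 1 \<inter> U"
    using add_subgroup_diff_commute[OF JJ_subgroup] by (auto simp: rcent_def)
  finally show ?thesis using cent_kernel[OF k] by simp
qed

lemma ncent_Suc: "k < L \<Longrightarrow> ncent (Suc k) a = card (rcent (Suc k) a \<inter> Dig 1) * ncent k a"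
  using ncent_Suc_filter[of k UNIV a] by (simp add: ncent_def Int_def del: dig.simps)

lemma ngcent_Suc: "k < L \<Longrightarrow> ngcent (Suc k) a = card (rcent (Suc k) a \<inter> Dig 1 \<inter> GL) * ncent k a"
  using ncent_Suc_filter[of k GL a] GL_cong by (simp add: ngcent_def Int_def del: dig.simps)

lemma ncent_pos: "k \<le> L \<Longrightarrow> 0 < ncent k a"
proof -
  assume "k \<le> L"
  have "0 \<in> cent k a \<inter> Dig k"
    using zero_dig JJ_closed(1) by (auto simp: cent_def) (auto simp: mat3_of_def)
  then show ?thesis unfolding ncent_def using finite_Dig card_gt_0_iff by blast
qed

lemma ncent_cong: "a - b \<in> JJ k \<Longrightarrow> ncent k a = ncent k b"
  by (simp add: ncent_def cent_cong)

end

section \<open>Trace duality between centralizer residues and commutator coefficients\<close>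

section \<open>Duality for reduced centralizers\<close>

context level_ring
begin

declare dig.simps(2) [simp del]

lemma q_gt_1: "1 < q"
proof -
  obtain t where t: "t \<in> S" "1 - t \<in> J 1" using rep[OF S_transversal] by blast
  then have "t \<noteq> 0" using one_notin_J1 by auto
  then have "card {0, t} = 2" by simp
  moreover have "card {0, t} \<le> q" using t S_0 S_finite by (intro card_mono) auto
  ultimately show ?thesis by simp
qed

text \<open>The preimage of a linear subspace of M_3 over the residue field; the order of the
  subspace itself appears as \<open>card (H \<inter> Dig 1)\<close>.\<close>

definition subspace1 :: "'a mat3 set \<Rightarrow> bool" where
  "subspace1 H \<longleftrightarrow> add_subgroup H \<and> (\<forall>c. \<forall>X\<in>H. sc c * X \<in> H) \<and> JJ 1 \<subseteq> H"

lemma subspace1D: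
  assumes "subspace1 H"
  shows "add_subgroup H" "X \<in> H \<Longrightarrow> sc c * X \<in> H" "X \<in> JJ 1 \<Longrightarrow> X \<in> H" "X - Y \<in> JJ 1 \<Longrightarrow> X \<in> H \<longleftrightarrow> Y \<in> H"
  using assms add_subgroup_cong[of H X Y] by (auto simp: subspace1_def)

lemma subspace1_rcent: "subspace1 (rcent k a)"
  using rcent_subgroup rcent_sc JJ1_rcent by (auto simp: subspace1_def)

lemma subspace1_UNIV: "subspace1 UNIV"
  by (auto simp: subspace1_def add_subgroup_def)

lemma functional_image:
  assumes H: "subspace1 H"
    and f: "\<And>x y. f (x - y) = f x - f y" and fsc: "\<And>c x. f (sc c * x) = c * f x"
    and x0: "x0 \<in> H" "f x0 \<notin> J 1"
  shows "\<exists>x\<in>H. f x - d \<in> J 1"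
proof -
  obtain y where y: "f x0 * y - 1 \<in> J 1" using lev1_inverse[OF x0(2)] by blast
  have "d * (f x0 * y - 1) \<in> J 1" by (rule J_mult[OF y])
  then have "f (sc (d * y) * x0) - d \<in> J 1" by (simp add: fsc algebra_simps)
  then show ?thesis using subspace1D(2)[OF H x0(1)] by blast
qed

text \<open>The value at \<open>x0\<close> can be scaled to any residue, so the functional is onto
  the residue field and its kernel has index q.\<close>

lemma card_functional_kernel:
  assumes H: "subspace1 H"
    and f: "\<And>x y. f (x - y) = f x - f y" and fsc: "\<And>c x. f (sc c * x) = c * f x"
    and fJ: "f ` JJ 1 \<subseteq> J 1"
    and x0: "x0 \<in> H" "f x0 \<notin> J 1"
  shows "q * card {x \<in> H \<inter> Dig 1. f x \<in> J 1} = card (H \<inter> Dig 1)"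
proof -
  have "card {x \<in> H \<inter> Dig 1. True}
    = card {d \<in> S. True \<and> (\<exists>x\<in>H. f x - d \<in> J 1)} * card {x \<in> H \<inter> Dig 1. f x \<in> J 1}"
    by (rule card_fibres[OF subspace1D(1)[OF H]])
      (use f fJ subspace1D(3)[OF H] in \<open>auto simp: Dig1_transversal S_transversal S_finite finite_Dig simp del: One_nat_def\<close>)
  also have "{d \<in> S. True \<and> (\<exists>x\<in>H. f x - d \<in> J 1)} = S"
    using functional_image[OF H f fsc x0] by blast
  finally show ?thesis by (simp add: Int_def)
qed

definition perp :: "'a mat3 set \<Rightarrow> 'a mat3 set" where
  "perp H = {Y. \<forall>X\<in>H. tr3 (X * Y) \<in> J 1}"

lemma tr3_diff_left: "tr3 ((X - Y) * Z) = tr3 (X * Z) - tr3 (Y * Z)"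
  and tr3_diff_right: "tr3 (Z * (X - Y)) = tr3 (Z * X) - tr3 (Z * Y)"
  and tr3_sc_left: "tr3 (sc c * X * Z) = c * tr3 (X * Z)"
  and tr3_sc_right: "tr3 (Z * (sc c * X)) = c * tr3 (Z * X)"
  by (simp_all add: tr3_def algebra_simps)

lemma subspace1_perp: "subspace1 (perp H)"
  unfolding subspace1_def add_subgroup_def perp_def
  using J_closed(1,2) J_mult tr3_J[OF JJ_mult] by (simp add: tr3_diff_right tr3_sc_right subset_iff)

lemma trace_nondegenerate:
  assumes "X \<notin> JJ 1"
  shows "\<exists>Y. tr3 (X * Y) \<notin> J 1"
proof (rule ccontr)
  assume "\<nexists>Y. tr3 (X * Y) \<notin> J 1"
  then have *: "tr3 (X * Y) \<in> J 1" for Y by blast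
  have "X \<in> JJ 1"
    using *[of "Mat3 1 0 0 0 0 0 0 0 0"] *[of "Mat3 0 1 0 0 0 0 0 0 0"] *[of "Mat3 0 0 1 0 0 0 0 0 0"]
      *[of "Mat3 0 0 0 1 0 0 0 0 0"] *[of "Mat3 0 0 0 0 1 0 0 0 0"] *[of "Mat3 0 0 0 0 0 1 0 0 0"]
      *[of "Mat3 0 0 0 0 0 0 1 0 0"] *[of "Mat3 0 0 0 0 0 0 0 1 0"] *[of "Mat3 0 0 0 0 0 0 0 0 1"]
    by (simp add: tr3_def mat3_of_def)
  with assms show False by blast
qed

lemma Dig1_JJ1: "X \<in> Dig 1 \<Longrightarrow> X \<in> JJ 1 \<longleftrightarrow> X = 0"
proof -
  assume X: "X \<in> Dig 1"
  have "0 \<in> Dig 1" using zero_dig by (simp add: mat3_of_def)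
  then show ?thesis using transversal_inj[OF Dig1_transversal X, of 0] JJ_closed(1) by auto
qed

lemma zero_Dig: "0 \<in> Dig k"
  using zero_dig by (simp add: mat3_of_def)

text \<open>Both sides count the pairs \<open>(X, Y)\<close> in \<open>H \<times> M\<^sub>3\<close> over the residue field with \<open>tr (X Y) = 0\<close>:
  a nonzero linear functional vanishes on a \<open>q\<close>-th part of its domain.\<close>

lemma card_perp:
  assumes H: "subspace1 H"
  shows "card (H \<inter> Dig 1) * card (perp H \<inter> Dig 1) = q ^ 9"
proof -
  let ?h = "card (H \<inter> Dig 1)" and ?r = "card (perp H \<inter> Dig 1)"
  let ?A = "H \<inter> Dig 1" and ?B = "Dig 1" and ?P = "\<lambda>X Y. tr3 (X * Y) \<in> J 1"
  have fin: "finite ?A" "finite ?B" using finite_Dig by auto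
  have cB: "card ?B = q ^ 9" using card_Dig[OF L_pos] by simp
  have zero: "0 \<in> ?A" using subspace1D(3)[OF H JJ_closed(1)] zero_Dig by blast
  have row: "q * card {Y \<in> ?B. ?P X Y} = (if X = 0 then q * q ^ 9 else q ^ 9)" if "X \<in> ?A" for X
  proof (cases "X = 0")
    case True
    then show ?thesis using cB J_closed(1) by simp
  next
    case False
    then have "X \<notin> JJ 1" using that Dig1_JJ1 by blast
    from trace_nondegenerate[OF this] obtain Y where "\<not> ?P X Y" by blast
    then have "q * card {Y \<in> UNIV \<inter> ?B. ?P X Y} = card (UNIV \<inter> ?B)"
      by (intro card_functional_kernel[OF subspace1_UNIV])
        (auto simp: tr3_diff_right tr3_sc_right intro: tr3_J JJ_mult)
    then show ?thesis using False cB by simp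
  qed
  have col: "q * card {X \<in> ?A. ?P X Y} = (if Y \<in> perp H then q * ?h else ?h)" if "Y \<in> ?B" for Y
  proof (cases "Y \<in> perp H")
    case True
    then have "{X \<in> ?A. ?P X Y} = ?A" by (auto simp: perp_def)
    then show ?thesis using True by simp
  next
    case False
    then obtain X where "X \<in> H" "\<not> ?P X Y" by (auto simp: perp_def)
    then have "q * card {X \<in> ?A. ?P X Y} = ?h"
      by (intro card_functional_kernel[OF H])
        (auto simp: tr3_diff_left tr3_sc_left intro: tr3_J JJ_mult2)
    then show ?thesis using False by simp
  qed
  have "(\<Sum>X\<in>?A. card {Y \<in> ?B. ?P X Y}) = (\<Sum>Y\<in>?B. card {X \<in> ?A. ?P X Y})"
    by (rule sum_multicount_gen) (use fin in auto)
  then have "(\<Sum>X\<in>?A. q * card {Y \<in> ?B. ?P X Y}) = (\<Sum>Y\<in>?B. q * card {X \<in> ?A. ?P X Y})"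
    by (simp only: flip: sum_distrib_left)
  then have "(\<Sum>X\<in>?A. if X = 0 then q * q ^ 9 else q ^ 9) = (\<Sum>Y\<in>?B. if Y \<in> perp H then q * ?h else ?h)"
    using row col by simp
  moreover have "(\<Sum>X\<in>?A. if X = 0 then q * q ^ 9 else q ^ 9) = q * q ^ 9 + (?h - 1) * q ^ 9"
    using sum.remove[OF fin(1) zero, of "\<lambda>X. if X = 0 then q * q ^ 9 else q ^ 9"] fin zero by simp
  moreover have "(\<Sum>Y\<in>?B. if Y \<in> perp H then q * ?h else ?h) = ?r * (q * ?h) + (q ^ 9 - ?r) * ?h"
  proof -
    have "?B \<inter> - perp H = ?B - (perp H \<inter> ?B)" by blast
    then have "card (?B \<inter> - perp H) = q ^ 9 - ?r" using cB fin by (simp add: card_Diff_subset)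
    then show ?thesis using fin by (simp add: sum.If_cases Int_commute)
  qed
  ultimately have e: "q * q ^ 9 + (?h - 1) * q ^ 9 = ?r * (q * ?h) + (q ^ 9 - ?r) * ?h" by simp
  have "?r \<le> q ^ 9" using cB fin by (metis card_mono inf_le2)
  moreover have "1 \<le> ?h" using zero fin by (metis One_nat_def Suc_leI card_gt_0_iff empty_iff)
  ultimately have "int q * int q ^ 9 + (int ?h - 1) * int q ^ 9 = int ?r * (int q * int ?h) + (int q ^ 9 - int ?r) * int ?h"
    using arg_cong[OF e, of int] by (simp add: of_nat_diff)
  \<comment> \<open>The term \<open>?h\<close> times q^9 occurs on both sides; what remains of each
    carries the factor q - 1, which is nonzero.\<close>
  then have "(int q - 1) * (int ?h * int ?r) = (int q - 1) * int q ^ 9" by (simp add: algebra_simps)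
  then have "int ?h * int ?r = int q ^ 9" using q_gt_1 by simp
  then show ?thesis by (metis of_nat_eq_iff of_nat_mult of_nat_power)
qed

lemma subspace1_eqI:
  assumes "subspace1 H" "subspace1 H'" "H \<subseteq> H'" "card (H' \<inter> Dig 1) \<le> card (H \<inter> Dig 1)"
  shows "H = H'"
proof -
  have *: "H \<inter> Dig 1 = H' \<inter> Dig 1"
    using assms finite_Dig by (intro card_seteq) auto
  have "X \<in> H" if "X \<in> H'" for X
  proof -
    let ?Y = "rep (JJ 1) (Dig 1) X"
    have "X - ?Y \<in> JJ 1" "?Y \<in> Dig 1" using rep[OF Dig1_transversal] by auto
    then show ?thesis using subspace1D(4)[OF assms(1)] subspace1D(4)[OF assms(2)] that * by blast
  qed
  then show ?thesis using assms(3) by blast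
qed

lemma cent_shift: "Suc m \<le> L \<Longrightarrow> sc p * X \<in> cent (Suc m) a \<longleftrightarrow> X \<in> cent m a"
  using JJ_scale_iff[of 1 m "comm X a"] by (simp add: cent_def comm_sc_mult_left)

lemma Dig_Suc_JJ:
  assumes k: "k < L"
  shows "Dig (Suc k) \<inter> JJ k = (\<lambda>Y. sc (p ^ k) * Y) ` Dig 1"
proof (intro equalityI subsetI)
  fix X assume X: "X \<in> Dig (Suc k) \<inter> JJ k"
  then have "X \<in> (\<lambda>(X, Y). X + sc (p ^ k) * Y) ` (Dig k \<times> Dig 1)"
    using bij_betw_imp_surj_on[OF bij_Dig[OF k]] by (simp del: One_nat_def)
  then obtain U Y where UY: "U \<in> Dig k" "Y \<in> Dig 1" "X = U + sc (p ^ k) * Y"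
    by (auto simp del: One_nat_def)
  have "X - sc (p ^ k) * Y \<in> JJ k" using X pJJ by (intro JJ_closed(2)) auto
  then have "U - 0 \<in> JJ k" using UY by simp
  then have "U = 0" using transversal_inj[OF Dig_transversal[of k] UY(1) zero_Dig] k by simp
  then show "X \<in> (\<lambda>Y. sc (p ^ k) * Y) ` Dig 1" using UY by simp
next
  fix X assume "X \<in> (\<lambda>Y. sc (p ^ k) * Y) ` Dig 1"
  then obtain Y where Y: "Y \<in> Dig 1" "X = sc (p ^ k) * Y" by blast
  have "(\<lambda>(X, Y). X + sc (p ^ k) * Y) (0, Y) \<in> Dig (Suc k)"
    using Y zero_Dig by (intro bij_betw_apply[OF bij_Dig[OF k]]) auto
  then show "X \<in> Dig (Suc k) \<inter> JJ k" using Y pJJ by simp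
qed

lemma inj_scale_Dig1:
  assumes k: "k < L"
  shows "inj_on (\<lambda>Y. sc (p ^ k) * Y) (Dig 1)"
proof (rule inj_onI)
  fix X Y assume XY: "X \<in> Dig 1" "Y \<in> Dig 1" "sc (p ^ k) * X = sc (p ^ k) * Y"
  then have "sc (p ^ k) * (X - Y) \<in> JJ (k + 1)" using JJ_closed(1) by (simp add: algebra_simps)
  then show "X = Y" using XY transversal_inj[OF Dig1_transversal XY(1,2)] JJ_scale_iff[of k 1] k by simp
qed

lemma card_cent_Dig_Suc:
  assumes "m < L"
  shows "card (cent m a \<inter> Dig (Suc m)) = ncent m a * q ^ 9"
proof -
  have "X + sc (p ^ m) * Y \<in> cent m a \<longleftrightarrow> X \<in> cent m a" for X Y
    using add_subgroup_cong[OF cent_subgroup, of "X + sc (p ^ m) * Y" X m a] JJ_cent[OF pJJ, of m Y a] by simp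
  note * = this
  have "bij_betw (\<lambda>(X, Y). X + sc (p ^ m) * Y) ((cent m a \<inter> Dig m) \<times> Dig 1) (cent m a \<inter> Dig (Suc m))"
  proof (rule bij_betw_subset[OF bij_Dig[OF assms]])
    have "(\<lambda>(X, Y). X + sc (p ^ m) * Y) ` ((cent m a \<inter> Dig m) \<times> Dig 1)
      = (\<lambda>(X, Y). X + sc (p ^ m) * Y) ` (Dig m \<times> Dig 1) \<inter> cent m a"
      using * by (force simp del: One_nat_def)
    then show "(\<lambda>(X, Y). X + sc (p ^ m) * Y) ` ((cent m a \<inter> Dig m) \<times> Dig 1) = cent m a \<inter> Dig (Suc m)"
      using bij_betw_imp_surj_on[OF bij_Dig[OF assms]] by (simp add: Int_commute del: One_nat_def)
  qed auto
  from bij_betw_same_card[OF this] show ?thesis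
    using card_Dig[OF L_pos] by (simp add: card_cartesian_product ncent_def)
qed

text \<open>Only multiples \<open>X\<close> of \<open>p\<close> are allowed: they can be subtracted
  from an element of a centralizer without changing its residue, and the orthogonality to
  \<open>rcent i a\<close> draws a factor p from them.\<close>

definition bracket_image :: "nat \<Rightarrow> 'a mat3 \<Rightarrow> 'a mat3 set" where
  "bracket_image i a = {D. \<exists>X\<in>JJ 1. comm X a - sc (p ^ i) * D \<in> JJ (Suc i)}"

lemma subspace1_bracket_image: "subspace1 (bracket_image i a)"
  unfolding subspace1_def add_subgroup_def
proof (intro conjI ballI allI subsetI)
  show "0 \<in> bracket_image i a" using JJ_closed(1) by (auto simp: bracket_image_def intro!: bexI[of _ 0])
next
  fix D E assume "D \<in> bracket_image i a" "E \<in> bracket_image i a"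
  then obtain X Y where XY: "X \<in> JJ 1" "comm X a - sc (p ^ i) * D \<in> JJ (Suc i)"
    "Y \<in> JJ 1" "comm Y a - sc (p ^ i) * E \<in> JJ (Suc i)" by (auto simp: bracket_image_def)
  have "comm (X - Y) a - sc (p ^ i) * (D - E) = (comm X a - sc (p ^ i) * D) - (comm Y a - sc (p ^ i) * E)"
    by (simp add: comm_diff_left algebra_simps)
  then have "comm (X - Y) a - sc (p ^ i) * (D - E) \<in> JJ (Suc i)" using JJ_closed(2)[OF XY(2,4)] by (simp only:)
  then show "D - E \<in> bracket_image i a" using JJ_closed(2)[OF XY(1,3)] by (auto simp: bracket_image_def)
next
  fix c D assume "D \<in> bracket_image i a"
  then obtain X where X: "X \<in> JJ 1" "comm X a - sc (p ^ i) * D \<in> JJ (Suc i)" by (auto simp: bracket_image_def)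
  have "comm (sc c * X) a - sc (p ^ i) * (sc c * D) = sc c * (comm X a - sc (p ^ i) * D)"
    by (simp add: comm_def mat3_eq_iff algebra_simps)
  then have "comm (sc c * X) a - sc (p ^ i) * (sc c * D) \<in> JJ (Suc i)" using JJ_mult[OF X(2)] by (simp only:)
  then show "sc c * D \<in> bracket_image i a" using JJ_mult[OF X(1)] by (auto simp: bracket_image_def)
next
  fix D assume D: "D \<in> JJ 1"
  have "comm 0 a - sc (p ^ i) * D \<in> JJ (Suc i)" using JJ_closed(3)[OF JJ_scale[OF D, of i]] by simp
  then show "D \<in> bracket_image i a" using JJ_closed(1) unfolding bracket_image_def by blast
qed

text \<open>Consider X -> [X, a] modulo p^(i+1) on the multiples of p in the centralizer of level i.
  The domain is p times the centralizer of level m taken modulo p^i, of order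
  \<open>ncent m a * q ^ 9\<close>. The kernel has order \<open>ncent i a\<close>, which is
  \<open>card (rcent i a \<inter> Dig 1) * ncent m a\<close>. The image is p^i times the bracket
  image.\<close>

lemma card_bracket_image:
  assumes i: "i < L" and im: "i = Suc m"
  shows "card (bracket_image i a \<inter> Dig 1) * card (rcent i a \<inter> Dig 1) = q ^ 9"
proof -
  let ?H = "JJ 1 \<inter> cent i a"
  have H: "add_subgroup ?H"
    using JJ_subgroup[of 1] cent_subgroup[of i a] by (auto simp: add_subgroup_def)
  have "card {x \<in> ?H \<inter> Dig (Suc i). True} =
    card {d \<in> Dig (Suc i). True \<and> (\<exists>x\<in>?H. comm x a - d \<in> JJ (Suc i))} *
    card {x \<in> ?H \<inter> Dig (Suc i). comm x a \<in> JJ (Suc i)}"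
    by (rule card_fibres[OF H, where ?K1.0 = "JJ (Suc i)"])
      (use i JJ_anti[of 1 "Suc i"] JJ_anti[of i "Suc i"] in \<open>auto simp: comm_diff_left finite_Dig Dig_transversal
        intro: JJ_cent JJ_comm_left simp del: One_nat_def\<close>)
  moreover have "{x \<in> ?H \<inter> Dig (Suc i). comm x a \<in> JJ (Suc i)} = {X \<in> cent (Suc i) a \<inter> Dig (Suc i). X \<in> JJ 1}"
    using cent_anti[of i "Suc i" a] by (auto simp: cent_def)
  moreover have "{d \<in> Dig (Suc i). True \<and> (\<exists>x\<in>?H. comm x a - d \<in> JJ (Suc i))}
      = (\<lambda>Y. sc (p ^ i) * Y) ` (bracket_image i a \<inter> Dig 1)" (is "?A = ?B")
  proof (intro equalityI subsetI)
    fix d assume d: "d \<in> ?A"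
    then obtain x where x: "x \<in> JJ 1" "comm x a \<in> JJ i" "comm x a - d \<in> JJ (Suc i)" by (auto simp: cent_def)
    then have "d \<in> JJ i" using JJ_cong[of "comm x a" d i] JJ_anti[of i "Suc i"] by auto
    then obtain Y where "Y \<in> Dig 1" "d = sc (p ^ i) * Y" using d Dig_Suc_JJ[OF i] by blast
    then show "d \<in> ?B" using x by (auto simp: bracket_image_def)
  next
    fix d assume "d \<in> ?B"
    then obtain Y x where Y: "d = sc (p ^ i) * Y" "Y \<in> Dig 1" "x \<in> JJ 1" "comm x a - d \<in> JJ (Suc i)"
      by (auto simp: bracket_image_def)
    then have d: "d \<in> Dig (Suc i)" "d \<in> JJ i" using Dig_Suc_JJ[OF i] by blast+
    have "comm x a \<in> JJ i" using JJ_cong[of "comm x a" d i] JJ_anti[OF _ Y(4), of i] d by simp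
    then show "d \<in> ?A" using Y d by (auto simp: cent_def)
  qed
  moreover have "card ((\<lambda>Y. sc (p ^ i) * Y) ` (bracket_image i a \<inter> Dig 1)) = card (bracket_image i a \<inter> Dig 1)"
    using inj_scale_Dig1[OF i] by (intro card_image) (auto simp: inj_on_def)
  moreover have "{x \<in> ?H \<inter> Dig (Suc i). True} = (\<lambda>X. sc p * X) ` (cent m a \<inter> Dig (Suc m))"
  proof -
    have "{x \<in> ?H \<inter> Dig (Suc i). True} = cent i a \<inter> (Dig (Suc i) \<inter> JJ 1)" by fast
    moreover have "sc p * X \<in> cent i a \<longleftrightarrow> X \<in> cent m a" for X
      using cent_shift[of m X a] i im by simp
    ultimately have "{x \<in> ?H \<inter> Dig (Suc i). True} = (\<lambda>X. sc p * X) ` (cent m a \<inter> Dig i)"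
      unfolding Dig_Suc_JJ1[OF i] by fast
    then show ?thesis using im by simp
  qed
  moreover have "card ((\<lambda>X. sc p * X) ` (cent m a \<inter> Dig (Suc m))) = ncent m a * q ^ 9"
    using inj_scale_Dig[OF i] im i card_cent_Dig_Suc[of m a] by (subst card_image) (auto simp: inj_on_def)
  ultimately have "ncent m a * q ^ 9 = card (bracket_image i a \<inter> Dig 1) * ncent i a"
    using cent_kernel[OF i, of a] by simp
  moreover have "ncent i a = card (rcent i a \<inter> Dig 1) * ncent m a" using ncent_Suc[of m a] i im by simp
  ultimately have "ncent m a * (card (bracket_image i a \<inter> Dig 1) * card (rcent i a \<inter> Dig 1)) = ncent m a * q ^ 9"
    by (metis mult.assoc mult.commute)
  then show ?thesis using ncent_pos[of m a] i im by simp
qed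

text \<open>By invariance of the trace, tr([X, a] Y) = tr(X [a, Y]), which is divisible by p^(i+1):
  one factor p comes from X and p^i from [a, Y]. So the coefficient of p^i on the left vanishes
  modulo p.\<close>

lemma tr3_comm_J:
  assumes i: "i < L" and X: "X \<in> JJ 1" "comm X a - sc (p ^ i) * D \<in> JJ (Suc i)" and Y: "comm Y a \<in> JJ i"
  shows "tr3 (D * Y) \<in> J 1"
proof -
  have "tr3 (X * comm a Y) \<in> J (1 + i)"
    using Y comm_anti[of a Y] JJ_closed(3)[of "comm Y a" i] by (intro tr3_J JJ_prod X(1)) simp
  moreover have "tr3 ((comm X a - sc (p ^ i) * D) * Y) \<in> J (Suc i)"
    by (intro tr3_J JJ_mult2 X(2))
  ultimately have "tr3 (X * comm a Y) - tr3 ((comm X a - sc (p ^ i) * D) * Y) \<in> J (Suc i)"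
    using J_closed(2) by simp
  then have "p ^ i * tr3 (D * Y) \<in> J (Suc i)" by (simp add: tr3_diff_left tr3_sc_left tr3_comm)
  then show ?thesis using i by (intro J_cancel1)
qed

text \<open>\<open>tr3_comm_J\<close> gives one inclusion between \<open>rcent i a\<close> and the
  complement of the bracket image, and their orders agree by \<open>card_bracket_image\<close> and
  \<open>card_perp\<close>. A second use of \<open>card_perp\<close> shows that the double
  complement gives the bracket image back.\<close>

lemma perp_rcent:
  assumes i: "i < L" "i = Suc m"
  shows "perp (rcent i a) = bracket_image i a"
proof -
  let ?W = "bracket_image i a"
  have sub: "rcent i a \<subseteq> perp ?W"
  proof
    fix Z assume "Z \<in> rcent i a"
    then obtain Y where Y: "Z - Y \<in> JJ 1" "comm Y a \<in> JJ i" by (auto simp: rcent_def cent_def)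
    have "Y \<in> perp ?W"
      using tr3_comm_J[OF i(1) _ _ Y(2)] by (auto simp: perp_def bracket_image_def)
    then show "Z \<in> perp ?W" using subspace1D(4)[OF subspace1_perp Y(1)] by blast
  qed
  have W: "card (?W \<inter> Dig 1) * card (perp ?W \<inter> Dig 1) = q ^ 9"
    by (rule card_perp[OF subspace1_bracket_image])
  have q: "0 < q ^ 9" using q_gt_1 by simp
  have "card (?W \<inter> Dig 1) * card (perp ?W \<inter> Dig 1) = card (?W \<inter> Dig 1) * card (rcent i a \<inter> Dig 1)"
    using W card_bracket_image[OF i, of a] by simp
  then have "card (perp ?W \<inter> Dig 1) = card (rcent i a \<inter> Dig 1)"
    using W q by (metis mult_cancel1 mult_zero_left neq0_conv)
  then have eq: "rcent i a = perp ?W"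
    by (intro subspace1_eqI sub subspace1_perp subspace1_rcent) simp
  have "?W \<subseteq> perp (perp ?W)" by (auto simp: perp_def tr3_commute)
  moreover have "card (perp ?W \<inter> Dig 1) * card (perp (perp ?W) \<inter> Dig 1) = q ^ 9"
    by (rule card_perp[OF subspace1_perp])
  then have "card (perp (perp ?W) \<inter> Dig 1) = card (?W \<inter> Dig 1)"
    using W q by (metis mult.commute mult_cancel1 mult_zero_left neq0_conv)
  ultimately have "?W = perp (perp ?W)"
    by (intro subspace1_eqI subspace1_perp subspace1_bracket_image) simp_all
  then show ?thesis using eq by simp
qed

text \<open>The coefficient \<open>D\<close> of \<open>p\<^sup>i\<close> in \<open>[X, a]\<close> is orthogonal to the reduced centralizer, so by
  duality it is also the coefficient of some \<open>[X0, a]\<close> with \<open>X0\<close> divisible by \<open>p\<close>.\<close>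

lemma rcent_SucI:
  assumes i: "i < L" "i = Suc m" and X: "X \<in> cent i a"
    and rad: "\<And>Y. Y \<in> cent i a \<Longrightarrow> tr3 (a * comm X Y) \<in> J (Suc i)"
  shows "X \<in> rcent (Suc i) a"
proof -
  obtain D where D: "comm X a - sc (p ^ i) * D \<in> JJ L"
    using JJ_decompose[of "comm X a" i] X by (auto simp: cent_def)
  then have D': "comm X a - sc (p ^ i) * D \<in> JJ (Suc i)" using i JJ_anti[of "Suc i" L] by auto
  have "tr3 (Y * D) \<in> J 1" if Y: "Y \<in> cent i a" for Y
  proof -
    have "tr3 ((comm X a - sc (p ^ i) * D) * Y) \<in> J (Suc i)" by (intro tr3_J JJ_mult2 D')
    moreover have "tr3 ((comm X a - sc (p ^ i) * D) * Y) = - tr3 (a * comm X Y) - p ^ i * tr3 (Y * D)"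
      by (simp add: tr3_def comm_def algebra_simps)
    ultimately have "- (- tr3 (a * comm X Y) - p ^ i * tr3 (Y * D)) - tr3 (a * comm X Y) \<in> J (Suc i)"
      using J_closed(2)[OF J_closed(3) rad[OF Y]] by (simp only:)
    then have "p ^ i * tr3 (Y * D) \<in> J (Suc i)" by simp
    then show ?thesis using i by (intro J_cancel1[of i])
  qed
  moreover have "tr3 (Z * D) \<in> J 1" if "tr3 (Y * D) \<in> J 1" "Z - Y \<in> JJ 1" for Y Z
    using J_cong[of "tr3 (Z * D)" "tr3 (Y * D)" 1] tr3_J[OF JJ_mult2[OF that(2)], of D] that(1)
    by (simp add: tr3_diff_left)
  ultimately have "D \<in> perp (rcent i a)" unfolding perp_def rcent_def by blast
  then obtain X0 where X0: "X0 \<in> JJ 1" "comm X0 a - sc (p ^ i) * D \<in> JJ (Suc i)"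
    unfolding perp_rcent[OF i] by (auto simp: bracket_image_def)
  have "(comm X a - sc (p ^ i) * D) - (comm X0 a - sc (p ^ i) * D) \<in> JJ (Suc i)"
    by (intro JJ_closed(2) D' X0)
  then have "X - X0 \<in> cent (Suc i) a" by (simp add: cent_def comm_diff_left)
  then show ?thesis using X0(1) by (auto simp: rcent_def intro!: bexI[of _ "X - X0"])
qed

text \<open>The representative X' commutes with a modulo p^(i+1), so the form vanishes against every
  matrix and not only against the centralizer.\<close>

lemma rcent_SucD:
  assumes X: "X \<in> rcent (Suc i) a"
  obtains X' where "X - X' \<in> JJ 1" "X' \<in> cent i a" "\<And>Y. tr3 (a * comm X' Y) \<in> J (Suc i)"
proof -
  obtain X' where X': "X - X' \<in> JJ 1" "comm X' a \<in> JJ (Suc i)" using X by (auto simp: rcent_def cent_def)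
  show ?thesis
  proof (rule that[OF X'(1)])
    show "X' \<in> cent i a" using X' JJ_anti[of i "Suc i"] by (simp add: cent_def)
    show "tr3 (a * comm X' Y) \<in> J (Suc i)" for Y
    proof -
      have "tr3 (comm X' a * Y) \<in> J (Suc i)" by (intro tr3_J JJ_mult2 X')
      moreover have "tr3 (a * comm X' Y) = - tr3 (comm X' a * Y)" by (simp add: tr3_def comm_def algebra_simps)
      ultimately show ?thesis using J_closed(3) by simp
    qed
  qed
qed

end

section \<open>Alternating forms on the reduced centralizer and their radicals\<close>

section \<open>Lifting to the next level\<close>

context level_ring
begin

definition nonscalar :: "'a mat3 \<Rightarrow> bool" where
  "nonscalar X \<longleftrightarrow> (\<forall>c. X - sc c \<notin> JJ 1)"

text \<open>Take j such that a is congruent to a scalar modulo p^j but not modulo p^(j+1). Were n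
  scalar modulo p, it would make a scalar modulo p^(j+1).\<close>

lemma nonscalar_decompose:
  assumes i: "i \<le> L" and a: "\<And>c. a - sc c \<notin> JJ i"
  obtains j s n where "j < i" "a - (sc s + sc (p ^ j) * n) \<in> JJ L" "nonscalar n"
proof -
  define P where "P j \<longleftrightarrow> j \<le> i \<and> (\<exists>c. a - sc c \<in> JJ j)" for j
  have "P 0" by (simp add: P_def)
  have "\<exists>j. P j \<and> \<not> P (Suc j)"
  proof (rule ccontr)
    assume "\<nexists>j. P j \<and> \<not> P (Suc j)"
    then have "P k" for k by (induction k) (use \<open>P 0\<close> in auto)
    from this[of "Suc i"] show False by (simp add: P_def)
  qed
  then obtain j where j: "P j" "\<not> P (Suc j)" by blast
  then have ji: "j < i" using a by (auto simp: P_def order_less_le)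
  from j obtain s where s: "a - sc s \<in> JJ j" by (auto simp: P_def)
  obtain n where n: "a - sc s - sc (p ^ j) * n \<in> JJ L" using JJ_decompose[OF s] by blast
  have "nonscalar n"
    unfolding nonscalar_def
  proof (intro allI notI)
    fix c assume "n - sc c \<in> JJ 1"
    then have "sc (p ^ j) * (n - sc c) \<in> JJ (j + 1)" by (rule JJ_scale)
    then have "(a - sc s - sc (p ^ j) * n) + sc (p ^ j) * (n - sc c) \<in> JJ (Suc j)"
      using JJ_anti[OF _ n, of "Suc j"] ji i by (intro JJ_closed(4)) auto
    then have "a - sc (s + p ^ j * c) \<in> JJ (Suc j)" by (simp add: sc_add sc_mult right_diff_distrib diff_diff_eq)
    then show False using j ji by (auto simp: P_def)
  qed
  then show ?thesis using that[of j s n] ji n by (simp add: algebra_simps)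
qed

text \<open>The error p^i e equals p^j p^(i-j) e and is absorbed into n; since j < i, the residue of
  n is kept. As n' commutes with a scalar plus p^j n', the residue of n stays in the reduced
  centralizer of every lift.\<close>

lemma decompose_lift:
  assumes i: "i \<le> L" and ji: "j < i" and a: "a - (sc s + sc (p ^ j) * n) \<in> JJ i"
  obtains n' where "n' - n \<in> JJ 1" "a - (sc s + sc (p ^ j) * n') \<in> JJ L" "\<And>k. k \<le> L \<Longrightarrow> n' \<in> cent k a"
proof -
  obtain e where e: "a - (sc s + sc (p ^ j) * n) - sc (p ^ i) * e \<in> JJ L" using JJ_decompose[OF a] .
  define n' where "n' = n + sc (p ^ (i - j)) * e"
  have "sc (p ^ i) = sc (p ^ j) * sc (p ^ (i - j))" using ji by (simp flip: sc_mult power_add)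
  then have a': "a - (sc s + sc (p ^ j) * n') \<in> JJ L" using e by (simp add: n'_def algebra_simps)
  have "sc (p ^ (i - j)) * e \<in> JJ 1" using ji by (intro JJ_anti[OF _ pJJ]) auto
  then have "n' - n \<in> JJ 1" by (simp add: n'_def)
  moreover have "n' \<in> cent k a" if "k \<le> L" for k
  proof -
    have "n' \<in> cent L (sc s + sc (p ^ j) * n')"
      using JJ_closed(1) by (simp add: cent_def comm_add_right comm_sc_mult_right)
    then show ?thesis using cent_cong[OF a'] cent_anti[OF that, of a] by auto
  qed
  ultimately show ?thesis using that a' by blast
qed

abbreviation form :: "'a mat3 \<Rightarrow> 'a mat3 \<Rightarrow> 'a mat3 \<Rightarrow> 'a" where
  "form a X Y \<equiv> tr3 (a * comm X Y)"

lemma form_bilinear: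
  "form a (X + X') Y = form a X Y + form a X' Y" "form a X (Y + Y') = form a X Y + form a X Y'"
  "form a (sc c * X) Y = c * form a X Y" "form a X (sc c * Y) = c * form a X Y"
  "form a (sc c) Y = 0" "form a X (sc c) = 0" "form a X X = 0"
  by (simp_all add: tr3_def comm_def algebra_simps)

lemma form_anti: "form a X Y = - form a Y X"
  by (simp add: tr3_def comm_def algebra_simps)

lemma form_minus: "form a X (Y - Y') = form a X Y - form a X Y'" "form a (X - X') Y = form a X Y - form a X' Y"
  by (simp_all add: tr3_def comm_def algebra_simps)

lemma form_shift: "form (a + sc c * b) X Y = form a X Y + c * tr3 (b * comm X Y)"
  by (simp add: tr3_def comm_def algebra_simps)

lemma J_uminus_iff: "- x \<in> J k \<longleftrightarrow> x \<in> J k"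
  using J_closed(3)[of x k] J_closed(3)[of "- x" k] by auto

lemma form_cent: "X \<in> cent k a \<Longrightarrow> form a X Y \<in> J k"
proof -
  assume "X \<in> cent k a"
  then have "tr3 (comm X a * Y) \<in> J k" by (intro tr3_J JJ_mult2) (simp add: cent_def)
  moreover have "form a X Y = - tr3 (comm X a * Y)" by (simp add: tr3_def comm_def algebra_simps)
  ultimately show ?thesis using J_closed(3) by simp
qed

lemma form_cent_right: "Y \<in> cent k a \<Longrightarrow> form a X Y \<in> J k"
  using form_cent[of Y k a X] form_anti[of a X Y] J_closed(3) by simp

text \<open>This makes the form, divided by p^k, well defined on residues: for X in the centralizer
  of level k, its value modulo p^(k+1) depends on Y only modulo p.\<close>

lemma form_JJ1:
  assumes X: "X \<in> cent k a" and E: "E \<in> JJ 1"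
  shows "form a X E \<in> J (Suc k)"
proof -
  have "tr3 (comm X a * E) \<in> J (k + 1)" using X E by (intro tr3_J JJ_prod) (auto simp: cent_def)
  moreover have "form a X E = - tr3 (comm X a * E)" by (simp add: tr3_def comm_def algebra_simps)
  ultimately show ?thesis using J_closed(3) by simp
qed

lemma form_cong_right:
  assumes "X \<in> cent k a" "Y - Y' \<in> JJ 1"
  shows "form a X Y \<in> J (Suc k) \<longleftrightarrow> form a X Y' \<in> J (Suc k)"
  using J_cong[of "form a X Y" "form a X Y'" "Suc k"] form_JJ1[OF assms] by (simp add: form_minus)

lemma form_cong_left:
  assumes "Y \<in> cent k a" "X - X' \<in> JJ 1"
  shows "form a X Y \<in> J (Suc k) \<longleftrightarrow> form a X' Y \<in> J (Suc k)"
  unfolding form_anti[of a X Y] form_anti[of a X' Y] J_uminus_iff by (rule form_cong_right[OF assms])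

subsection \<open>The case of a three-dimensional reduced centralizer\<close>

text \<open>The q^3 combinations of 1, n and X with coefficients in \<open>S\<close> are distinct
  modulo p, so they exhaust the residues of H.\<close>

lemma card_span3:
  assumes H: "subspace1 H" and n: "nonscalar n" "1 \<in> H" "n \<in> H" and X: "X \<in> H"
    and indep: "\<And>a b. X - (sc a + sc b * n) \<notin> JJ 1"
    and card: "card (H \<inter> Dig 1) = q ^ 3" and Y: "Y \<in> H"
  obtains a b c where "Y - (sc a + sc b * n + sc c * X) \<in> JJ 1"
proof -
  let ?g = "\<lambda>(a, b, c). sc a + sc b * n + sc c * X"
  let ?f = "\<lambda>t. rep (JJ 1) (Dig 1) (?g t)"
  have "sc a + sc b * n + sc c * X \<in> H" for a b c
    using subspace1D(2)[OF H n(2), of a] subspace1D(2)[OF H n(3), of b] subspace1D(2)[OF H X, of c]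
    by (intro add_subgroupD(4)[OF subspace1D(1)[OF H]]) auto
  then have gH: "?g t \<in> H" for t by (cases t) auto
  have "inj_on ?f (S \<times> S \<times> S)"
  proof (rule inj_onI)
    fix t t' assume t: "t \<in> S \<times> S \<times> S" "t' \<in> S \<times> S \<times> S" and ft: "?f t = ?f t'"
    obtain a b c a' b' c' where tt: "t = (a, b, c)" "t' = (a', b', c')" by (metis prod.exhaust)
    have S: "a \<in> S" "b \<in> S" "c \<in> S" "a' \<in> S" "b' \<in> S" "c' \<in> S"
      and "?f (a, b, c) = ?f (a', b', c')" using t ft by (simp_all only: tt mem_Times_iff fst_conv snd_conv)
    then have d: "?g (a, b, c) - ?g (a', b', c') \<in> JJ 1" using rep_eq_iff[OF Dig1_transversal] by blast
    have c: "c - c' \<in> J 1"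
    proof (rule ccontr)
      assume "c - c' \<notin> J 1"
      then obtain y where y: "(c - c') * y - 1 \<in> J 1" using lev1_inverse by blast
      have "sc y * (?g (a, b, c) - ?g (a', b', c')) - sc ((c - c') * y - 1) * X \<in> JJ 1"
        using JJ_mult[OF d] sc_mult_JJ[OF y] by (intro JJ_closed(2))
      moreover have "sc y * (?g (a, b, c) - ?g (a', b', c')) - sc ((c - c') * y - 1) * X
          = X - (sc (- (y * (a - a'))) + sc (- (y * (b - b'))) * n)"
        by (simp add: mat3_eq_iff algebra_simps)
      ultimately show False using indep by simp
    qed
    then have cc: "c = c'" using S transversal_inj[OF S_transversal] by blast
    have b: "b - b' \<in> J 1"
    proof (rule ccontr)
      assume "b - b' \<notin> J 1"
      then obtain y where y: "(b - b') * y - 1 \<in> J 1" using lev1_inverse by blast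
      have "sc y * (?g (a, b, c) - ?g (a', b', c')) - sc ((b - b') * y - 1) * n \<in> JJ 1"
        using JJ_mult[OF d] sc_mult_JJ[OF y] by (intro JJ_closed(2))
      moreover have "sc y * (?g (a, b, c) - ?g (a', b', c')) - sc ((b - b') * y - 1) * n
          = n - sc (- (y * (a - a')))"
        using cc by (simp add: mat3_eq_iff algebra_simps)
      ultimately show False using n by (simp add: nonscalar_def)
    qed
    then have bb: "b = b'" using S transversal_inj[OF S_transversal] by blast
    have "sc (a - a') \<in> JJ 1" using d cc bb by (simp add: sc_diff algebra_simps)
    then have "a = a'" using S transversal_inj[OF S_transversal] by (simp add: sc_JJ_iff)
    then show "t = t'" using bb cc tt by simp
  qed
  then have "card (?f ` (S \<times> S \<times> S)) = q ^ 3"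
    by (simp add: card_image card_cartesian_product power3_eq_cube)
  moreover have sub: "?f ` (S \<times> S \<times> S) \<subseteq> H \<inter> Dig 1"
    using gH rep[OF Dig1_transversal] subspace1D(4)[OF H rep(2)[OF Dig1_transversal]] by blast
  ultimately have eq: "?f ` (S \<times> S \<times> S) = H \<inter> Dig 1"
    using card finite_Dig by (intro card_subset_eq) auto
  let ?Y = "rep (JJ 1) (Dig 1) Y"
  have Y': "Y - ?Y \<in> JJ 1" "?Y \<in> Dig 1" using rep[OF Dig1_transversal] by auto
  then have "?Y \<in> ?f ` (S \<times> S \<times> S)" using eq Y subspace1D(4)[OF H Y'(1)] by blast
  then obtain t where "?Y = ?f t" by blast
  then have "Y - ?g t \<in> JJ 1" using rep_eq_iff[OF Dig1_transversal] by blast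
  then show ?thesis using that by (cases t) auto
qed

lemma one_cent: "1 \<in> cent k a"
  using JJ_closed(1) by (simp add: cent_def)

text \<open>The alternating form is defined on the quotient of the reduced centralizer by the span of
  \<open>1\<close> and \<open>n\<close>, which here is one-dimensional, so it vanishes.\<close>

lemma rcent_Suc_card3:
  assumes i: "i < L" "i = Suc m" and n: "nonscalar n" "n \<in> cent (Suc i) a"
    and card: "card (rcent i a \<inter> Dig 1) = q ^ 3"
  shows "rcent (Suc i) a = rcent i a"
proof
  show "rcent (Suc i) a \<subseteq> rcent i a" by (rule rcent_anti) simp
  show "rcent i a \<subseteq> rcent (Suc i) a"
  proof
    fix X assume X: "X \<in> rcent i a"
    have ni: "n \<in> cent i a" using n cent_anti[of i "Suc i" a] by auto
    show "X \<in> rcent (Suc i) a"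
    proof (cases "\<exists>a b. X - (sc a + sc b * n) \<in> JJ 1")
      case True
      then obtain c b where cb: "X - (sc c + sc b * n) \<in> JJ 1" by blast
      have "sc c * 1 + sc b * n \<in> cent (Suc i) a"
        by (intro add_subgroupD(4)[OF cent_subgroup] cent_sc one_cent n)
      then show ?thesis using cb by (auto simp: rcent_def)
    next
      case False
      obtain X' where X': "X - X' \<in> JJ 1" "X' \<in> cent i a" using X by (auto simp: rcent_def)
      have "X' \<in> rcent (Suc i) a"
      proof (rule rcent_SucI[OF i X'(2)])
        fix Y assume Y: "Y \<in> cent i a"
        obtain c b d where Yc: "Y - (sc c + sc b * n + sc d * X) \<in> JJ 1"
          by (rule card_span3[OF subspace1_rcent n(1) cent_rcent[OF one_cent] cent_rcent[OF ni] X _ card cent_rcent[OF Y]])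
            (use False in blast)
        have "(Y - (sc c + sc b * n + sc d * X)) + sc d * (X - X') \<in> JJ 1"
          using JJ_mult[OF X'(1)] by (intro JJ_closed(4) Yc)
        then have Y': "Y - (sc c + sc b * n + sc d * X') \<in> JJ 1" by (simp add: algebra_simps)
        have "form a X' (sc c + sc b * n + sc d * X') = b * form a X' n" by (simp add: form_bilinear)
        also have "\<dots> \<in> J (Suc i)" by (intro J_mult form_cent_right n)
        finally show "form a X' Y \<in> J (Suc i)" using form_cong_right[OF X'(2) Y'] by simp
      qed
      then show ?thesis using rcent_saturated[OF X'(1)] by blast
    qed
  qed
qed

end

lemma transversal_Times:
  assumes "transversal K T" "transversal K' T'"
  shows "transversal (K \<times> K') (T \<times> T')"
proof -
  have "\<exists>!t. t \<in> T \<times> T' \<and> x - t \<in> K \<times> K'" for x :: "'a \<times> 'b"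
  proof (rule ex1I)
    show "(rep K T (fst x), rep K' T' (snd x)) \<in> T \<times> T' \<and> x - (rep K T (fst x), rep K' T' (snd x)) \<in> K \<times> K'"
      using rep[OF assms(1)] rep[OF assms(2)] by (simp add: mem_Times_iff)
  next
    fix t assume "t \<in> T \<times> T' \<and> x - t \<in> K \<times> K'"
    then show "t = (rep K T (fst x), rep K' T' (snd x))"
      using rep_eqI[OF assms(1), of "fst t"] rep_eqI[OF assms(2), of "snd t"] by (auto simp: mem_Times_iff prod_eq_iff)
  qed
  moreover have "add_subgroup (K \<times> K')"
    using assms unfolding transversal_def add_subgroup_def by (auto simp: zero_prod_def)
  ultimately show ?thesis by (auto simp: transversal_def)
qed

text \<open>Translation permutes the cosets of \<open>K\<close>. This removes the part of the
  alternating form that is common to all lifts.\<close>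

lemma card_shift:
  assumes T: "transversal K T" and Q: "\<And>x y. x - y \<in> K \<Longrightarrow> Q x \<longleftrightarrow> Q y"
  shows "card {d \<in> T. Q (e + d)} = card {d \<in> T. Q d}"
proof (rule bij_betw_same_card)
  note sub = transversal_subgroup[OF T]
  have Qrep: "Q (rep K T x) \<longleftrightarrow> Q x" "Q (e + rep K T x) \<longleftrightarrow> Q (e + x)" for x
    using Q[of x "rep K T x"] Q[of "e + x" "e + rep K T x"] rep(2)[OF T, of x] by auto
  show "bij_betw (\<lambda>d. rep K T (e + d)) {d \<in> T. Q (e + d)} {d \<in> T. Q d}"
  proof (rule bij_betwI[where g = "\<lambda>d. rep K T (d - e)"])
    fix d assume "d \<in> {d \<in> T. Q (e + d)}"
    then show "rep K T (rep K T (e + d) - e) = d"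
      using rep(2)[OF T, of "e + d"] add_subgroup_diff_commute[OF sub, of "e + d" "rep K T (e + d)"]
      by (intro rep_eqI[OF T]) (auto simp: algebra_simps)
  next
    fix d assume "d \<in> {d \<in> T. Q d}"
    then show "rep K T (e + rep K T (d - e)) = d"
      using rep(2)[OF T, of "d - e"] add_subgroup_diff_commute[OF sub, of "d - e" "rep K T (d - e)"]
      by (intro rep_eqI[OF T]) (auto simp: algebra_simps)
  qed (auto simp: Qrep rep[OF T])
qed

context level_ring
begin

lemma JJ_sym: "X - Y \<in> JJ k \<Longrightarrow> Y - X \<in> JJ k"
  using add_subgroup_diff_commute[OF JJ_subgroup] by blast

subsection \<open>The case of a five-dimensional reduced centralizer\<close>

abbreviation JJJ :: "('a \<times> 'a \<times> 'a) set" where "JJJ \<equiv> J 1 \<times> J 1 \<times> J 1"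
abbreviation SSS :: "('a \<times> 'a \<times> 'a) set" where "SSS \<equiv> S \<times> S \<times> S"

lemma SSS_transversal: "transversal JJJ SSS"
  by (intro transversal_Times S_transversal)

text \<open>The cross product of f and x vanishes over the residue field. An alternating form on a
  three-dimensional space is given by a vector f through (x, y) -> det(f, x, y), and x is in its
  radical iff the cross product of f and x is 0.\<close>

definition crossJ :: "'a \<times> 'a \<times> 'a \<Rightarrow> 'a \<times> 'a \<times> 'a \<Rightarrow> bool" where
  "crossJ = (\<lambda>(f1, f2, f3) (c, d, e). e * f2 - d * f3 \<in> J 1 \<and> c * f3 - e * f1 \<in> J 1 \<and> d * f1 - c * f2 \<in> J 1)"

lemma crossJ_commute: "crossJ f x \<longleftrightarrow> crossJ x f"
proof -
  have *: "a - b \<in> J 1 \<longleftrightarrow> b - a \<in> J 1" for a b by (rule add_subgroup_diff_commute[OF J_subgroup])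
  obtain f1 f2 f3 c d e where "f = (f1, f2, f3)" "x = (c, d, e)" by (cases f; cases x) auto
  then show ?thesis
    using *[of "e * f2" "d * f3"] *[of "c * f3" "e * f1"] *[of "d * f1" "c * f2"]
    by (simp add: crossJ_def mult.commute del: One_nat_def)
qed

lemma crossJ_cong: "f - f' \<in> JJJ \<Longrightarrow> crossJ f x \<longleftrightarrow> crossJ f' x"
proof -
  assume f: "f - f' \<in> JJJ"
  obtain f1 f2 f3 g1 g2 g3 c d e where [simp]: "f = (f1, f2, f3)" "f' = (g1, g2, g3)" "x = (c, d, e)"
    by (cases f; cases f'; cases x) auto
  have J: "f1 - g1 \<in> J 1" "f2 - g2 \<in> J 1" "f3 - g3 \<in> J 1" using f by auto
  have "e * f2 - d * f3 \<in> J 1 \<longleftrightarrow> e * g2 - d * g3 \<in> J 1" if "f2 - g2 \<in> J 1" "f3 - g3 \<in> J 1" for d e f2 f3 g2 g3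
    using J_cong[of "e * f2 - d * f3" "e * g2 - d * g3" 1] J_closed(2)[OF J_mult[OF that(1), of e] J_mult[OF that(2), of d]]
    by (simp add: algebra_simps)
  with J show ?thesis by (simp add: crossJ_def)
qed

lemma crossJ_JJJ: "x \<in> JJJ \<Longrightarrow> crossJ f x"
  by (cases f; cases x) (auto simp: crossJ_def simp del: One_nat_def intro: J_closed J_mult2)

text \<open>The vectors parallel to a nonzero x are its q multiples.\<close>

lemma card_crossJ:
  assumes x: "x \<notin> JJJ"
  shows "card {f \<in> SSS. crossJ f x} = q"
proof -
  obtain x1 x2 x3 where [simp]: "x = (x1, x2, x3)" by (cases x)
  have "\<exists>y1 y2 y3. x1 * y1 + x2 * y2 + x3 * y3 - 1 \<in> J 1"
  proof -
    consider "x1 \<notin> J 1" | "x2 \<notin> J 1" | "x3 \<notin> J 1" using x by auto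
    then show ?thesis
    proof cases
      case 1
      then obtain y where "x1 * y + x2 * 0 + x3 * 0 - 1 \<in> J 1" using lev1_inverse by auto
      then show ?thesis by blast
    next
      case 2
      then obtain y where "x1 * 0 + x2 * y + x3 * 0 - 1 \<in> J 1" using lev1_inverse by auto
      then show ?thesis by blast
    next
      case 3
      then obtain y where "x1 * 0 + x2 * 0 + x3 * y - 1 \<in> J 1" using lev1_inverse by auto
      then show ?thesis by blast
    qed
  qed
  then obtain y1 y2 y3 where y: "x1 * y1 + x2 * y2 + x3 * y3 - 1 \<in> J 1" by blast
  let ?r = "rep JJJ SSS" and ?m = "\<lambda>t. (t * x1, t * x2, t * x3)"
  have "bij_betw (\<lambda>t. ?r (?m t)) S {f \<in> SSS. crossJ f x}"
    unfolding bij_betw_def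
  proof
    show "inj_on (\<lambda>t. ?r (?m t)) S"
    proof (rule inj_onI)
      fix s t assume st: "s \<in> S" "t \<in> S" "?r (?m s) = ?r (?m t)"
      then have "?m s - ?m t \<in> JJJ" using rep_eq_iff[OF SSS_transversal] by blast
      then have d: "s * x1 - t * x1 \<in> J 1" "s * x2 - t * x2 \<in> J 1" "s * x3 - t * x3 \<in> J 1" by auto
      have "y1 * (s * x1 - t * x1) + y2 * (s * x2 - t * x2) + y3 * (s * x3 - t * x3)
          - (s - t) * (x1 * y1 + x2 * y2 + x3 * y3 - 1) \<in> J 1"
        by (intro J_closed(2) J_closed(4) J_mult d y)
      then have "s - t \<in> J 1" by (simp add: algebra_simps)
      then show "s = t" using st transversal_inj[OF S_transversal] by blast
    qed
    show "(\<lambda>t. ?r (?m t)) ` S = {f \<in> SSS. crossJ f x}"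
    proof (intro equalityI subsetI)
      fix f assume "f \<in> (\<lambda>t. ?r (?m t)) ` S"
      then obtain t where t: "t \<in> S" "f = ?r (?m t)" by blast
      have "crossJ (?m t) x" using J_closed(1) by (simp add: crossJ_def algebra_simps)
      then show "f \<in> {f \<in> SSS. crossJ f x}"
        using t rep[OF SSS_transversal, of "?m t"] crossJ_cong[OF rep(2)[OF SSS_transversal, of "?m t"]] by blast
    next
      fix f assume f: "f \<in> {f \<in> SSS. crossJ f x}"
      obtain f1 f2 f3 where [simp]: "f = (f1, f2, f3)" by (cases f)
      have c: "x3 * f2 - x2 * f3 \<in> J 1" "x1 * f3 - x3 * f1 \<in> J 1" "x2 * f1 - x1 * f2 \<in> J 1"
        using f by (auto simp: crossJ_def)
      let ?u = "f1 * y1 + f2 * y2 + f3 * y3"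
      let ?t = "rep (J 1) S ?u"
      have t: "?t \<in> S" "?u - ?t \<in> J 1" using rep[OF S_transversal, of ?u] by simp_all
      \<comment> \<open>Since x.y is 1 modulo p, the identity (y.f) x - (y.x) f = y cross (x cross
        f) shows that f is congruent to (y.f) x. The digit of y.f is therefore the
        multiplier.\<close>
      have "y2 * - (x2 * f1 - x1 * f2) + y3 * (x1 * f3 - x3 * f1) + f1 * (x1 * y1 + x2 * y2 + x3 * y3 - 1)
          - x1 * (?u - ?t) \<in> J 1"
        "y1 * (x2 * f1 - x1 * f2) + y3 * - (x3 * f2 - x2 * f3) + f2 * (x1 * y1 + x2 * y2 + x3 * y3 - 1)
          - x2 * (?u - ?t) \<in> J 1"
        "y1 * - (x1 * f3 - x3 * f1) + y2 * (x3 * f2 - x2 * f3) + f3 * (x1 * y1 + x2 * y2 + x3 * y3 - 1)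
          - x3 * (?u - ?t) \<in> J 1"
        by (intro J_closed(2) J_closed(4) J_mult J_closed(3) c y t)+
      then have "?t * x1 - f1 \<in> J 1" "?t * x2 - f2 \<in> J 1" "?t * x3 - f3 \<in> J 1"
        by (simp_all add: algebra_simps)
      then have "?r (?m ?t) = f" using f by (intro rep_eqI[OF SSS_transversal]) auto
      then show "f \<in> (\<lambda>t. ?r (?m t)) ` S" using t by blast
    qed
  qed
  then show ?thesis using bij_betw_same_card by fastforce
qed

definition lin5 :: "'a mat3 \<Rightarrow> 'a mat3 \<Rightarrow> 'a mat3 \<Rightarrow> 'a mat3 \<Rightarrow> 'a \<times> 'a \<times> 'a \<times> 'a \<times> 'a \<Rightarrow> 'a mat3" where
  "lin5 n x y z = (\<lambda>(a, b, c, d, e). sc a + sc b * n + sc c * x + sc d * y + sc e * z)"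

text \<open>The vector of the alternating form (u, v) -> tr(b [u, v]) in the coordinates given by x,
  y, z.\<close>

definition comm3 :: "'a mat3 \<Rightarrow> 'a mat3 \<Rightarrow> 'a mat3 \<Rightarrow> 'a mat3 \<Rightarrow> 'a \<times> 'a \<times> 'a" where
  "comm3 x y z b = (tr3 (b * comm y z), tr3 (b * comm z x), tr3 (b * comm x y))"

text \<open>Over the residue field, \<open>C\<close> has basis \<open>1, n, x, y, z\<close> and the commutators of \<open>x, y, z\<close> are
  linearly independent, as witnessed by the dual matrices \<open>u, v, w\<close>.\<close>

definition five :: "'a mat3 set \<Rightarrow> 'a mat3 \<Rightarrow> 'a mat3 \<Rightarrow> 'a mat3 \<Rightarrow> 'a mat3 \<Rightarrow> bool" where
  "five C n x y z \<longleftrightarrow>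
    (\<forall>X. X \<in> C \<longleftrightarrow> (\<exists>t. X - lin5 n x y z t \<in> JJ 1)) \<and>
    (\<forall>t. lin5 n x y z t \<in> JJ 1 \<longrightarrow> t \<in> J 1 \<times> J 1 \<times> JJJ) \<and>
    (\<exists>u v w. comm3 x y z u - (1, 0, 0) \<in> JJJ \<and> comm3 x y z v - (0, 1, 0) \<in> JJJ \<and> comm3 x y z w - (0, 0, 1) \<in> JJJ)"

lemma lin5_diff: "lin5 n x y z t - lin5 n x y z t' = lin5 n x y z (t - t')"
  by (cases t; cases t') (simp add: lin5_def sc_diff algebra_simps)

lemma lin5_JJ1: "t \<in> J 1 \<times> J 1 \<times> JJJ \<Longrightarrow> lin5 n x y z t \<in> JJ 1"
  by (cases t) (auto simp: lin5_def simp del: One_nat_def intro!: JJ_closed(4) sc_JJ sc_mult_JJ)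

lemma lin5_cong:
  assumes "n - n' \<in> JJ 1" "x - x' \<in> JJ 1" "y - y' \<in> JJ 1" "z - z' \<in> JJ 1"
  shows "lin5 n x y z t - lin5 n' x' y' z' t \<in> JJ 1"
proof -
  obtain a b c d e where [simp]: "t = (a, b, c, d, e)" by (cases t)
  have "sc b * (n - n') + sc c * (x - x') + sc d * (y - y') + sc e * (z - z') \<in> JJ 1"
    by (intro JJ_closed(4) JJ_mult assms)
  then show ?thesis by (simp add: lin5_def algebra_simps)
qed

lemma comm3_diff: "comm3 x y z (b - b') = comm3 x y z b - comm3 x y z b'"
  and comm3_add: "comm3 x y z (b + b') = comm3 x y z b + comm3 x y z b'"
  and comm3_sc: "comm3 x y z (sc c * b) = (c * fst (comm3 x y z b), c * fst (snd (comm3 x y z b)), c * snd (snd (comm3 x y z b)))"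
  by (simp_all add: comm3_def tr3_diff_left tr3_sc_left distrib_right tr3_add)

lemma comm3_JJJ: "b \<in> JJ 1 \<Longrightarrow> comm3 x y z b \<in> JJJ"
  by (auto simp: comm3_def simp del: One_nat_def intro!: tr3_J JJ_mult2)

lemma comm3_cong:
  assumes "x - x' \<in> JJ 1" "y - y' \<in> JJ 1" "z - z' \<in> JJ 1"
  shows "comm3 x y z b - comm3 x' y' z' b \<in> JJJ"
proof -
  have "tr3 (b * comm u v) - tr3 (b * comm u' v') \<in> J 1" if "u - u' \<in> JJ 1" "v - v' \<in> JJ 1" for u v u' v'
  proof -
    have "tr3 (b * (comm (u - u') v + comm u' (v - v'))) \<in> J 1"
      by (intro tr3_J JJ_mult JJ_closed(4) JJ_comm_left JJ_comm_right that)
    then show ?thesis by (simp add: comm_diff_left comm_diff_right tr3_diff_right)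
  qed
  then show ?thesis using assms by (simp add: comm3_def del: One_nat_def)
qed

lemma JJJ_subgroup: "add_subgroup JJJ"
  by (rule transversal_subgroup[OF SSS_transversal])

lemma five_cong:
  assumes five: "five C n x y z" and "n - n' \<in> JJ 1" "x - x' \<in> JJ 1" "y - y' \<in> JJ 1" "z - z' \<in> JJ 1"
  shows "five C n' x' y' z'"
proof -
  have l: "lin5 n x y z t - lin5 n' x' y' z' t \<in> JJ 1" for t
    by (rule lin5_cong) fact+
  have 1: "X - lin5 n x y z t \<in> JJ 1 \<longleftrightarrow> X - lin5 n' x' y' z' t \<in> JJ 1" for X t
    using JJ_cong[of "X - lin5 n' x' y' z' t" "X - lin5 n x y z t" 1] l[of t] by simp
  have 2: "lin5 n x y z t \<in> JJ 1 \<longleftrightarrow> lin5 n' x' y' z' t \<in> JJ 1" for t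
    by (rule JJ_cong[OF l])
  have 3: "comm3 x y z b - d \<in> JJJ \<longleftrightarrow> comm3 x' y' z' b - d \<in> JJJ" for b d
    using add_subgroup_cong[OF JJJ_subgroup, of "comm3 x y z b - d" "comm3 x' y' z' b - d"]
      comm3_cong[OF assms(3-5), of b] by simp
  show ?thesis using five unfolding five_def 1 2 3 .
qed

context
  fixes C n x y z
  assumes five: "five C n x y z"
begin

lemma five_mem: "X \<in> C \<longleftrightarrow> (\<exists>t. X - lin5 n x y z t \<in> JJ 1)"
  using five by (auto simp: five_def)

lemma five_inj: "lin5 n x y z t \<in> JJ 1 \<Longrightarrow> t \<in> J 1 \<times> J 1 \<times> JJJ"
  using five unfolding five_def by blast

lemma five_bij: "bij_betw (\<lambda>t. rep (JJ 1) (Dig 1) (lin5 n x y z t)) (S \<times> S \<times> SSS) (C \<inter> Dig 1)"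
  unfolding bij_betw_def
proof
  let ?f = "\<lambda>t. rep (JJ 1) (Dig 1) (lin5 n x y z t)"
  have S5: "transversal (J 1 \<times> J 1 \<times> JJJ) (S \<times> S \<times> SSS)"
    by (intro transversal_Times S_transversal)
  show "inj_on ?f (S \<times> S \<times> SSS)"
  proof (rule inj_onI)
    fix t t' assume t: "t \<in> S \<times> S \<times> SSS" "t' \<in> S \<times> S \<times> SSS" and "?f t = ?f t'"
    then have "lin5 n x y z (t - t') \<in> JJ 1" using rep_eq_iff[OF Dig1_transversal] by (simp add: lin5_diff)
    then have "t - t' \<in> J 1 \<times> J 1 \<times> JJJ" by (rule five_inj)
    then show "t = t'" by (rule transversal_inj[OF S5 t])
  qed
  show "?f ` (S \<times> S \<times> SSS) = C \<inter> Dig 1"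
  proof (intro equalityI subsetI)
    fix X assume "X \<in> ?f ` (S \<times> S \<times> SSS)"
    then obtain t where t: "X = ?f t" by blast
    then have "lin5 n x y z t - X \<in> JJ 1" "X \<in> Dig 1" using rep[OF Dig1_transversal] by auto
    then show "X \<in> C \<inter> Dig 1" using five_mem JJ_sym[of "lin5 n x y z t" X 1] by blast
  next
    fix X assume X: "X \<in> C \<inter> Dig 1"
    then obtain t where t: "X - lin5 n x y z t \<in> JJ 1" using five_mem by blast
    let ?t = "rep (J 1 \<times> J 1 \<times> JJJ) (S \<times> S \<times> SSS) t"
    have S: "?t \<in> S \<times> S \<times> SSS" "t - ?t \<in> J 1 \<times> J 1 \<times> JJJ" using rep[OF S5] by auto
    then have "lin5 n x y z (t - ?t) \<in> JJ 1" by (intro lin5_JJ1)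
    then have "(X - lin5 n x y z t) + (lin5 n x y z t - lin5 n x y z ?t) \<in> JJ 1"
      using t by (intro JJ_closed(4)) (simp_all only: lin5_diff)
    then have "X - lin5 n x y z ?t \<in> JJ 1" by simp
    from JJ_sym[OF this] have "?f ?t = X"
      using X by (intro rep_eqI[OF Dig1_transversal]) simp_all
    then show "X \<in> ?f ` (S \<times> S \<times> SSS)" by (rule image_eqI[OF sym S(1)])
  qed
qed

lemma card_five: "card (C \<inter> Dig 1) = q ^ 5"
  using bij_betw_same_card[OF five_bij] by (simp add: card_cartesian_product eval_nat_numeral)

lemma comm3_surj: "\<exists>b. comm3 x y z b - d \<in> JJJ"
proof -
  from five obtain u v w where uvw: "comm3 x y z u - (1, 0, 0) \<in> JJJ" "comm3 x y z v - (0, 1, 0) \<in> JJJ"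
    "comm3 x y z w - (0, 0, 1) \<in> JJJ" unfolding five_def by metis
  obtain d1 d2 d3 where [simp]: "d = (d1, d2, d3)" by (cases d)
  have J: "d1 * r + d2 * s + d3 * t \<in> J 1" if "r \<in> J 1" "s \<in> J 1" "t \<in> J 1" for r s t
    using that by (intro J_closed(4) J_mult)
  let ?b = "sc d1 * u + sc d2 * v + sc d3 * w"
  obtain u1 u2 u3 v1 v2 v3 w1 w2 w3 where c: "comm3 x y z u = (u1, u2, u3)" "comm3 x y z v = (v1, v2, v3)"
    "comm3 x y z w = (w1, w2, w3)" by (metis prod.exhaust)
  have "d1 * (u1 - 1) + d2 * v1 + d3 * w1 \<in> J 1" "d1 * u2 + d2 * (v2 - 1) + d3 * w2 \<in> J 1"
    "d1 * u3 + d2 * v3 + d3 * (w3 - 1) \<in> J 1"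
    using uvw by (intro J; simp add: c)+
  then have "comm3 x y z ?b - d \<in> JJJ"
    by (simp add: comm3_add comm3_sc c algebra_simps)
  then show ?thesis by (rule exI)
qed

text \<open>By \<open>comm3_surj\<close> the additive map \<open>comm3 x y z\<close> is onto the q^3
  residue vectors, so each has q^6 of the q^9 residue matrices above it. Adding \<open>f\<close>
  only permutes the vectors.\<close>

lemma comm3_equidistributed:
  assumes Q: "\<And>s t. s - t \<in> JJJ \<Longrightarrow> Q s \<longleftrightarrow> Q t"
  shows "card {b \<in> Dig 1. Q (f + comm3 x y z b)} = q ^ 6 * card {d \<in> SSS. Q d}"
proof -
  have *: "card {b \<in> UNIV \<inter> Dig 1. P (comm3 x y z b)}
    = card {d \<in> SSS. P d \<and> (\<exists>b\<in>UNIV. comm3 x y z b - d \<in> JJJ)} * card {b \<in> UNIV \<inter> Dig 1. comm3 x y z b \<in> JJJ}"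
    if P: "\<And>s t. s - t \<in> JJJ \<Longrightarrow> P s \<longleftrightarrow> P t" for P
  proof (rule card_fibres[where f = "comm3 x y z" and ?K1.0 = "JJ 1" and ?K2.0 = JJJ])
    show "comm3 x y z ` JJ 1 \<subseteq> JJJ" by (intro image_subsetI comm3_JJJ)
    show "P (comm3 x y z b) \<longleftrightarrow> P d" if "comm3 x y z b - d \<in> JJJ" for b d using that by (rule P)
  qed (simp_all add: comm3_diff Dig1_transversal finite_Dig SSS_transversal S_finite
        subspace1D(1)[OF subspace1_UNIV] del: One_nat_def)
  have "card (Dig 1) = card SSS * card {b \<in> UNIV \<inter> Dig 1. comm3 x y z b \<in> JJJ}"
    using *[of "\<lambda>_. True"] comm3_surj by simp
  moreover have "card (Dig 1) = q ^ 3 * q ^ 6" using card_Dig[OF L_pos] by (simp flip: power_add)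
  moreover have "card SSS = q ^ 3" by (simp add: card_cartesian_product power3_eq_cube)
  ultimately have "q ^ 3 * q ^ 6 = q ^ 3 * card {b \<in> UNIV \<inter> Dig 1. comm3 x y z b \<in> JJJ}"
    by (simp only:)
  moreover have "q ^ 3 \<noteq> 0" using q_gt_1 by simp
  ultimately have ker: "card {b \<in> UNIV \<inter> Dig 1. comm3 x y z b \<in> JJJ} = q ^ 6"
    unfolding mult_cancel1 by (simp only: simp_thms)
  have "card {b \<in> UNIV \<inter> Dig 1. Q (f + comm3 x y z b)} = card {d \<in> SSS. Q (f + d)} * q ^ 6"
    using *[of "\<lambda>t. Q (f + t)"] Q comm3_surj ker by simp
  also have "card {d \<in> SSS. Q (f + d)} = card {d \<in> SSS. Q d}"
    by (rule card_shift[OF SSS_transversal Q])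
  finally show ?thesis by simp
qed

text \<open>Coordinates are unique modulo p by \<open>five_inj\<close>, so lying in the span of 1
  and n means that the last three of them vanish.\<close>

lemma five_span2: "X - lin5 n x y z t \<in> JJ 1 \<Longrightarrow> snd (snd t) \<in> JJJ \<longleftrightarrow> (\<exists>a b. X - (sc a + sc b * n) \<in> JJ 1)"
proof -
  assume X: "X - lin5 n x y z t \<in> JJ 1"
  have l: "lin5 n x y z (a, b, 0, 0, 0) = sc a + sc b * n" for a b by (simp add: lin5_def)
  obtain a b r where t: "t = (a, b, r)" by (cases t)
  show ?thesis
  proof
    assume r: "snd (snd t) \<in> JJJ"
    have "lin5 n x y z (t - (a, b, 0, 0, 0)) \<in> JJ 1"
      using r J_closed(1) by (intro lin5_JJ1) (auto simp: t simp del: One_nat_def)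
    then have "lin5 n x y z t - (sc a + sc b * n) \<in> JJ 1" by (simp flip: lin5_diff l)
    from JJ_closed(4)[OF X this] have "X - (sc a + sc b * n) \<in> JJ 1" by (simp add: algebra_simps)
    then show "\<exists>a b. X - (sc a + sc b * n) \<in> JJ 1" by blast
  next
    assume "\<exists>a b. X - (sc a + sc b * n) \<in> JJ 1"
    then obtain a' b' where "X - lin5 n x y z (a', b', 0, 0, 0) \<in> JJ 1" unfolding l by blast
    from JJ_closed(2)[OF this X] have "lin5 n x y z (t - (a', b', 0, 0, 0)) \<in> JJ 1"
      by (simp flip: lin5_diff)
    from five_inj[OF this] show "snd (snd t) \<in> JJJ" by (cases r) (auto simp: t)
  qed
qed

end

text \<open>1 and n lie in the radical, n because it commutes with a even at level i+1. So X is in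
  the radical iff it is orthogonal to x, y and z, and modulo p^(i+1) these three values of the form
  are p^i times the components of a cross product.\<close>

lemma five_rcent_Suc:
  assumes i: "i < L" "i = Suc m" and five: "five (rcent i a) n x y z"
    and xyz: "x \<in> cent i a" "y \<in> cent i a" "z \<in> cent i a" and n: "n \<in> cent (Suc i) a"
    and f: "form a y z - p ^ i * f1 \<in> J (Suc i)" "form a z x - p ^ i * f2 \<in> J (Suc i)"
      "form a x y - p ^ i * f3 \<in> J (Suc i)"
    and X: "X - lin5 n x y z t \<in> JJ 1"
  shows "X \<in> rcent (Suc i) a \<longleftrightarrow> crossJ (f1, f2, f3) (snd (snd t))"
proof -
  obtain s b c d e where t: "t = (s, b, c, d, e)" by (cases t)
  have ni: "n \<in> cent i a" using n cent_anti[of i "Suc i" a] by auto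
  have lin: "lin5 n x y z t \<in> cent i a" for t
  proof -
    obtain s b c d e where t: "t = (s, b, c, d, e)" by (cases t)
    have "sc s * 1 + sc b * n + sc c * x + sc d * y + sc e * z \<in> cent i a"
      by (intro add_subgroupD(4)[OF cent_subgroup] cent_sc one_cent ni xyz)
    then show ?thesis by (simp add: lin5_def t)
  qed
  let ?X = "lin5 n x y z t"
  have scale: "p ^ i * r \<in> J (Suc i) \<longleftrightarrow> r \<in> J 1" for r using J_scale_iff[of i 1 r] i by simp
  have fn: "form a n Y \<in> J (Suc i)" "form a Y n \<in> J (Suc i)" for Y
    using form_cent[OF n] form_cent_right[OF n] by auto
  have "form a ?X x \<in> J (Suc i) \<longleftrightarrow> e * f2 - d * f3 \<in> J 1"
  proof -
    have "form a ?X x = b * form a n x + d * - form a x y + e * form a z x"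
      using form_anti[of a y x] by (simp add: t lin5_def form_bilinear)
    then have "form a ?X x - p ^ i * (e * f2 - d * f3)
      = b * form a n x + (- d) * (form a x y - p ^ i * f3) + e * (form a z x - p ^ i * f2)"
      by (simp add: algebra_simps)
    also have "\<dots> \<in> J (Suc i)" by (intro J_closed(4) J_mult fn f)
    finally show ?thesis using J_cong scale by blast
  qed
  moreover have "form a ?X y \<in> J (Suc i) \<longleftrightarrow> c * f3 - e * f1 \<in> J 1"
  proof -
    have "form a ?X y = b * form a n y + c * form a x y + e * - form a y z"
      using form_anti[of a z y] by (simp add: t lin5_def form_bilinear)
    then have "form a ?X y - p ^ i * (c * f3 - e * f1)
      = b * form a n y + c * (form a x y - p ^ i * f3) + (- e) * (form a y z - p ^ i * f1)"
      by (simp add: algebra_simps)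
    also have "\<dots> \<in> J (Suc i)" by (intro J_closed(4) J_mult fn f)
    finally show ?thesis using J_cong scale by blast
  qed
  moreover have "form a ?X z \<in> J (Suc i) \<longleftrightarrow> d * f1 - c * f2 \<in> J 1"
  proof -
    have "form a ?X z = b * form a n z + c * - form a z x + d * form a y z"
      using form_anti[of a x z] by (simp add: t lin5_def form_bilinear)
    then have "form a ?X z - p ^ i * (d * f1 - c * f2)
      = b * form a n z + (- c) * (form a z x - p ^ i * f2) + d * (form a y z - p ^ i * f1)"
      by (simp add: algebra_simps)
    also have "\<dots> \<in> J (Suc i)" by (intro J_closed(4) J_mult fn f)
    finally show ?thesis using J_cong scale by blast
  qed
  ultimately have cr: "crossJ (f1, f2, f3) (snd (snd t)) \<longleftrightarrow>
      form a ?X x \<in> J (Suc i) \<and> form a ?X y \<in> J (Suc i) \<and> form a ?X z \<in> J (Suc i)"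
    by (simp add: crossJ_def t)
  have "?X \<in> rcent (Suc i) a \<longleftrightarrow>
      form a ?X x \<in> J (Suc i) \<and> form a ?X y \<in> J (Suc i) \<and> form a ?X z \<in> J (Suc i)"
  proof
    assume "?X \<in> rcent (Suc i) a"
    then obtain X' where X': "?X - X' \<in> JJ 1" "X' \<in> cent i a" "\<And>Y. form a X' Y \<in> J (Suc i)"
      by (rule rcent_SucD) blast
    then show "form a ?X x \<in> J (Suc i) \<and> form a ?X y \<in> J (Suc i) \<and> form a ?X z \<in> J (Suc i)"
      using form_cong_left[OF _ X'(1)] xyz by blast
  next
    assume g: "form a ?X x \<in> J (Suc i) \<and> form a ?X y \<in> J (Suc i) \<and> form a ?X z \<in> J (Suc i)"
    show "?X \<in> rcent (Suc i) a"
    proof (rule rcent_SucI[OF i lin])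
      fix Y assume "Y \<in> cent i a"
      then obtain t' where t': "Y - lin5 n x y z t' \<in> JJ 1" using five_mem[OF five] cent_rcent by blast
      obtain s' b' c' d' e' where te: "t' = (s', b', c', d', e')" by (cases t')
      have "form a ?X (lin5 n x y z t') = b' * form a ?X n + c' * form a ?X x + d' * form a ?X y + e' * form a ?X z"
        by (simp add: te lin5_def[of n x y z] form_bilinear)
      also have "\<dots> \<in> J (Suc i)" using g by (intro J_closed(4) J_mult fn) auto
      finally show "form a ?X Y \<in> J (Suc i)" using form_cong_right[OF lin t'] by blast
    qed
  qed
  then show ?thesis using cr rcent_saturated[OF X] by blast
qed

text \<open>The alternating form of a lift \<open>a + \<pi>\<^sup>i b\<close> corresponds to a vector \<open>\<Phi> b\<close>, which is
  equidistributed in the three-dimensional space of all alternating forms modulo \<open>1\<close> and \<open>n\<close>.\<close>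

lemma five_lifts:
  assumes i: "i < L" "i = Suc m" and five: "five (rcent i a) n x y z"
    and n: "\<And>b. \<exists>n'. n' - n \<in> JJ 1 \<and> n' \<in> cent (Suc i) (a + sc (p ^ i) * b)"
  obtains \<Phi> where "\<And>b X t. X - lin5 n x y z t \<in> JJ 1 \<Longrightarrow>
      X \<in> rcent (Suc i) (a + sc (p ^ i) * b) \<longleftrightarrow> crossJ (\<Phi> b) (snd (snd t))"
    "\<And>Q. (\<And>s t. s - t \<in> JJJ \<Longrightarrow> Q s \<longleftrightarrow> Q t) \<Longrightarrow> card {b \<in> Dig 1. Q (\<Phi> b)} = q ^ 6 * card {d \<in> SSS. Q d}"
proof -
  have "x \<in> rcent i a" "y \<in> rcent i a" "z \<in> rcent i a"
  proof -
    have "x - lin5 n x y z (0, 0, 1, 0, 0) \<in> JJ 1" "y - lin5 n x y z (0, 0, 0, 1, 0) \<in> JJ 1"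
      "z - lin5 n x y z (0, 0, 0, 0, 1) \<in> JJ 1"
      using JJ_closed(1) by (simp_all add: lin5_def)
    then show "x \<in> rcent i a" "y \<in> rcent i a" "z \<in> rcent i a" using five_mem[OF five] by blast+
  qed
  then obtain x' y' z' where xyz: "x' \<in> cent i a" "y' \<in> cent i a" "z' \<in> cent i a"
    "x - x' \<in> JJ 1" "y - y' \<in> JJ 1" "z - z' \<in> JJ 1" by (auto simp: rcent_def)
  have "\<exists>f. form a y' z' - p ^ i * f \<in> K" "\<exists>f. form a z' x' - p ^ i * f \<in> K" "\<exists>f. form a x' y' - p ^ i * f \<in> K"
    using form_cent xyz by (auto intro!: J_decompose)
  then obtain f1 f2 f3 where f: "form a y' z' - p ^ i * f1 \<in> K" "form a z' x' - p ^ i * f2 \<in> K"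
    "form a x' y' - p ^ i * f3 \<in> K" by blast
  define \<Phi> where "\<Phi> b = (f1, f2, f3) + comm3 x' y' z' b" for b
  have five': "five (rcent i a) n x' y' z'"
    using five_cong[OF five _ xyz(4-6)] JJ_closed(1) by simp
  show ?thesis
  proof (rule that[of \<Phi>])
    fix b X t assume X: "X - lin5 n x y z t \<in> JJ 1"
    let ?a = "a + sc (p ^ i) * b"
    have a: "a - ?a \<in> JJ i" using JJ_closed(3)[OF pJJ[of i b]] by simp
    obtain n' where n': "n' - n \<in> JJ 1" "n' \<in> cent (Suc i) ?a" using n by blast
    have nn: "n - n' \<in> JJ 1" by (rule JJ_sym[OF n'(1)])
    have *: "form ?a u v - p ^ i * (g + tr3 (b * comm u v)) \<in> J (Suc i)" if "form a u v - p ^ i * g \<in> K" for u v g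
    proof -
      have "form ?a u v - p ^ i * (g + tr3 (b * comm u v)) = form a u v - p ^ i * g"
        by (simp only: form_shift) (simp add: algebra_simps)
      then show ?thesis using K_J[OF that] by (simp only:)
    qed
    have X': "X - lin5 n' x' y' z' t \<in> JJ 1"
      using JJ_closed(4)[OF X lin5_cong[OF nn xyz(4-6), of t]] by simp
    show "X \<in> rcent (Suc i) ?a \<longleftrightarrow> crossJ (\<Phi> b) (snd (snd t))"
      using five_rcent_Suc[OF i _ _ _ _ n'(2) f(1)[THEN *] f(2)[THEN *] f(3)[THEN *] X'] xyz(1-3)
        five_cong[OF five' nn] JJ_closed(1) rcent_cong[OF a] cent_cong[OF a]
      by (simp add: \<Phi>_def comm3_def)
  next
    fix Q :: "'a \<times> 'a \<times> 'a \<Rightarrow> bool" assume "\<And>s t. s - t \<in> JJJ \<Longrightarrow> Q s \<longleftrightarrow> Q t"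
    then show "card {b \<in> Dig 1. Q (\<Phi> b)} = q ^ 6 * card {d \<in> SSS. Q d}"
      unfolding \<Phi>_def by (rule comm3_equidistributed[OF five'])
  qed
qed

text \<open>If the vector \<Phi> b of the form vanishes modulo p, which happens for q^6 of the b,
  then C is unchanged; otherwise the radical is the span of 1, n and one further element. For the
  sum, the pairs (b, X) are counted by X. An X in the span of 1 and n belongs to the reduced
  centralizer of all q^9 lifts. Any other X requires \<Phi> b to be one of the q vectors parallel to
  its coordinates, which holds for q^6 q of the lifts.\<close>

lemma five_step:
  assumes i: "i < L" "i = Suc m" and five: "five (rcent i a) n x y z"
    and n: "\<And>b. \<exists>n'. n' - n \<in> JJ 1 \<and> n' \<in> cent (Suc i) (a + sc (p ^ i) * b)"
  shows "card {b \<in> Dig 1. rcent (Suc i) (a + sc (p ^ i) * b) = rcent i a} = q ^ 6" (is ?A)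
    and "rcent (Suc i) (a + sc (p ^ i) * b) \<noteq> rcent i a \<Longrightarrow>
      card (rcent (Suc i) (a + sc (p ^ i) * b) \<inter> Dig 1) = q ^ 3"
    and "(\<Sum>b\<in>Dig 1. card (rcent (Suc i) (a + sc (p ^ i) * b) \<inter> Dig 1 \<inter> GL))
      = card {X \<in> rcent i a \<inter> Dig 1 \<inter> GL. \<exists>c d. X - (sc c + sc d * n) \<in> JJ 1} * q ^ 9
        + card {X \<in> rcent i a \<inter> Dig 1 \<inter> GL. \<not> (\<exists>c d. X - (sc c + sc d * n) \<in> JJ 1)} * q ^ 7"
proof -
  let ?C = "rcent i a" and ?R = "\<lambda>b. rcent (Suc i) (a + sc (p ^ i) * b)"
  obtain \<Phi> where \<Phi>: "\<And>b X t. X - lin5 n x y z t \<in> JJ 1 \<Longrightarrow> X \<in> ?R b \<longleftrightarrow> crossJ (\<Phi> b) (snd (snd t))"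
    and eq: "\<And>Q. (\<And>s t. s - t \<in> JJJ \<Longrightarrow> Q s \<longleftrightarrow> Q t) \<Longrightarrow> card {b \<in> Dig 1. Q (\<Phi> b)} = q ^ 6 * card {d \<in> SSS. Q d}"
    by (rule five_lifts[OF i five n]) blast
  have RC: "?R b \<subseteq> ?C" for b
    using rcent_anti[of i "Suc i" "a + sc (p ^ i) * b"] rcent_cong[of "a + sc (p ^ i) * b" a i] pJJ by simp
  have R1: "?R b = ?C" if "\<Phi> b \<in> JJJ" for b
  proof -
    have "X \<in> ?R b" if "X \<in> ?C" for X
      using that five_mem[OF five] \<Phi> crossJ_commute crossJ_JJJ[OF \<open>\<Phi> b \<in> JJJ\<close>] by metis
    then show ?thesis using RC by blast
  qed
  have R2: "card (?R b \<inter> Dig 1) = q ^ 3" if b: "\<Phi> b \<notin> JJJ" for b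
  proof -
    let ?g = "\<lambda>t. rep (JJ 1) (Dig 1) (lin5 n x y z t)"
    let ?T = "S \<times> S \<times> {d \<in> SSS. crossJ (\<Phi> b) d}"
    have g: "?g t \<in> ?R b \<longleftrightarrow> crossJ (\<Phi> b) (snd (snd t))" for t
      using \<Phi> JJ_sym[OF rep(2)[OF Dig1_transversal]] by blast
    have "bij_betw ?g ?T (?R b \<inter> Dig 1)"
    proof (rule bij_betw_subset[OF five_bij[OF five]])
      show "?T \<subseteq> S \<times> S \<times> SSS" by blast
      have T: "?T = {t \<in> S \<times> S \<times> SSS. crossJ (\<Phi> b) (snd (snd t))}" by auto
      have "?g ` ?T = ?g ` (S \<times> S \<times> SSS) \<inter> ?R b" unfolding T using g by blast
      also have "\<dots> = ?R b \<inter> Dig 1"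
        using bij_betw_imp_surj_on[OF five_bij[OF five]] RC[of b] by blast
      finally show "?g ` ?T = ?R b \<inter> Dig 1" .
    qed
    then have "card (?R b \<inter> Dig 1) = q * (q * card {d \<in> SSS. crossJ d (\<Phi> b)})"
      using bij_betw_same_card crossJ_commute by (fastforce simp: card_cartesian_product)
    then show ?thesis using card_crossJ[OF b] by (simp add: power3_eq_cube)
  qed
  have iff: "?R b = ?C \<longleftrightarrow> \<Phi> b \<in> JJJ" for b
  proof
    assume "?R b = ?C"
    then have "card (?R b \<inter> Dig 1) = q ^ 5" using card_five[OF five] by simp
    moreover have "q ^ 5 \<noteq> q ^ 3" using q_gt_1 by simp
    ultimately show "\<Phi> b \<in> JJJ" using R2 by metis
  qed (rule R1)
  have z: "{d \<in> SSS. d \<in> JJJ} = {(0, 0, 0)}"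
  proof -
    have "d \<in> S \<Longrightarrow> d \<in> J 1 \<Longrightarrow> d = 0" for d using transversal_inj[OF S_transversal _ S_0] by simp
    then show ?thesis using S_0 J_closed(1) by auto
  qed
  have "card {b \<in> Dig 1. \<Phi> b \<in> JJJ} = q ^ 6 * card {d \<in> SSS. d \<in> JJJ}"
    by (rule eq) (rule add_subgroup_cong[OF JJJ_subgroup])
  then show ?A unfolding iff z by simp
  show "card (?R b \<inter> Dig 1) = q ^ 3" if "?R b \<noteq> ?C" using that iff R2 by blast
  let ?X = "?C \<inter> Dig 1 \<inter> GL" and ?P = "\<lambda>X. \<exists>c d. X - (sc c + sc d * n) \<in> JJ 1"
  have fin: "finite (Dig 1)" "finite ?X" using finite_Dig by auto
  have cnt: "card {b \<in> Dig 1. X \<in> ?R b} = (if ?P X then q ^ 9 else q ^ 7)" if X: "X \<in> ?X" for X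
  proof -
    obtain t where t: "X - lin5 n x y z t \<in> JJ 1" using X five_mem[OF five] by blast
    have "card {b \<in> Dig 1. X \<in> ?R b} = q ^ 6 * card {d \<in> SSS. crossJ d (snd (snd t))}"
      unfolding \<Phi>[OF t] by (rule eq) (rule crossJ_cong)
    also have "card {d \<in> SSS. crossJ d (snd (snd t))} = (if ?P X then q ^ 3 else q)"
    proof (cases "?P X")
      case True
      then have "snd (snd t) \<in> JJJ" using five_span2[OF five t] by blast
      then have "crossJ d (snd (snd t))" for d by (rule crossJ_JJJ)
      then have "{d \<in> SSS. crossJ d (snd (snd t))} = SSS" by simp
      then show ?thesis using True by (simp add: card_cartesian_product power3_eq_cube)
    next
      case False
      then have "snd (snd t) \<notin> JJJ" using five_span2[OF five t] by metis
      then show ?thesis using False card_crossJ by simp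
    qed
    finally show ?thesis by (simp add: eval_nat_numeral)
  qed
  have "(\<Sum>b\<in>Dig 1. card (?R b \<inter> Dig 1 \<inter> GL)) = (\<Sum>b\<in>Dig 1. card {X \<in> ?X. X \<in> ?R b})"
    using RC by (intro sum.cong refl arg_cong[where f = card]) blast
  also have "\<dots> = (\<Sum>X\<in>?X. card {b \<in> Dig 1. X \<in> ?R b})"
    by (rule sum_multicount_gen) (use fin in auto)
  also have "\<dots> = (\<Sum>X\<in>?X. if ?P X then q ^ 9 else q ^ 7)" using cnt by simp
  also have "\<dots> = card {X \<in> ?X. ?P X} * q ^ 9 + card {X \<in> ?X. \<not> ?P X} * q ^ 7"
    using fin by (simp add: sum.If_cases Int_def conj_ac)
  finally show "(\<Sum>b\<in>Dig 1. card (?R b \<inter> Dig 1 \<inter> GL)) = card {X \<in> ?X. ?P X} * q ^ 9 + card {X \<in> ?X. \<not> ?P X} * q ^ 7" .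
qed

end

section \<open>Normal forms of 3 x 3 matrices over a finite field and their centralizers\<close>

section \<open>Similarity over the residue field\<close>

context level_ring
begin

lemma GL_mult: "g * h \<in> GL \<longleftrightarrow> g \<in> GL \<and> h \<in> GL"
  by (auto simp: GL_def det3_mult J1_prime simp del: One_nat_def)

lemma GL_1: "1 \<in> GL"
  using one_notin_J1 by (simp add: GL_def)

lemma GL_inverse:
  assumes "g \<in> GL"
  obtains g' where "g' \<in> GL" "g * g' - 1 \<in> JJ L" "g' * g - 1 \<in> JJ L"
proof -
  obtain y where y: "det3 g * y - 1 \<in> K" using unit_inverse assms by (auto simp: GL_def)
  then have "sc (det3 g * y - 1) \<in> JJ L" using J_L by (intro sc_JJ) simp
  moreover have "g * (sc y * adj3 g) - 1 = sc (det3 g * y - 1)" "sc y * adj3 g * g - 1 = sc (det3 g * y - 1)"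
    using adj3[of g] by (simp_all add: sc_left_commute mult.assoc sc_diff mult.commute[of "det3 g"] flip: sc_mult)
  ultimately have "g * (sc y * adj3 g) - 1 \<in> JJ L" "sc y * adj3 g * g - 1 \<in> JJ L" by simp_all
  moreover from this(1) have "g * (sc y * adj3 g) \<in> GL"
    using GL_cong[of "g * (sc y * adj3 g)" 1] JJ_anti[OF L_pos] GL_1 by blast
  ultimately show ?thesis using that[of "sc y * adj3 g"] GL_mult by blast
qed

definition conjg :: "nat \<Rightarrow> 'a mat3 \<Rightarrow> 'a mat3 \<Rightarrow> bool" where
  "conjg k a b \<longleftrightarrow> (\<exists>g\<in>GL. g * a - b * g \<in> JJ k)"

context
  fixes k
  assumes k0: "0 < k" and kL: "k \<le> L"
begin

lemma GL_inverse_level: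
  assumes "g \<in> GL"
  obtains g' where "g' \<in> GL" "g * g' - 1 \<in> JJ k" "g' * g - 1 \<in> JJ k"
  using GL_inverse[OF assms] JJ_anti[OF kL] by metis

lemma GL_cancel_left_level:
  assumes g: "g \<in> GL"
  shows "g * X \<in> JJ k \<longleftrightarrow> X \<in> JJ k"
proof
  assume X: "g * X \<in> JJ k"
  obtain g' where "g' * g - 1 \<in> JJ k" using GL_inverse_level[OF g] .
  from JJ_closed(2)[OF JJ_mult[OF X, of g'] JJ_mult2[OF this, of X]] show "X \<in> JJ k"
    by (simp add: algebra_simps)
qed (rule JJ_mult)

lemma GL_cancel_right_level:
  assumes g: "g \<in> GL"
  shows "X * g \<in> JJ k \<longleftrightarrow> X \<in> JJ k"
proof
  assume X: "X * g \<in> JJ k"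
  obtain g' where "g * g' - 1 \<in> JJ k" using GL_inverse_level[OF g] .
  from JJ_closed(2)[OF JJ_mult2[OF X, of g'] JJ_mult[OF this, of X]] show "X \<in> JJ k"
    by (simp add: algebra_simps)
qed (rule JJ_mult2)

lemma conjgI: "g \<in> GL \<Longrightarrow> g * a - b * g \<in> JJ k \<Longrightarrow> conjg k a b"
  by (auto simp: conjg_def)

lemma conjg_cong: "a - b \<in> JJ k \<Longrightarrow> conjg k a b"
  using GL_1 by (intro conjgI[of 1]) simp_all

lemma conjg_sym: "conjg k a b \<Longrightarrow> conjg k b a"
proof -
  assume "conjg k a b"
  then obtain g where g: "g \<in> GL" "g * a - b * g \<in> JJ k" by (auto simp: conjg_def)
  obtain g' where g': "g' \<in> GL" "g * g' - 1 \<in> JJ k" "g' * g - 1 \<in> JJ k" using GL_inverse_level[OF g(1)] .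
  have "(g' * g - 1) * a * g' - g' * b * (g * g' - 1) - g' * (g * a - b * g) * g' \<in> JJ k"
    by (rule JJ_closed(2)[OF JJ_closed(2)[OF JJ_mult2[OF JJ_mult2[OF g'(3)]] JJ_mult[OF g'(2)]]
        JJ_mult2[OF JJ_mult[OF g(2)]]])
  then have "g' * b - a * g' \<in> JJ k" by (simp add: algebra_simps)
  then show ?thesis using g' by (auto simp: conjg_def)
qed

lemma conjg_trans: "conjg k a b \<Longrightarrow> conjg k b c \<Longrightarrow> conjg k a c"
proof -
  assume "conjg k a b" "conjg k b c"
  then obtain g h where "g \<in> GL" "g * a - b * g \<in> JJ k" "h \<in> GL" "h * b - c * h \<in> JJ k" by (auto simp: conjg_def)
  moreover from this have "h * (g * a - b * g) + (h * b - c * h) * g \<in> JJ k"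
    by (intro JJ_closed(4) JJ_mult JJ_mult2)
  ultimately show ?thesis using GL_mult by (intro conjgI[of "h * g"]) (auto simp: algebra_simps)
qed

lemma cent_iff: "X \<in> cent k a \<longleftrightarrow> X * a - a * X \<in> JJ k"
  by (simp add: cent_def comm_def)

text \<open>Orbit and stabilizer: count the triples (i, g, b) in which g carries
  \<open>\<nu> i\<close> to b. A pair (i, g) determines b. For given b only one i occurs, and the
  matrices g form a coset of the centralizer of b.\<close>

lemma sum_centralizers_level:
  assumes I: "finite I" and inj: "\<And>i j. i \<in> I \<Longrightarrow> j \<in> I \<Longrightarrow> conjg k (\<nu> i) (\<nu> j) \<Longrightarrow> i = j"
  shows "(\<Sum>b\<in>{b \<in> Dig k. \<exists>i\<in>I. conjg k (\<nu> i) b}. card (cent k b \<inter> Dig k \<inter> GL)) = card I * card (Dig k \<inter> GL)"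
proof -
  let ?B = "{b \<in> Dig k. \<exists>i\<in>I. conjg k (\<nu> i) b}" and ?G = "Dig k \<inter> GL"
  let ?P = "\<lambda>i b g. g * \<nu> i - b * g \<in> JJ k"
  have fin: "finite ?B" "finite ?G" using finite_Dig by auto
  have one: "card {b \<in> ?B. ?P i b g} = 1" if i: "i \<in> I" and g: "g \<in> ?G" for i g
  proof -
    obtain g' where g': "g * g' - 1 \<in> JJ k" "g' * g - 1 \<in> JJ k" using GL_inverse_level g by blast
    let ?b = "rep (JJ k) (Dig k) (g * \<nu> i * g')"
    have b: "?b \<in> Dig k" "g * \<nu> i * g' - ?b \<in> JJ k" using rep[OF Dig_transversal[OF kL]] by auto
    have "(g * \<nu> i * g' - ?b) * g - g * \<nu> i * (g' * g - 1) \<in> JJ k"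
      by (rule JJ_closed(2)[OF JJ_mult2[OF b(2)] JJ_mult[OF g'(2)]])
    then have P: "?P i ?b g" by (simp add: algebra_simps)
    have "b = ?b" if "b \<in> Dig k" "?P i b g" for b
    proof -
      have "(b - ?b) * g \<in> JJ k" using JJ_closed(2)[OF P that(2)] by (simp add: algebra_simps)
      then have "b - ?b \<in> JJ k" using GL_cancel_right_level g by blast
      then show ?thesis by (rule transversal_inj[OF Dig_transversal[OF kL] that(1) b(1)])
    qed
    moreover have "conjg k (\<nu> i) ?b" using P g by (intro conjgI[of g]) auto
    ultimately have "{b \<in> ?B. ?P i b g} = {?b}" using P b(1) i by blast
    then show ?thesis by simp
  qed
  have stab: "(\<Sum>i\<in>I. card {g \<in> ?G. ?P i b g}) = card (cent k b \<inter> Dig k \<inter> GL)" if b: "b \<in> ?B" for b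
  proof -
    obtain i where i: "i \<in> I" "conjg k (\<nu> i) b" using b by blast
    obtain g0 where g0: "g0 \<in> GL" "?P i b g0" using i(2) by (auto simp: conjg_def)
    obtain g1 where g1: "g1 \<in> GL" "g0 * g1 - 1 \<in> JJ k" "g1 * g0 - 1 \<in> JJ k" using GL_inverse_level[OF g0(1)] .
    let ?r = "rep (JJ k) (Dig k)"
    have r: "?r X \<in> Dig k" "X - ?r X \<in> JJ k" for X using rep[OF Dig_transversal[OF kL]] by auto
    have rGL: "?r X \<in> GL \<longleftrightarrow> X \<in> GL" for X using GL_cong[OF JJ_anti[OF _ r(2)]] k0 by simp
    have "{g \<in> ?G. ?P j b g} = {}" if "j \<in> I - {i}" for j
    proof -
      have "\<not> conjg k (\<nu> j) b" using conjg_trans[OF _ conjg_sym[OF i(2)], of "\<nu> j"] inj that i(1) by blast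
      then show ?thesis by (auto simp: conjg_def)
    qed
    then have "(\<Sum>j\<in>I - {i}. card {g \<in> ?G. ?P j b g}) = 0"
      by (intro sum.neutral ballI) (simp only: card.empty)
    then have "(\<Sum>i\<in>I. card {g \<in> ?G. ?P i b g}) = card {g \<in> ?G. ?P i b g}"
      using sum.remove[OF I i(1), of "\<lambda>i. card {g \<in> ?G. ?P i b g}"] by simp
    also have "\<dots> = card (cent k b \<inter> Dig k \<inter> GL)"
    proof (rule bij_betw_same_card[symmetric])
      show "bij_betw (\<lambda>h. ?r (h * g0)) (cent k b \<inter> Dig k \<inter> GL) {g \<in> ?G. ?P i b g}"
      proof (rule bij_betwI[where g = "\<lambda>g. ?r (g * g1)"])
        show "(\<lambda>h. ?r (h * g0)) \<in> cent k b \<inter> Dig k \<inter> GL \<rightarrow> {g \<in> ?G. ?P i b g}"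
        proof (intro Pi_I CollectI conjI IntI)
          fix h assume h: "h \<in> cent k b \<inter> Dig k \<inter> GL"
          show "?r (h * g0) \<in> Dig k" "?r (h * g0) \<in> GL" using h g0 r rGL GL_mult by auto
          have e: "h * b - b * h \<in> JJ k" using h cent_iff by blast
          \<comment> \<open>The first two terms lead from h g0 \<open>\<nu> i\<close> over h b g0 to
            b h g0; the last two replace h g0 by its representative.\<close>
          have "h * (g0 * \<nu> i - b * g0) + (h * b - b * h) * g0 - (h * g0 - ?r (h * g0)) * \<nu> i + b * (h * g0 - ?r (h * g0)) \<in> JJ k"
            by (rule JJ_closed(4)[OF JJ_closed(2)[OF JJ_closed(4)[OF JJ_mult[OF g0(2)] JJ_mult2[OF e]] JJ_mult2[OF r(2)]] JJ_mult[OF r(2)]])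
          then show "?P i b (?r (h * g0))" by (simp add: algebra_simps)
        qed
        show "(\<lambda>g. ?r (g * g1)) \<in> {g \<in> ?G. ?P i b g} \<rightarrow> cent k b \<inter> Dig k \<inter> GL"
        proof (intro Pi_I CollectI conjI IntI)
          fix g assume g: "g \<in> {g \<in> ?G. ?P i b g}"
          show "?r (g * g1) \<in> Dig k" "?r (g * g1) \<in> GL" using g g1 r rGL GL_mult by auto
          have f: "g * \<nu> i - b * g \<in> JJ k" using g by blast
          have "(g * \<nu> i - b * g) * g1 - g * (g1 * (g0 * \<nu> i - b * g0) - (g1 * g0 - 1) * \<nu> i) * g1
              - g * g1 * b * (g0 * g1 - 1) - (g * g1 - ?r (g * g1)) * b + b * (g * g1 - ?r (g * g1)) \<in> JJ k"
            by (rule JJ_closed(4)[OF JJ_closed(2)[OF JJ_closed(2)[OF JJ_closed(2)[OF JJ_mult2[OF f]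
                JJ_mult2[OF JJ_mult[OF JJ_closed(2)[OF JJ_mult[OF g0(2)] JJ_mult2[OF g1(3)]]]]]
                JJ_mult[OF g1(2)]] JJ_mult2[OF r(2)]] JJ_mult[OF r(2)]])
          then show "?r (g * g1) \<in> cent k b" unfolding cent_iff by (simp add: algebra_simps)
        qed
      next
        fix h assume h: "h \<in> cent k b \<inter> Dig k \<inter> GL"
        have "h * (g0 * g1 - 1) - (h * g0 - ?r (h * g0)) * g1 \<in> JJ k"
          by (rule JJ_closed(2)[OF JJ_mult[OF g1(2)] JJ_mult2[OF r(2)]])
        then have "?r (h * g0) * g1 - h \<in> JJ k" by (simp add: algebra_simps)
        then show "?r (?r (h * g0) * g1) = h" using h by (intro rep_eqI[OF Dig_transversal[OF kL]]) auto
      next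
        fix g assume g: "g \<in> {g \<in> ?G. ?P i b g}"
        have "g * (g1 * g0 - 1) - (g * g1 - ?r (g * g1)) * g0 \<in> JJ k"
          by (rule JJ_closed(2)[OF JJ_mult[OF g1(3)] JJ_mult2[OF r(2)]])
        then have "?r (g * g1) * g0 - g \<in> JJ k" by (simp add: algebra_simps)
        then show "?r (?r (g * g1) * g0) = g" using g by (intro rep_eqI[OF Dig_transversal[OF kL]]) auto
      qed
    qed
    finally show ?thesis .
  qed
  have "(\<Sum>b\<in>?B. card (cent k b \<inter> Dig k \<inter> GL)) = (\<Sum>b\<in>?B. \<Sum>i\<in>I. card {g \<in> ?G. ?P i b g})"
    using stab by simp
  also have "\<dots> = (\<Sum>i\<in>I. \<Sum>b\<in>?B. card {g \<in> ?G. ?P i b g})" by (rule sum.swap)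
  also have "\<dots> = (\<Sum>i\<in>I. \<Sum>g\<in>?G. card {b \<in> ?B. ?P i b g})"
    by (intro sum.cong refl sum_multicount_gen) (use fin in auto)
  also have "\<dots> = card I * card ?G" using one by simp
  finally show ?thesis .
qed

lemma conjg_GL:
  assumes "conjg k a b"
  shows "a \<in> GL \<longleftrightarrow> b \<in> GL"
proof -
  obtain g where g: "g \<in> GL" "g * a - b * g \<in> JJ k" using assms by (auto simp: conjg_def)
  then have "g * a - b * g \<in> JJ 1" using JJ_anti[OF _ g(2), of 1] k0 by simp
  then show ?thesis using GL_cong GL_mult g(1) by blast
qed

end

abbreviation conj1 :: "'a mat3 \<Rightarrow> 'a mat3 \<Rightarrow> bool" where
  "conj1 \<equiv> conjg 1"

lemma one_pos: "0 < (1::nat)"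
  by simp

lemmas GL_inverse1 = GL_inverse_level[OF one_pos L_pos]
lemmas GL_cancel_left = GL_cancel_left_level[OF one_pos L_pos]
lemmas GL_cancel_right = GL_cancel_right_level[OF one_pos L_pos]
lemmas conj1_def = conjg_def
lemmas conj1I = conjgI[OF one_pos L_pos]
lemmas conj1_cong = conjg_cong[OF one_pos L_pos]
lemmas conj1_sym = conjg_sym[OF one_pos L_pos]
lemmas conj1_trans = conjg_trans[OF one_pos L_pos]
lemmas cent1_iff = cent_iff[OF one_pos L_pos]
lemmas sum_centralizers = sum_centralizers_level[OF one_pos L_pos]

subsection \<open>Normal forms\<close>

definition companion :: "'a \<times> 'a \<times> 'a \<Rightarrow> 'a mat3" where
  "companion = (\<lambda>(c1, c2, c3). Mat3 0 0 c1 1 0 c2 0 1 c3)"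

text \<open>\<open>rank1 s y\<close> is the scalar \<open>s\<close> plus a matrix of rank one and trace \<open>y\<close>; it is semisimple for
  \<open>y \<noteq> 0\<close> and a scalar plus a nilpotent matrix for \<open>y = 0\<close>.\<close>

definition rank1 :: "'a \<Rightarrow> 'a \<Rightarrow> 'a mat3" where
  "rank1 s y = Mat3 s 0 1 0 s 0 0 0 (s + y)"

text \<open>The columns are v, b v and b^2 v, so the matrix is invertible iff v is a cyclic vector
  of b.\<close>

definition cyc :: "'a mat3 \<Rightarrow> 'a \<Rightarrow> 'a \<Rightarrow> 'a \<Rightarrow> 'a mat3" where
  "cyc b v1 v2 v3 = (let V = Mat3 v1 0 0 v2 0 0 v3 0 0; V1 = b * V; V2 = b * V1 in
    Mat3 v1 (m11 V1) (m11 V2) v2 (m21 V1) (m21 V2) v3 (m31 V1) (m31 V2))"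

lemma cyc_sel:
  "m11 (cyc b v1 v2 v3) = v1" "m21 (cyc b v1 v2 v3) = v2" "m31 (cyc b v1 v2 v3) = v3"
  "m12 (cyc b v1 v2 v3) = m11 b * v1 + m12 b * v2 + m13 b * v3"
  "m22 (cyc b v1 v2 v3) = m21 b * v1 + m22 b * v2 + m23 b * v3"
  "m32 (cyc b v1 v2 v3) = m31 b * v1 + m32 b * v2 + m33 b * v3"
  "m13 (cyc b v1 v2 v3) = m11 b * m12 (cyc b v1 v2 v3) + m12 b * m22 (cyc b v1 v2 v3) + m13 b * m32 (cyc b v1 v2 v3)"
  "m23 (cyc b v1 v2 v3) = m21 b * m12 (cyc b v1 v2 v3) + m22 b * m22 (cyc b v1 v2 v3) + m23 b * m32 (cyc b v1 v2 v3)"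
  "m33 (cyc b v1 v2 v3) = m31 b * m12 (cyc b v1 v2 v3) + m32 b * m22 (cyc b v1 v2 v3) + m33 b * m32 (cyc b v1 v2 v3)"
  by (simp_all add: cyc_def Let_def)

text \<open>If h has columns v, b v, b^2 v, then b h agrees with h times a companion matrix in the
  first two columns. The third asks for the coordinates of b^3 v in the basis h, which h' supplies
  up to h h' - 1.\<close>

lemma companion_column:
  assumes c1: "m12 h = m11 b * m11 h + m12 b * m21 h + m13 b * m31 h"
    "m22 h = m21 b * m11 h + m22 b * m21 h + m23 b * m31 h"
    "m32 h = m31 b * m11 h + m32 b * m21 h + m33 b * m31 h"
    and c2: "m13 h = m11 b * m12 h + m12 b * m22 h + m13 b * m32 h"
    "m23 h = m21 b * m12 h + m22 b * m22 h + m23 b * m32 h"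
    "m33 h = m31 b * m12 h + m32 b * m22 h + m33 b * m32 h"
    and W: "W = b * Mat3 0 0 (m13 h) 0 0 (m23 h) 0 0 (m33 h)"
  shows "h * companion (m13 (h' * W), m23 (h' * W), m33 (h' * W)) - b * h = (h * h' - 1) * W" (is "?l = ?r")
proof -
  have "m11 ?l = m11 ?r" "m21 ?l = m21 ?r" "m31 ?l = m31 ?r"
    by (simp_all add: companion_def W c1)
  moreover have "m12 ?l = m12 ?r" "m22 ?l = m22 ?r" "m32 ?l = m32 ?r"
    by (simp_all add: companion_def W c2)
  moreover have "m13 ?l = m13 ?r" "m23 ?l = m23 ?r" "m33 ?l = m33 ?r"
    by (simp_all add: companion_def W algebra_simps)
  ultimately show ?thesis by (simp only: mat3_eq_iff simp_thms)
qed

lemma cyc_conj_companion: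
  assumes "cyc b v1 v2 v3 \<in> GL"
  shows "\<exists>c\<in>SSS. conj1 (companion c) b"
proof -
  let ?h = "cyc b v1 v2 v3"
  obtain h' where h': "?h * h' - 1 \<in> JJ 1" using GL_inverse1[OF assms] .
  define W where "W = b * Mat3 0 0 (m13 ?h) 0 0 (m23 ?h) 0 0 (m33 ?h)"
  let ?c = "h' * W"
  let ?d = "(m13 ?c, m23 ?c, m33 ?c)"
  have "?h * companion ?d - b * ?h = (?h * h' - 1) * W"
    by (rule companion_column[OF _ _ _ _ _ _ W_def]) (simp_all only: cyc_sel)
  then have "?h * companion ?d - b * ?h \<in> JJ 1" using JJ_mult2[OF h'] by simp
  then have 1: "conj1 (companion ?d) b" using assms by (rule conj1I[rotated])
  let ?r = "rep JJJ SSS ?d"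
  have r: "?r \<in> SSS" "?d - ?r \<in> JJJ" using rep[OF SSS_transversal] by auto
  have "companion ?d - companion ?r \<in> JJ 1"
    using r(2) J_closed(1) by (cases ?r) (auto simp: companion_def mat3_of_def)
  then have "conj1 (companion ?r) b" using conj1_trans[OF conj1_sym[OF conj1_cong] 1] by blast
  then show ?thesis using r(1) by (rule bexI)
qed

text \<open>A matrix for which every vector is an eigenvector is scalar, so some v is independent of
  b v. In a basis v, b v, w the first column of the matrix is the second unit vector.\<close>

lemma nonscalar_basis:
  assumes "nonscalar b"
  obtains g b' where "g \<in> GL" "g * b' - b * g \<in> JJ 1" "m11 b' \<in> J 1" "m21 b' - 1 \<in> J 1" "m31 b' \<in> J 1"
proof -
  note basis = that
  have key: thesis if g: "Mat3 v1 (m11 b * v1 + m12 b * v2 + m13 b * v3) w1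
      v2 (m21 b * v1 + m22 b * v2 + m23 b * v3) w2 v3 (m31 b * v1 + m32 b * v2 + m33 b * v3) w3 \<in> GL" (is "?g \<in> GL")
    for v1 v2 v3 w1 w2 w3
  proof -
    obtain g' where g': "g' \<in> GL" "?g * g' - 1 \<in> JJ 1" "g' * ?g - 1 \<in> JJ 1" using GL_inverse1[OF g] .
    let ?b = "g' * b * ?g"
    have "(?g * g' - 1) * (b * ?g) \<in> JJ 1" by (rule JJ_mult2[OF g'(2)])
    then have 1: "?g * ?b - b * ?g \<in> JJ 1" by (simp add: left_diff_distrib mult.assoc)
    have 2: "m11 ?b = m12 (g' * ?g - 1)" "m21 ?b - 1 = m22 (g' * ?g - 1)" "m31 ?b = m32 (g' * ?g - 1)"
      by (simp_all add: algebra_simps)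
    show thesis
      by (rule basis[OF g 1]) (use g'(3) in \<open>unfold 2, auto simp only: mat3_of_def mem_Collect_eq\<close>)
  qed
  show thesis
  proof (rule ccontr)
    assume "\<not> thesis"
    then have n: "det3 (Mat3 v1 (m11 b * v1 + m12 b * v2 + m13 b * v3) w1
      v2 (m21 b * v1 + m22 b * v2 + m23 b * v3) w2 v3 (m31 b * v1 + m32 b * v2 + m33 b * v3) w3) \<in> J 1"
      for v1 v2 v3 w1 w2 w3
      using key[of v1 v2 v3 w1 w2 w3] unfolding GL_def mem_Collect_eq by metis
    \<comment> \<open>That the unit vectors are eigenvectors kills the off-diagonal entries; below,
      e1 + e2 and e1 + e3 make the diagonal constant.\<close>
    have z: "m21 b \<in> J 1" "m31 b \<in> J 1" "m12 b \<in> J 1" "m32 b \<in> J 1" "m23 b \<in> J 1" "m13 b \<in> J 1"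
      using n[of 1 0 0 0 0 1] n[of 1 0 0 0 1 0] n[of 0 1 0 0 0 1] n[of 0 1 0 1 0 0] n[of 0 0 1 1 0 0] n[of 0 0 1 0 1 0]
      by (simp_all add: det3_def J_uminus_iff)
    have d: "m21 b + m22 b - (m11 b + m12 b) \<in> J 1" "m11 b + m13 b - (m31 b + m33 b) \<in> J 1"
      using n[of 1 1 0 0 0 1] n[of 1 0 1 0 1 0] by (simp_all add: det3_def algebra_simps)
    have "(m21 b + m22 b - (m11 b + m12 b)) - m21 b + m12 b \<in> J 1"
      by (intro J_closed(4)[OF J_closed(2)] d z)
    moreover have "- (m11 b + m13 b - (m31 b + m33 b)) - m31 b + m13 b \<in> J 1"
      by (intro J_closed(4)[OF J_closed(2)[OF J_closed(3)]] d z)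
    ultimately have "b - sc (m11 b) \<in> JJ 1"
      using z J_closed(1) by (simp add: mat3_of_def)
    then show False using assms by (auto simp: nonscalar_def)
  qed
qed


lemma classification:
  assumes b: "nonscalar b"
  shows "(\<exists>c\<in>SSS. conj1 (companion c) b) \<or> (\<exists>s\<in>S. \<exists>y\<in>S. conj1 (rank1 s y) b)"
proof (rule disjCI)
  assume no: "\<not> (\<exists>s\<in>S. \<exists>y\<in>S. conj1 (rank1 s y) b)"
  show "\<exists>c\<in>SSS. conj1 (companion c) b"
  proof (rule ccontr)
    assume noc: "\<not> (\<exists>c\<in>SSS. conj1 (companion c) b)"
    have cyc: "det3 (cyc b' v1 v2 v3) \<in> J 1" if "conj1 b' b" for b' v1 v2 v3
    proof (rule ccontr)
      assume "det3 (cyc b' v1 v2 v3) \<notin> J 1"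
      then have "cyc b' v1 v2 v3 \<in> GL" unfolding GL_def by blast
      from cyc_conj_companion[OF this] show False using noc conj1_trans[OF _ that] by metis
    qed
    obtain g b' where g: "g \<in> GL" "g * b' - b * g \<in> JJ 1" and b': "m11 b' \<in> J 1" "m21 b' - 1 \<in> J 1" "m31 b' \<in> J 1"
      using nonscalar_basis[OF b] .
    define x p' y r z w where xyz: "x = m12 b'" "p' = m13 b'" "y = m22 b'" "r = m23 b'" "z = m32 b'" "w = m33 b'"
    define b0 where "b0 = Mat3 0 x p' 1 y r 0 z w"
    have "b' - b0 \<in> JJ 1" using b' J_closed(1) by (simp add: b0_def xyz mat3_of_def)
    then have c0: "conj1 b0 b" using conj1_trans[OF conj1_sym[OF conj1_cong] conj1I[OF g]] by blast
    \<comment> \<open>b0 sends e1 to e2, so this determinant is the last coordinate of b0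
      e2.\<close>
    have "det3 (cyc b0 1 0 0) = z" by (simp add: cyc_def b0_def det3_def)
    then have z: "z \<in> J 1" using cyc[OF c0, of 1 0 0] by simp
    define b1 where "b1 = Mat3 0 x p' 1 y r 0 0 w"
    have "b1 - b0 \<in> JJ 1" using z J_closed(1) J_closed(3) by (simp add: b0_def b1_def mat3_of_def)
    then have c1: "conj1 b1 b" using conj1_trans[OF conj1_cong c0] by blast
    let ?D = "p' + w * r" and ?F = "x + w * (y - w)"
    \<comment> \<open>If v has last coordinate 1 and (b1 - w) v = c e1, then v, b1 v, b1^2 v have
      determinant c^2, because b1 e1 = e2. The condition holds for v = (- r, 0, 1) with c = D and,
      below, for v = (w - y - r, 1, 1) with c = F + D.\<close>
    have "det3 (cyc b1 (- r) 0 1) = ?D * ?D"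
      by (simp add: cyc_def b1_def det3_def algebra_simps)
    then have D: "?D \<in> J 1" using cyc[OF c1, of "- r" 0 1] J1_prime by simp
    have "det3 (cyc b1 (w - y - r) 1 1) = (?F + ?D) * (?F + ?D)"
      by (simp add: cyc_def b1_def det3_def algebra_simps)
    then have "?F + ?D \<in> J 1" using cyc[OF c1, of "w - y - r" 1 1] J1_prime by simp
    from J_closed(2)[OF this D] have F: "?F \<in> J 1" by simp
    \<comment> \<open>As D and F vanish modulo p, b1 - w has rank one there: it is the column (- w,
      1, 0) times the row (1, y - w, r), of trace y - 2w. This row is the last row of
      \<open>?h\<close>, and \<open>?h\<close> moves the column to (1, 0, y - 2w), the column of the
      normal form.\<close>
    let ?h = "Mat3 0 1 0 0 0 1 1 (y - w) r"
    have h: "?h \<in> GL" using one_notin_J1 by (simp add: GL_def det3_def)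
    have "?h * b1 - rank1 w (y - 2 * w) * ?h = Mat3 0 0 0 0 0 0 0 ?F ?D"
      by (simp add: mat3_eq_iff b1_def rank1_def algebra_simps)
    then have "?h * b1 - rank1 w (y - 2 * w) * ?h \<in> JJ 1"
      using D F J_closed(1) by (simp add: mat3_of_def)
    then have 1: "conj1 (rank1 w (y - 2 * w)) b" using conj1_trans[OF conj1_sym[OF conj1I[OF h]] c1] by blast
    let ?w = "rep (J 1) S w" and ?y = "rep (J 1) S (y - 2 * w)"
    have r: "?w \<in> S" "?y \<in> S" "w - ?w \<in> J 1" "y - 2 * w - ?y \<in> J 1" using rep[OF S_transversal] by auto
    have "rank1 w (y - 2 * w) - rank1 ?w ?y \<in> JJ 1"
      using r(3,4) J_closed(4)[OF r(3,4)] J_closed(1) by (simp add: rank1_def mat3_of_def algebra_simps)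
    then have "conj1 (rank1 ?w ?y) b" using conj1_trans[OF conj1_sym[OF conj1_cong] 1] by blast
    then show False using no r by blast
  qed
qed

lemma conj1_tr3: "conj1 a b \<Longrightarrow> tr3 a - tr3 b \<in> J 1"
proof -
  assume "conj1 a b"
  then obtain g where g: "g \<in> GL" "g * a - b * g \<in> JJ 1" by (auto simp: conj1_def)
  obtain g' where g': "g * g' - 1 \<in> JJ 1" "g' * g - 1 \<in> JJ 1" using GL_inverse1[OF g(1)] by metis
  have "tr3 (g' * (g * a - b * g)) - tr3 ((g' * g - 1) * a) + tr3 (b * (g * g' - 1)) \<in> J 1"
    by (rule J_closed(4)[OF J_closed(2)[OF tr3_J[OF JJ_mult[OF g(2)]] tr3_J[OF JJ_mult2[OF g'(2)]]] tr3_J[OF JJ_mult[OF g'(1)]]])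
  moreover have "tr3 (g' * (g * a - b * g)) - tr3 ((g' * g - 1) * a) + tr3 (b * (g * g' - 1)) = tr3 a - tr3 b"
    using tr3_commute[of "b * g" g'] by (simp add: tr3_diff left_diff_distrib right_diff_distrib mult.assoc)
  ultimately show ?thesis by simp
qed

lemma conj1_power:
  assumes "g * a - b * g \<in> JJ 1"
  shows "g * a ^ k - b ^ k * g \<in> JJ 1"
proof (induction k)
  case (Suc k)
  from JJ_closed(4)[OF JJ_mult2[OF Suc, of a] JJ_mult[OF assms, of "b ^ k"]]
  show ?case by (simp add: algebra_simps power_Suc2 del: power_Suc)
qed (simp add: JJ_closed)

lemma conj1_annihilate:
  assumes "conj1 a b" and 0: "a ^ 3 - sc c3 * a ^ 2 - sc c2 * a - sc c1 = 0"
  shows "b ^ 3 - sc c3 * b ^ 2 - sc c2 * b - sc c1 \<in> JJ 1"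
proof -
  obtain g where g: "g \<in> GL" "g * a - b * g \<in> JJ 1" using assms by (auto simp: conj1_def)
  have "(g * a ^ 3 - b ^ 3 * g) - sc c3 * (g * a ^ 2 - b ^ 2 * g) - sc c2 * (g * a - b * g) \<in> JJ 1"
    by (rule JJ_closed(2)[OF JJ_closed(2)[OF conj1_power[OF g(2)] JJ_mult[OF conj1_power[OF g(2)]]] JJ_mult[OF g(2)]])
  moreover have "(g * a ^ 3 - b ^ 3 * g) - sc c3 * (g * a ^ 2 - b ^ 2 * g) - sc c2 * (g * a - b * g)
    = g * (a ^ 3 - sc c3 * a ^ 2 - sc c2 * a - sc c1) - (b ^ 3 - sc c3 * b ^ 2 - sc c2 * b - sc c1) * g"
    by (simp add: left_diff_distrib right_diff_distrib sc_left_commute sc_commute mult.assoc)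
  ultimately have "- ((b ^ 3 - sc c3 * b ^ 2 - sc c2 * b - sc c1) * g) \<in> JJ 1" using 0 by simp
  from JJ_closed(3)[OF this] show ?thesis using GL_cancel_right[OF g(1)] by simp
qed

text \<open>\<open>companion d\<close> satisfies the cubic equation of \<open>companion c\<close>
  modulo p. Its powers send e1 to e2, then to e3, then to d, so on e1 the equation reads d - c =
  0.\<close>

lemma companion_inj:
  assumes "c \<in> SSS" "d \<in> SSS" "conj1 (companion c) (companion d)"
  shows "c = d"
proof -
  obtain c1 c2 c3 d1 d2 d3 where cd: "c = (c1, c2, c3)" "d = (d1, d2, d3)" by (metis prod.exhaust)
  have "companion c ^ 3 - sc c3 * companion c ^ 2 - sc c2 * companion c - sc c1 = 0"
    by (simp add: cd mat3_eq_iff companion_def eval_nat_numeral algebra_simps)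
  from conj1_annihilate[OF assms(3) this]
  have "d1 - c1 \<in> J 1" "d2 - c2 \<in> J 1" "d3 - c3 \<in> J 1"
    by (simp_all add: cd companion_def eval_nat_numeral mat3_of_def)
  then show ?thesis using assms cd transversal_inj[OF S_transversal] by (metis mem_Times_iff fst_conv snd_conv)
qed

text \<open>Conjugation preserves the equation (a - s)^2 = y (a - s), whose entry in row 1 and
  column 3 gives 2(t - s) + z - y = 0; it also preserves the trace 3s + y. The two relations add up
  to s - t = 0, so there is no division by 2 or 3 and every characteristic is covered.\<close>

lemma rank1_inj:
  assumes S: "s \<in> S" "y \<in> S" "t \<in> S" "z \<in> S" and c: "conj1 (rank1 s y) (rank1 t z)"
  shows "s = t \<and> y = z"
proof -
  let ?a = "rank1 s y" and ?b = "rank1 t z"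
  obtain g where g: "g \<in> GL" "g * ?a - ?b * g \<in> JJ 1" using c by (auto simp: conj1_def)
  have "g * (?a - sc s) - (?b - sc s) * g = g * ?a - ?b * g"
    by (simp add: algebra_simps sc_commute)
  then have g': "g * (?a - sc s) - (?b - sc s) * g \<in> JJ 1" using g by simp
  have "g * (?a - sc s) ^ 2 - (?b - sc s) ^ 2 * g \<in> JJ 1" by (rule conj1_power[OF g'])
  moreover have "(?a - sc s) ^ 2 = sc y * (?a - sc s)"
    by (simp add: mat3_eq_iff rank1_def power2_eq_square algebra_simps)
  ultimately have "g * (sc y * (?a - sc s)) - (?b - sc s) ^ 2 * g \<in> JJ 1" by simp
  moreover have eq: "g * (sc y * A) - B ^ 2 * g - sc y * (g * A - B * g) = - ((B ^ 2 - sc y * B) * g)" for A B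
    by (simp add: sc_left_commute[of g y] algebra_simps)
  ultimately have "g * (sc y * (?a - sc s)) - (?b - sc s) ^ 2 * g - sc y * (g * (?a - sc s) - (?b - sc s) * g) \<in> JJ 1"
    using JJ_closed(2)[OF _ JJ_mult[OF g', of "sc y"]] by blast
  then
  have "- (((?b - sc s) ^ 2 - sc y * (?b - sc s)) * g) \<in> JJ 1"
    unfolding eq .
  from JJ_closed(3)[OF this] have "((?b - sc s) ^ 2 - sc y * (?b - sc s)) \<in> JJ 1"
    using GL_cancel_right[OF g(1)] by simp
  then have 1: "2 * (t - s) + z - y \<in> J 1"
    by (simp add: mat3_of_def rank1_def power2_eq_square algebra_simps)
  have 2: "(3 * s + y) - (3 * t + z) \<in> J 1"
    using conj1_tr3[OF c] by (simp add: tr3_def rank1_def algebra_simps)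
  from J_closed(4)[OF 1 2] have "s - t \<in> J 1" by (simp add: algebra_simps)
  then have st: "s = t" using S transversal_inj[OF S_transversal] by blast
  with 1 have "z - y \<in> J 1" by simp
  then show ?thesis using st S transversal_inj[OF S_transversal, of z y] by simp
qed

lemmas conj1_GL = conjg_GL[OF one_pos L_pos]

subsection \<open>Transport along a conjugation\<close>

text \<open>The conjugation X -> g X g' is additive and linear exactly, but multiplicative only
  modulo p, because g' inverts g only modulo p. With these properties collected, statements on
  centralizers pass from a to b without reference to g.\<close>

definition transport :: "'a mat3 \<Rightarrow> 'a mat3 \<Rightarrow> ('a mat3 \<Rightarrow> 'a mat3) \<Rightarrow> bool" where
  "transport a b T \<longleftrightarrow> (\<forall>X Y. T (X - Y) = T X - T Y) \<and> (\<forall>X Y. T (X + Y) = T X + T Y)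
    \<and> (\<forall>c X. T (sc c * X) = sc c * T X) \<and> T 1 - 1 \<in> JJ 1 \<and> (\<forall>X. T X \<in> JJ 1 \<longleftrightarrow> X \<in> JJ 1)
    \<and> (\<forall>X Y. T (X * Y) - T X * T Y \<in> JJ 1) \<and> T a - b \<in> JJ 1 \<and> (\<forall>X. tr3 (T X) - tr3 X \<in> J 1)
    \<and> (\<forall>X. T X \<in> GL \<longleftrightarrow> X \<in> GL) \<and> (\<forall>Y. \<exists>X. T X - Y \<in> JJ 1)"

lemma transportD:
  assumes "transport a b T"
  shows "T (X - Y) = T X - T Y" "T (X + Y) = T X + T Y" "T (sc c * X) = sc c * T X" "T 1 - 1 \<in> JJ 1"
    "T X \<in> JJ 1 \<longleftrightarrow> X \<in> JJ 1" "T (X * Y) - T X * T Y \<in> JJ 1" "T a - b \<in> JJ 1"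
    "tr3 (T X) - tr3 X \<in> J 1" "T X \<in> GL \<longleftrightarrow> X \<in> GL" "\<exists>X. T X - Y \<in> JJ 1"
  using assms unfolding transport_def by simp_all

lemma conj1_transport:
  assumes "conj1 a b"
  shows "\<exists>T. transport a b T"
proof -
  obtain g where g: "g \<in> GL" "g * a - b * g \<in> JJ 1" using assms by (auto simp: conj1_def)
  obtain g' where g': "g' \<in> GL" "g * g' - 1 \<in> JJ 1" "g' * g - 1 \<in> JJ 1" using GL_inverse1[OF g(1)] .
  have "transport a b (\<lambda>X. g * X * g')"
    unfolding transport_def
  proof (intro conjI allI)
    show "g * (X * Y) * g' - g * X * g' * (g * Y * g') \<in> JJ 1" for X Y
      using JJ_closed(3)[OF JJ_mult2[OF JJ_mult2[OF JJ_mult[OF g'(3), of "g * X"], of Y], of g']] by (simp add: algebra_simps)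
    show "g * a * g' - b \<in> JJ 1"
      using JJ_closed(4)[OF JJ_mult2[OF g(2), of g'] JJ_mult[OF g'(2), of b]] by (simp add: algebra_simps)
    show "tr3 (g * X * g') - tr3 X \<in> J 1" for X
      using tr3_J[OF JJ_mult2[OF g'(3), of X]] tr3_commute[of "g * X" g'] by (simp add: tr3_diff algebra_simps)
    show "\<exists>X. g * X * g' - Y \<in> JJ 1" for Y
      using JJ_closed(4)[OF JJ_mult2[OF g'(2), of "Y * (g * g')"] JJ_mult[OF g'(2), of Y]]
      by (intro exI[of _ "g' * Y * g"]) (simp add: algebra_simps)
    show "g * X * g' \<in> JJ 1 \<longleftrightarrow> X \<in> JJ 1" for X
      using GL_cancel_left[OF g(1)] GL_cancel_right[OF g'(1)] by simp
    show "g * X * g' \<in> GL \<longleftrightarrow> X \<in> GL" for X using GL_mult g g' by blast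
    show "g * 1 * g' - 1 \<in> JJ 1" using g' by simp
    show "g * (sc c * X) * g' = sc c * (g * X * g')" for c X by (simp add: sc_left_commute mult.assoc)
  qed (simp_all add: algebra_simps)
  then show ?thesis by blast
qed

text \<open>On residues T is additive, onto and has trivial kernel, so every fibre is a single
  matrix.\<close>

lemma card_transport:
  assumes T: "\<And>X Y. T (X - Y) = T X - T Y" "\<And>X. T X \<in> JJ 1 \<longleftrightarrow> X \<in> JJ 1" "\<And>Y. \<exists>X. T X - Y \<in> JJ 1"
    and PQ: "\<And>X Y. T X - Y \<in> JJ 1 \<Longrightarrow> P X \<longleftrightarrow> Q Y"
  shows "card {X \<in> Dig 1. P X} = card {X \<in> Dig 1. Q X}"
proof -
  have "card {X \<in> UNIV \<inter> Dig 1. P X} = card {d \<in> Dig 1. Q d \<and> (\<exists>x\<in>UNIV. T x - d \<in> JJ 1)} *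
      card {X \<in> UNIV \<inter> Dig 1. T X \<in> JJ 1}"
    by (rule card_fibres[where f = T and ?K1.0 = "JJ 1"])
      (use T PQ in \<open>auto simp: Dig1_transversal finite_Dig subspace1D(1)[OF subspace1_UNIV] simp del: One_nat_def\<close>)
  moreover have "{X \<in> UNIV \<inter> Dig 1. T X \<in> JJ 1} = {0}" using T(2) Dig1_JJ1 zero_Dig[of 1] JJ_closed(1)[of 1] by blast
  ultimately show ?thesis using T(3) by simp
qed

lemma transport_cent:
  assumes T: "\<And>X Y. T (X - Y) = T X - T Y" "\<And>X. T X \<in> JJ 1 \<longleftrightarrow> X \<in> JJ 1"
    "\<And>X Y. T (X * Y) - T X * T Y \<in> JJ 1" "T a - b \<in> JJ 1"
  shows "T X \<in> cent 1 b \<longleftrightarrow> X \<in> cent 1 a"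
proof -
  have "T (X * a - a * X) - (T X * b - b * T X) \<in> JJ 1"
    using JJ_closed(2)[OF JJ_closed(4)[OF T(3)[of X a] JJ_mult[OF T(4), of "T X"]]
      JJ_closed(4)[OF T(3)[of a X] JJ_mult2[OF T(4), of "T X"]]] by (simp add: T(1) algebra_simps)
  then show ?thesis unfolding cent1_iff using JJ_cong T(2) by blast
qed

lemma cent1_cong: "X - Y \<in> JJ 1 \<Longrightarrow> X \<in> cent 1 b \<longleftrightarrow> Y \<in> cent 1 b"
  using add_subgroup_cong[OF cent_subgroup] JJ_cent by blast

lemma conj1_card_cent:
  assumes "conj1 a b"
  shows "card (cent 1 a \<inter> Dig 1) = card (cent 1 b \<inter> Dig 1)"
    and "card (cent 1 a \<inter> Dig 1 \<inter> GL) = card (cent 1 b \<inter> Dig 1 \<inter> GL)"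
    and "card {X \<in> cent 1 a \<inter> Dig 1 \<inter> GL. \<exists>c d. X - (sc c + sc d * a) \<in> JJ 1}
      = card {X \<in> cent 1 b \<inter> Dig 1 \<inter> GL. \<exists>c d. X - (sc c + sc d * b) \<in> JJ 1}"
proof -
  obtain T where tr: "transport a b T" using conj1_transport[OF assms] by blast
  note T = transportD[OF tr]
  have c: "X \<in> cent 1 a \<longleftrightarrow> Y \<in> cent 1 b" if "T X - Y \<in> JJ 1" for X Y
    using transport_cent[OF T(1,5,6,7)] cent1_cong[OF that] by blast
  have g: "X \<in> GL \<longleftrightarrow> Y \<in> GL" if "T X - Y \<in> JJ 1" for X Y using T(9) GL_cong[OF that] by blast
  have s: "(\<exists>c d. X - (sc c + sc d * a) \<in> JJ 1) \<longleftrightarrow> (\<exists>c d. Y - (sc c + sc d * b) \<in> JJ 1)" if XY: "T X - Y \<in> JJ 1" for X Y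
  proof -
    have "X - (sc c + sc d * a) \<in> JJ 1 \<longleftrightarrow> Y - (sc c + sc d * b) \<in> JJ 1" for c d
    proof -
      have e: "T (sc c) = sc c * T 1" using T(3)[of c 1] by simp
      have "T (X - (sc c + sc d * a)) - (Y - (sc c + sc d * b)) \<in> JJ 1"
        using JJ_closed(2)[OF JJ_closed(2)[OF XY JJ_mult[OF T(4), of "sc c"]] JJ_mult[OF T(7), of "sc d"]]
        by (simp add: T(1-3) e algebra_simps)
      then show ?thesis using JJ_cong T(5) by blast
    qed
    then show ?thesis by blast
  qed
  have 1: "card {X \<in> Dig 1. X \<in> cent 1 a} = card {X \<in> Dig 1. X \<in> cent 1 b}"
    by (rule card_transport[where T = T, OF T(1,5,10) c])
  have 2: "card {X \<in> Dig 1. X \<in> cent 1 a \<and> X \<in> GL} = card {X \<in> Dig 1. X \<in> cent 1 b \<and> X \<in> GL}"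
    by (rule card_transport[where T = T, OF T(1,5,10)]) (metis c g)
  have 3: "card {X \<in> Dig 1. X \<in> cent 1 a \<and> X \<in> GL \<and> (\<exists>c d. X - (sc c + sc d * a) \<in> JJ 1)}
      = card {X \<in> Dig 1. X \<in> cent 1 b \<and> X \<in> GL \<and> (\<exists>c d. X - (sc c + sc d * b) \<in> JJ 1)}"
    by (rule card_transport[where T = T, OF T(1,5,10)]) (metis c g s)
  show "card (cent 1 a \<inter> Dig 1) = card (cent 1 b \<inter> Dig 1)"
    using 1 by (simp add: Int_def conj_ac)
  show "card (cent 1 a \<inter> Dig 1 \<inter> GL) = card (cent 1 b \<inter> Dig 1 \<inter> GL)"
    using 2 by (simp add: Int_def conj_ac)
  show "card {X \<in> cent 1 a \<inter> Dig 1 \<inter> GL. \<exists>c d. X - (sc c + sc d * a) \<in> JJ 1}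
      = card {X \<in> cent 1 b \<inter> Dig 1 \<inter> GL. \<exists>c d. X - (sc c + sc d * b) \<in> JJ 1}"
    using 3 by (simp add: conj_ac)
qed

text \<open>The images of x, y, z and of the dual matrices serve for b: T preserves commutators and
  traces modulo p.\<close>

lemma conj1_five:
  assumes "conj1 a b" and five: "five (cent 1 a) a x y z"
  shows "\<exists>x' y' z'. five (cent 1 b) b x' y' z'"
proof -
  obtain T where tr: "transport a b T" using conj1_transport[OF assms(1)] by blast
  note T = transportD[OF tr]
  have lin: "T (lin5 a x y z t) - lin5 b (T x) (T y) (T z) t \<in> JJ 1" for t
  proof -
    obtain s0 s1 c d e where t: "t = (s0, s1, c, d, e)" by (cases t)
    have e: "T (sc s0) = sc s0 * T 1" using T(3)[of s0 1] by simp
    show ?thesis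
      using JJ_closed(4)[OF JJ_mult[OF T(4), of "sc s0"] JJ_mult[OF T(7), of "sc s1"]]
      by (simp add: t lin5_def T(2,3) e algebra_simps)
  qed
  have tr3T: "tr3 (u * comm v w) - tr3 (T u * comm (T v) (T w)) \<in> J 1" for u v w
  proof -
    have "T (u * comm v w) - T u * comm (T v) (T w) \<in> JJ 1"
      using JJ_closed(4)[OF T(6)[of u "comm v w"] JJ_mult[OF JJ_closed(2)[OF T(6)[of v w] T(6)[of w v]], of "T u"]]
      by (simp add: comm_def T(1) algebra_simps)
    from J_closed(2)[OF tr3_J[OF this] T(8)[of "u * comm v w"]] show ?thesis
      using J_uminus_iff[of "tr3 (u * comm v w) - tr3 (T u * comm (T v) (T w))" 1] by (simp add: tr3_diff)
  qed
  have com: "comm3 (T x) (T y) (T z) (T u) - d \<in> JJJ" if "comm3 x y z u - d \<in> JJJ" for u d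
  proof -
    have "comm3 x y z u - comm3 (T x) (T y) (T z) (T u) \<in> JJJ" using tr3T by (simp add: comm3_def del: One_nat_def)
    then have "comm3 x y z u - d - (comm3 (T x) (T y) (T z) (T u) - d) \<in> JJJ" by simp
    then show ?thesis using add_subgroup_cong[OF JJJ_subgroup] that by metis
  qed
  have "five (cent 1 b) b (T x) (T y) (T z)"
    unfolding five_def
  proof (intro conjI allI impI)
    fix Y
    obtain X where X: "T X - Y \<in> JJ 1" using T(10) by blast
    have "Y - lin5 b (T x) (T y) (T z) t \<in> JJ 1 \<longleftrightarrow> X - lin5 a x y z t \<in> JJ 1" for t
    proof -
      have "T (X - lin5 a x y z t) - (Y - lin5 b (T x) (T y) (T z) t) \<in> JJ 1"
        using JJ_closed(2)[OF X lin[of t]] by (simp add: T(1) algebra_simps)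
      then show ?thesis using JJ_cong T(5) by blast
    qed
    moreover have "Y \<in> cent 1 b \<longleftrightarrow> X \<in> cent 1 a"
      using transport_cent[OF T(1,5,6,7)] cent1_cong[OF X] by blast
    ultimately show "Y \<in> cent 1 b \<longleftrightarrow> (\<exists>t. Y - lin5 b (T x) (T y) (T z) t \<in> JJ 1)"
      using five_mem[OF five] by blast
  next
    fix t assume "lin5 b (T x) (T y) (T z) t \<in> JJ 1"
    then have "lin5 a x y z t \<in> JJ 1" using JJ_cong[OF lin] T(5) by blast
    then show "t \<in> J 1 \<times> J 1 \<times> JJJ" by (rule five_inj[OF five])
  next
    from five obtain u v w where uvw: "comm3 x y z u - (1, 0, 0) \<in> JJJ" "comm3 x y z v - (0, 1, 0) \<in> JJJ"
      "comm3 x y z w - (0, 0, 1) \<in> JJJ" unfolding five_def by metis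
    show "\<exists>u v w. comm3 (T x) (T y) (T z) u - (1, 0, 0) \<in> JJJ \<and> comm3 (T x) (T y) (T z) v - (0, 1, 0) \<in> JJJ
        \<and> comm3 (T x) (T y) (T z) w - (0, 0, 1) \<in> JJJ"
      by (rule exI[of _ "T u"], rule exI[of _ "T v"], rule exI[of _ "T w"]) (intro conjI com uvw)
  qed
  then show ?thesis by blast
qed


subsection \<open>Centralizers of the normal forms\<close>

lemma cent1_sc: "cent 1 (sc s) = UNIV"
  using JJ_closed(1) by (simp add: cent_def)

text \<open>Since e1 is a cyclic vector, a matrix commuting with C is determined by its first
  column, and the polynomial in C with these three coefficients has the same first column. The
  difference Y has first column 0 and commutes with C, so the other columns vanish in turn.\<close>

lemma cent1_companion:
  "X \<in> cent 1 (companion (c1, c2, c3)) \<Longrightarrow>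
    X - (sc (m11 X) + sc (m21 X) * companion (c1, c2, c3) + sc (m31 X) * companion (c1, c2, c3) ^ 2) \<in> JJ 1"
proof -
  let ?C = "companion (c1, c2, c3)"
  assume X: "X \<in> cent 1 ?C"
  define Y where "Y = X - (sc (m11 X) + sc (m21 X) * ?C + sc (m31 X) * ?C ^ 2)"
  have "comm (sc (m11 X) + sc (m21 X) * ?C + sc (m31 X) * ?C ^ 2) ?C = 0"
    by (simp add: comm_add_left comm_sc_mult_left) (simp add: comm_def power2_eq_square algebra_simps)
  then have "comm Y ?C = comm X ?C" by (simp add: Y_def comm_diff_left)
  then have Y: "Y * ?C - ?C * Y \<in> JJ 1" using X by (simp add: cent_def comm_def)
  have 0: "m11 Y = 0" "m21 Y = 0" "m31 Y = 0"
    by (simp_all add: Y_def companion_def power2_eq_square)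
  have c2: "m12 Y \<in> J 1" "m22 Y \<in> J 1" "m32 Y \<in> J 1"
    using Y 0 by (simp_all add: mat3_of_def companion_def)
  have "m13 Y - c1 * m32 Y \<in> J 1" "m23 Y - (m12 Y + c2 * m32 Y) \<in> J 1" "m33 Y - (m22 Y + c3 * m32 Y) \<in> J 1"
    using Y by (simp_all add: mat3_of_def companion_def)
  from J_closed(4)[OF this(1) J_mult[OF c2(3), of c1]] J_closed(4)[OF this(2) J_closed(4)[OF c2(1) J_mult[OF c2(3), of c2]]]
    J_closed(4)[OF this(3) J_closed(4)[OF c2(2) J_mult[OF c2(3), of c3]]]
  have "m13 Y \<in> J 1" "m23 Y \<in> J 1" "m33 Y \<in> J 1" by (simp_all only: diff_add_cancel)
  then have "Y \<in> JJ 1" using c2 0 J_closed(1) by (simp add: mat3_of_def)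
  then show ?thesis by (simp only: Y_def)
qed

lemma Dig1_iff: "X \<in> Dig 1 \<longleftrightarrow> m11 X \<in> S \<and> m12 X \<in> S \<and> m13 X \<in> S \<and> m21 X \<in> S \<and> m22 X \<in> S \<and> m23 X \<in> S
    \<and> m31 X \<in> S \<and> m32 X \<in> S \<and> m33 X \<in> S"
  unfolding dig_1 by (simp add: mat3_of_def)

lemma card_cent1_companion: "card (cent 1 (companion c) \<inter> Dig 1) = q ^ 3"
proof -
  obtain c1 c2 c3 where c: "c = (c1, c2, c3)" by (cases c)
  let ?C = "companion c" and ?f = "\<lambda>X. (m11 X, m21 X, m31 X)"
  let ?l = "\<lambda>(x, y, z). sc x + sc y * ?C + sc z * ?C ^ 2"
  have l: "X - ?l (?f X) \<in> JJ 1" if "X \<in> cent 1 ?C" for X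
    using cent1_companion that by (simp only: c prod.case)
  have lf: "?f (?l t) = t" for t by (cases t) (simp add: c companion_def power2_eq_square)
  have lC: "?l t \<in> cent 1 ?C" for t
  proof -
    have "comm (?l t) ?C = 0"
      by (cases t) (simp add: comm_add_left comm_sc_mult_left, simp add: comm_def power2_eq_square algebra_simps)
    then show ?thesis using JJ_closed(1) by (simp add: cent_def)
  qed
  have "bij_betw ?f (cent 1 ?C \<inter> Dig 1) SSS"
    unfolding bij_betw_def
  proof
    show "inj_on ?f (cent 1 ?C \<inter> Dig 1)"
    proof (rule inj_onI)
      fix X Y assume XY: "X \<in> cent 1 ?C \<inter> Dig 1" "Y \<in> cent 1 ?C \<inter> Dig 1" and e: "?f X = ?f Y"
      have "X - Y \<in> JJ 1" using JJ_closed(2)[OF l[of X] l[of Y]] XY e by simp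
      then show "X = Y" using XY by (intro transversal_inj[OF Dig1_transversal]) auto
    qed
    show "?f ` (cent 1 ?C \<inter> Dig 1) = SSS"
    proof (intro equalityI subsetI)
      fix t assume "t \<in> ?f ` (cent 1 ?C \<inter> Dig 1)"
      then obtain X where X: "X \<in> Dig 1" "t = ?f X" by blast
      then show "t \<in> SSS" by (simp only: Dig1_iff mem_Times_iff fst_conv snd_conv simp_thms)
    next
      fix t assume t: "t \<in> SSS"
      let ?X = "rep (JJ 1) (Dig 1) (?l t)"
      have X: "?X \<in> Dig 1" "?l t - ?X \<in> JJ 1" by (rule rep[OF Dig1_transversal])+
      have XC: "?X \<in> cent 1 ?C" using lC cent1_cong[OF X(2)] by blast
      obtain x y z where te: "t = (x, y, z)" by (cases t)
      have "m11 (?l t) - m11 ?X \<in> J 1" "m21 (?l t) - m21 ?X \<in> J 1" "m31 (?l t) - m31 ?X \<in> J 1"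
        using X(2) by (simp_all only: mat3_of_def mem_Collect_eq mat3_sel)
      moreover have "m11 (?l t) = x" "m21 (?l t) = y" "m31 (?l t) = z" using lf[of t] by (simp_all only: te prod.inject)
      moreover have S: "?f ?X \<in> SSS" using X(1) by (simp only: Dig1_iff mem_Times_iff fst_conv snd_conv simp_thms)
      ultimately have "t - ?f ?X \<in> JJJ" unfolding te diff_Pair mem_Times_iff fst_conv snd_conv by (simp only: simp_thms)
      then have "t = ?f ?X" using t S by (intro transversal_inj[OF SSS_transversal])
      then show "t \<in> ?f ` (cent 1 ?C \<inter> Dig 1)" using X(1) XC by (intro image_eqI[of _ _ ?X]) auto
    qed
  qed
  from bij_betw_same_card[OF this] show ?thesis by (simp add: card_cartesian_product power3_eq_cube)
qed

lemma cent1_rank1: "X \<in> cent 1 (rank1 s y) \<longleftrightarrow>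
  m31 X \<in> J 1 \<and> m32 X \<in> J 1 \<and> m11 X + y * m13 X - m33 X \<in> J 1 \<and> m21 X + y * m23 X \<in> J 1"
proof -
  have e: "comm X (rank1 s y) = Mat3 (- m31 X) (- m32 X) (m11 X + y * m13 X - m33 X)
    0 0 (m21 X + y * m23 X) (- (y * m31 X)) (- (y * m32 X)) (m31 X)"
    by (simp add: mat3_eq_iff comm_def rank1_def algebra_simps)
  show ?thesis
    unfolding cent_def mem_Collect_eq e
    using J_closed(1)[of 1] J_mult[of "m31 X" 1 y] J_mult[of "m32 X" 1 y]
    by (auto simp: mat3_of_def J_uminus_iff simp del: One_nat_def)
qed

text \<open>In matrix units \<open>?x\<close> = E12, \<open>?y\<close> = E22 and \<open>?z\<close> =
  E23 - y E21. The commutators [\<open>?y\<close>, \<open>?z\<close>] = E23 - y E21,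
  [\<open>?z\<close>, \<open>?x\<close>] = y (E11 - E22) - E13 and
  [\<open>?x\<close>, \<open>?y\<close>] = E12 stay independent for y = 0, so one basis serves both
  types. E32, - E31 and E21 are dual to them.\<close>

lemma five_rank1: "\<exists>x y' z. five (cent 1 (rank1 s y)) (rank1 s y) x y' z"
proof -
  let ?x = "Mat3 0 1 0 0 0 0 0 0 0 :: 'a mat3" and ?y = "Mat3 0 0 0 0 1 0 0 0 0 :: 'a mat3"
    and ?z = "Mat3 0 0 0 (- y) 0 1 0 0 0 :: 'a mat3"
  have lin: "lin5 (rank1 s y) ?x ?y ?z (a, b, c, d, e)
      = Mat3 (a + b * s) c b (- (e * y)) (a + b * s + d) e 0 0 (a + b * s + b * y)" for a b c d e
    by (simp add: mat3_eq_iff lin5_def rank1_def algebra_simps)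
  have "five (cent 1 (rank1 s y)) (rank1 s y) ?x ?y ?z"
    unfolding five_def
  proof (intro conjI allI impI)
    fix X
    show "X \<in> cent 1 (rank1 s y) \<longleftrightarrow> (\<exists>t. X - lin5 (rank1 s y) ?x ?y ?z t \<in> JJ 1)"
    proof
      assume X: "X \<in> cent 1 (rank1 s y)"
      then have *: "- (m11 X + y * m13 X - m33 X) \<in> J 1" unfolding cent1_rank1 J_uminus_iff by blast
      have "X - lin5 (rank1 s y) ?x ?y ?z (m11 X - m13 X * s, m13 X, m12 X, m22 X - m11 X, m23 X) \<in> JJ 1"
        unfolding lin using X[unfolded cent1_rank1] J_closed(1) * by (simp add: mat3_of_def algebra_simps)
      then show "\<exists>t. X - lin5 (rank1 s y) ?x ?y ?z t \<in> JJ 1" by blast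
    next
      assume "\<exists>t. X - lin5 (rank1 s y) ?x ?y ?z t \<in> JJ 1"
      then obtain t where t: "X - lin5 (rank1 s y) ?x ?y ?z t \<in> JJ 1" by blast
      have "lin5 (rank1 s y) ?x ?y ?z t \<in> cent 1 (rank1 s y)"
        using J_closed(1) by (cases t) (simp add: lin cent1_rank1 algebra_simps del: One_nat_def)
      then show "X \<in> cent 1 (rank1 s y)" using cent1_cong[OF t] by blast
    qed
  next
    fix t assume t: "lin5 (rank1 s y) ?x ?y ?z t \<in> JJ 1"
    obtain a b c d e where te: "t = (a, b, c, d, e)" by (cases t)
    have J: "a + b * s \<in> J 1" "c \<in> J 1" "b \<in> J 1" "a + b * s + d \<in> J 1" "e \<in> J 1"
      using t by (simp_all add: te lin mat3_of_def)
    from J_closed(2)[OF J(1) J_mult2[OF J(3), of s]] J_closed(2)[OF J(4) J(1)]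
    show "t \<in> J 1 \<times> J 1 \<times> JJJ" using J by (simp add: te)
  next
    have "comm3 ?x ?y ?z (Mat3 0 0 0 0 0 0 0 1 0) = (1, 0, 0)" "comm3 ?x ?y ?z (Mat3 0 0 0 0 0 0 (- 1) 0 0) = (0, 1, 0)"
      "comm3 ?x ?y ?z (Mat3 0 0 0 1 0 0 0 0 0) = (0, 0, 1)"
      by (simp_all add: comm3_def comm_def tr3_def)
    then show "\<exists>u v w. comm3 ?x ?y ?z u - (1, 0, 0) \<in> JJJ \<and> comm3 ?x ?y ?z v - (0, 1, 0) \<in> JJJ
        \<and> comm3 ?x ?y ?z w - (0, 0, 1) \<in> JJJ"
      using J_closed(1)
      by (intro exI[of _ "Mat3 0 0 0 0 0 0 0 1 0"] exI[of _ "Mat3 0 0 0 0 0 0 (- 1) 0 0"] exI[of _ "Mat3 0 0 0 1 0 0 0 0 0"])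
         (simp add: zero_prod_def)
  qed
  then show ?thesis by blast
qed

lemma S_J1: "x \<in> S \<Longrightarrow> x \<in> J 1 \<longleftrightarrow> x = 0"
  using transversal_inj[OF S_transversal _ S_0, of x] J_closed(1) by auto

lemma span2_rank1:
  assumes "X \<in> cent 1 (rank1 s y)"
  shows "(\<exists>c d. X - (sc c + sc d * rank1 s y) \<in> JJ 1) \<longleftrightarrow>
    m12 X \<in> J 1 \<and> m21 X \<in> J 1 \<and> m23 X \<in> J 1 \<and> m22 X - m11 X \<in> J 1" (is "?L \<longleftrightarrow> ?R")
proof
  assume ?L
  then obtain c d where cd: "X - (sc c + sc d * rank1 s y) \<in> JJ 1" by blast
  then have "m12 X \<in> J 1" "m21 X \<in> J 1" "m23 X \<in> J 1" "m22 X - (c + d * s) \<in> J 1" "m11 X - (c + d * s) \<in> J 1"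
    by (simp_all add: mat3_of_def rank1_def)
  with J_closed(2)[OF this(4,5)] show ?R by simp
next
  assume R: ?R
  have X: "m31 X \<in> J 1" "m32 X \<in> J 1" "- (m11 X + y * m13 X - m33 X) \<in> J 1"
    using assms unfolding cent1_rank1 J_uminus_iff by auto
  have "X - (sc (m11 X - m13 X * s) + sc (m13 X) * rank1 s y) \<in> JJ 1"
    using R X J_closed(1) by (simp add: mat3_of_def rank1_def algebra_simps)
  then show ?L by blast
qed

lemma det3_rank1_cent:
  assumes "X \<in> cent 1 (rank1 s y)" "X \<in> Dig 1"
  shows "X \<in> GL \<longleftrightarrow> m33 X \<noteq> 0 \<and> m11 X * m22 X - m12 X * m21 X \<notin> J 1"
proof -
  have "m31 X = 0" "m32 X = 0" using assms S_J1 unfolding cent1_rank1 Dig1_iff by auto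
  then have "det3 X = m33 X * (m11 X * m22 X - m12 X * m21 X)" by (simp add: det3_def algebra_simps)
  then show ?thesis using S_J1[of "m33 X"] assms(2) unfolding GL_def Dig1_iff by (simp add: J1_prime del: One_nat_def)
qed

lemma card_S': "card (S - {0}) = q - 1"
  using S_0 S_finite by simp

text \<open>The centralizer consists of the upper triangular matrices whose first and last diagonal
  entries are an equal a; they are invertible iff a and the middle entry are nonzero. In the span of
  1 and n only a and the upper right corner are free.\<close>

lemma counts_nilpotent:
  "card (cent 1 (rank1 s 0) \<inter> Dig 1 \<inter> GL) = (q - 1) ^ 2 * q ^ 3"
  "card {X \<in> cent 1 (rank1 s 0) \<inter> Dig 1 \<inter> GL. \<exists>c d. X - (sc c + sc d * rank1 s 0) \<in> JJ 1} = q * (q - 1)"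
proof -
  let ?f = "\<lambda>(a, b, c, d, e). Mat3 a b c 0 d e 0 0 a"
  let ?C = "cent 1 (rank1 s 0) \<inter> Dig 1 \<inter> GL"
  have eq: "?C = ?f ` ((S - {0}) \<times> S \<times> S \<times> (S - {0}) \<times> S)"
  proof (intro equalityI subsetI)
    fix X assume X: "X \<in> ?C"
    then have D: "X \<in> Dig 1" and c: "X \<in> cent 1 (rank1 s 0)" and g: "X \<in> GL" by auto
    have 0: "m31 X = 0" "m32 X = 0" "m21 X = 0"
      using c D S_J1 unfolding cent1_rank1 Dig1_iff by auto
    have "m11 X - m33 X \<in> J 1" using c unfolding cent1_rank1 by simp
    then have 1: "m11 X = m33 X" using D transversal_inj[OF S_transversal] unfolding Dig1_iff by blast
    have "m33 X \<noteq> 0" "m11 X * m22 X \<notin> J 1" using g det3_rank1_cent[OF c D] 0 by auto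
    then have "m33 X \<noteq> 0" "m22 X \<noteq> 0" using J_closed(1)[of 1] by auto
    then show "X \<in> ?f ` ((S - {0}) \<times> S \<times> S \<times> (S - {0}) \<times> S)"
      using D 0 1 unfolding Dig1_iff
      by (intro image_eqI[of _ _ "(m11 X, m12 X, m13 X, m22 X, m23 X)"]) (auto simp: mat3_eq_iff)
  next
    fix X assume "X \<in> ?f ` ((S - {0}) \<times> S \<times> S \<times> (S - {0}) \<times> S)"
    then obtain t where t: "X = ?f t" "t \<in> (S - {0}) \<times> S \<times> S \<times> (S - {0}) \<times> S" by blast
    obtain a b c d e where te: "t = (a, b, c, d, e)" by (cases t)
    have X: "X = Mat3 a b c 0 d e 0 0 a" and S: "a \<in> S" "a \<noteq> 0" "b \<in> S" "c \<in> S" "d \<in> S" "d \<noteq> 0" "e \<in> S"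
      using t by (simp_all add: te)
    have D: "X \<in> Dig 1" using S S_0 unfolding Dig1_iff X by simp
    have c: "X \<in> cent 1 (rank1 s 0)" using J_closed(1)[of 1] unfolding cent1_rank1 X by simp
    have "a * d \<notin> J 1" using S S_J1 by (simp only: J1_prime) simp
    then have "X \<in> GL" unfolding det3_rank1_cent[OF c D] using S by (simp add: X)
    then show "X \<in> ?C" using c D by blast
  qed
  show "card ?C = (q - 1) ^ 2 * q ^ 3"
    unfolding eq by (subst card_image) (auto simp: inj_on_def card_cartesian_product card_S' power2_eq_square power3_eq_cube)
  have "{X \<in> ?C. \<exists>c d. X - (sc c + sc d * rank1 s 0) \<in> JJ 1} = (\<lambda>(a, c). ?f (a, 0, c, a, 0)) ` ((S - {0}) \<times> S)"
  proof (intro equalityI subsetI)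
    fix X assume X: "X \<in> {X \<in> ?C. \<exists>c d. X - (sc c + sc d * rank1 s 0) \<in> JJ 1}"
    then have "X \<in> ?f ` ((S - {0}) \<times> S \<times> S \<times> (S - {0}) \<times> S)" using eq by blast
    then obtain t where t: "X = ?f t" "t \<in> (S - {0}) \<times> S \<times> S \<times> (S - {0}) \<times> S" by blast
    obtain a b c d e where te: "t = (a, b, c, d, e)" by (cases t)
    have Xe: "X = Mat3 a b c 0 d e 0 0 a" and S: "a \<in> S" "a \<noteq> 0" "b \<in> S" "c \<in> S" "d \<in> S" "d \<noteq> 0" "e \<in> S"
      using t by (simp_all add: te)
    have "m12 X \<in> J 1 \<and> m21 X \<in> J 1 \<and> m23 X \<in> J 1 \<and> m22 X - m11 X \<in> J 1"
      using X span2_rank1[of X s 0] by blast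
    then have "b \<in> J 1" "e \<in> J 1" "d - a \<in> J 1" by (simp_all add: Xe)
    then have "b = 0" "e = 0" "d = a"
      using S S_J1[of b] S_J1[of e] transversal_inj[OF S_transversal, of d a] by simp_all
    then show "X \<in> (\<lambda>(a, c). ?f (a, 0, c, a, 0)) ` ((S - {0}) \<times> S)" using S Xe by force
  next
    fix X assume "X \<in> (\<lambda>(a, c). ?f (a, 0, c, a, 0)) ` ((S - {0}) \<times> S)"
    then obtain a c where X: "X = ?f (a, 0, c, a, 0)" and S: "a \<in> S - {0}" "c \<in> S" by auto
    have XC: "X \<in> ?C" unfolding eq X using S S_0 by (intro imageI) auto
    moreover have "\<exists>c d. X - (sc c + sc d * rank1 s 0) \<in> JJ 1"
      using XC J_closed(1)[of 1] by (subst span2_rank1) (auto simp: X)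
    ultimately show "X \<in> {X \<in> ?C. \<exists>c d. X - (sc c + sc d * rank1 s 0) \<in> JJ 1}" by blast
  qed
  then show "card {X \<in> ?C. \<exists>c d. X - (sc c + sc d * rank1 s 0) \<in> JJ 1} = q * (q - 1)"
    by (simp only:) (subst card_image, auto simp: inj_on_def card_cartesian_product card_S')
qed

lemma card_kernel2:
  assumes "\<not> (a \<in> J 1 \<and> b \<in> J 1)"
  shows "card {t \<in> S \<times> S. a * snd t - b * fst t \<in> J 1} = q"
proof -
  let ?f = "\<lambda>t. a * snd t - b * fst t"
  have surj: "\<exists>t. ?f t - d \<in> J 1" for d
  proof (cases "a \<in> J 1")
    case False
    then obtain y where y: "a * y - 1 \<in> J 1" using lev1_inverse by blast
    have "?f (0, y * d) - d \<in> J 1" using J_mult[OF y, of d] by (simp add: algebra_simps)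
    then show ?thesis by blast
  next
    case True
    then obtain y where y: "b * y - 1 \<in> J 1" using lev1_inverse assms by blast
    have "?f (- (y * d), 0) - d \<in> J 1" using J_mult[OF y, of d] by (simp add: algebra_simps)
    then show ?thesis by blast
  qed
  have "card {t \<in> UNIV \<inter> S \<times> S. True} = card {d \<in> S. True \<and> (\<exists>t\<in>UNIV. ?f t - d \<in> J 1)} *
      card {t \<in> UNIV \<inter> S \<times> S. ?f t \<in> J 1}"
  proof (rule card_fibres[where ?K1.0 = "J 1 \<times> J 1"])
    show "?f ` (J 1 \<times> J 1) \<subseteq> J 1"
      by (auto simp del: One_nat_def intro!: J_closed(2) J_mult)
  qed (auto simp: transversal_Times S_transversal S_finite add_subgroup_def algebra_simps simp del: One_nat_def)
  then have "q * q = q * card {t \<in> S \<times> S. ?f t \<in> J 1}"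
    using surj by (simp add: card_cartesian_product)
  then show ?thesis using q_gt_1 by simp
qed

text \<open>The order of GL_2 over the residue field: a nonzero first row, and a second row off the
  line that it spans.\<close>

lemma card_GL2: "card {((a, b), (c, d)). (a, b) \<in> S \<times> S \<and> (c, d) \<in> S \<times> S \<and> a * d - b * c \<notin> J 1} = (q ^ 2 - 1) * (q ^ 2 - q)"
proof -
  have eq: "{((a, b), (c, d)). (a, b) \<in> S \<times> S \<and> (c, d) \<in> S \<times> S \<and> a * d - b * c \<notin> J 1}
    = Sigma (S \<times> S - {(0, 0)}) (\<lambda>(a, b). S \<times> S - {t \<in> S \<times> S. a * snd t - b * fst t \<in> J 1})" (is "_ = Sigma ?A ?B")
    using J_closed(1)[of 1] by (auto simp del: One_nat_def)
  have "card (?B s) = q ^ 2 - q" if "s \<in> ?A" for s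
  proof -
    obtain a b where s: "s = (a, b)" by (cases s)
    then have "\<not> (a \<in> J 1 \<and> b \<in> J 1)" using that S_J1 by auto
    then show ?thesis
      using card_kernel2[of a b] S_finite
      by (simp add: s card_Diff_subset card_cartesian_product power2_eq_square)
  qed
  then have "card (Sigma ?A ?B) = (\<Sum>s\<in>?A. q ^ 2 - q)"
    using S_finite by (subst card_SigmaI) auto
  also have "\<dots> = (q ^ 2 - 1) * (q ^ 2 - q)"
    using S_0 S_finite by (simp add: card_Diff_subset card_cartesian_product power2_eq_square)
  finally show ?thesis unfolding eq .
qed

text \<open>As y is a unit, the entries m13 and m23 of a commuting matrix are determined by the
  others. The upper left 2 x 2 block and m33 are free, so the invertible elements number as many as
  GL_2 times GL_1. In the span of 1 and n the block is scalar.\<close>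

lemma counts_semisimple:
  assumes y: "y \<notin> J 1"
  shows "card (cent 1 (rank1 s y) \<inter> Dig 1 \<inter> GL) = (q - 1) * ((q ^ 2 - 1) * (q ^ 2 - q))"
    and "card {X \<in> cent 1 (rank1 s y) \<inter> Dig 1 \<inter> GL. \<exists>c d. X - (sc c + sc d * rank1 s y) \<in> JJ 1} = (q - 1) ^ 2"
proof -
  obtain y' where y': "y * y' - 1 \<in> J 1" using lev1_inverse y by blast
  let ?r = "rep (J 1) S"
  have r: "?r x \<in> S" "x - ?r x \<in> J 1" for x using rep[OF S_transversal] by auto
  let ?f = "\<lambda>(t, ((a, b), (c, d))). Mat3 a b (?r ((t - a) * y')) c d (?r (- (c * y'))) 0 0 t"
  let ?C = "cent 1 (rank1 s y) \<inter> Dig 1 \<inter> GL"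
  let ?M = "{((a, b), (c, d)). (a, b) \<in> S \<times> S \<and> (c, d) \<in> S \<times> S \<and> a * d - b * c \<notin> J 1}"
  have eq: "?C = ?f ` ((S - {0}) \<times> ?M)"
  proof (intro equalityI subsetI)
    fix X assume X: "X \<in> ?C"
    then have D: "X \<in> Dig 1" and c: "X \<in> cent 1 (rank1 s y)" and g: "X \<in> GL" by auto
    have 0: "m31 X = 0" "m32 X = 0"
      using c D S_J1 unfolding cent1_rank1 Dig1_iff by auto
    have "m33 X \<noteq> 0" "m11 X * m22 X - m12 X * m21 X \<notin> J 1" using g det3_rank1_cent[OF c D] by auto
    have c': "m11 X + y * m13 X - m33 X \<in> J 1" "m21 X + y * m23 X \<in> J 1" using c unfolding cent1_rank1 by auto
    have "m13 X * (y * y' - 1) - (m11 X + y * m13 X - m33 X) * y' \<in> J 1"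
      by (rule J_closed(2)[OF J_mult[OF y'] J_mult2[OF c'(1)]])
    also have "m13 X * (y * y' - 1) - (m11 X + y * m13 X - m33 X) * y' = (m33 X - m11 X) * y' - m13 X"
      by (simp add: algebra_simps)
    finally have 1: "?r ((m33 X - m11 X) * y') = m13 X"
      using D unfolding Dig1_iff by (intro rep_eqI[OF S_transversal]) blast+
    have "m23 X * (y * y' - 1) - (m21 X + y * m23 X) * y' \<in> J 1"
      by (rule J_closed(2)[OF J_mult[OF y'] J_mult2[OF c'(2)]])
    also have "m23 X * (y * y' - 1) - (m21 X + y * m23 X) * y' = - (m21 X * y') - m23 X"
      by (simp add: algebra_simps)
    finally have 2: "?r (- (m21 X * y')) = m23 X"
      using D unfolding Dig1_iff by (intro rep_eqI[OF S_transversal]) blast+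
    show "X \<in> ?f ` ((S - {0}) \<times> ?M)"
    proof (rule image_eqI)
      show "X = ?f (m33 X, ((m11 X, m12 X), (m21 X, m22 X)))" using 0 1 2 by (simp add: mat3_eq_iff)
      show "(m33 X, ((m11 X, m12 X), (m21 X, m22 X))) \<in> (S - {0}) \<times> ?M"
        using D \<open>m33 X \<noteq> 0\<close> \<open>m11 X * m22 X - m12 X * m21 X \<notin> J 1\<close> unfolding Dig1_iff by simp
    qed
  next
    fix X assume "X \<in> ?f ` ((S - {0}) \<times> ?M)"
    then obtain u where u: "X = ?f u" "u \<in> (S - {0}) \<times> ?M" by blast
    obtain t a b c d where ue: "u = (t, ((a, b), (c, d)))" by (metis prod.exhaust)
    have X: "X = Mat3 a b (?r ((t - a) * y')) c d (?r (- (c * y'))) 0 0 t"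
      and S: "t \<in> S" "t \<noteq> 0" "a \<in> S" "b \<in> S" "c \<in> S" "d \<in> S" and det: "a * d - b * c \<notin> J 1"
      using u by (simp_all add: ue)
    have D: "X \<in> Dig 1" using S S_0 r unfolding Dig1_iff X by simp
    have "(t - a) * (y * y' - 1) - y * ((t - a) * y' - ?r ((t - a) * y')) \<in> J 1"
      "(- c) * (y * y' - 1) - y * (- (c * y') - ?r (- (c * y'))) \<in> J 1"
      by (rule J_closed(2)[OF J_mult[OF y'] J_mult[OF r(2)]])+
    then have cX: "X \<in> cent 1 (rank1 s y)" using J_closed(1)[of 1] unfolding cent1_rank1 X by (simp add: algebra_simps)
    have "X \<in> GL" unfolding det3_rank1_cent[OF cX D] using S det by (simp add: X)
    then show "X \<in> ?C" using cX D by blast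
  qed
  have inj: "inj_on ?f A" for A by (auto simp: inj_on_def)
  show "card ?C = (q - 1) * ((q ^ 2 - 1) * (q ^ 2 - q))"
    unfolding eq using card_GL2 by (simp only: card_image[OF inj] card_cartesian_product card_S')
  have "{X \<in> ?C. \<exists>c d. X - (sc c + sc d * rank1 s y) \<in> JJ 1} = (\<lambda>(t, a). ?f (t, ((a, 0), (0, a)))) ` ((S - {0}) \<times> (S - {0}))"
  proof (intro equalityI subsetI)
    fix X assume X: "X \<in> {X \<in> ?C. \<exists>c d. X - (sc c + sc d * rank1 s y) \<in> JJ 1}"
    then have "X \<in> ?f ` ((S - {0}) \<times> ?M)" using eq by blast
    then obtain u where u: "X = ?f u" "u \<in> (S - {0}) \<times> ?M" by blast
    obtain t a b c d where ue: "u = (t, ((a, b), (c, d)))" by (metis prod.exhaust)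
    have Xe: "X = ?f (t, ((a, b), (c, d)))"
      and S: "t \<in> S" "t \<noteq> 0" "a \<in> S" "b \<in> S" "c \<in> S" "d \<in> S" and det: "a * d - b * c \<notin> J 1"
      using u by (simp_all add: ue)
    have "m12 X \<in> J 1 \<and> m21 X \<in> J 1 \<and> m23 X \<in> J 1 \<and> m22 X - m11 X \<in> J 1"
      using X span2_rank1[of X s y] by blast
    then have "b \<in> J 1" "c \<in> J 1" "d - a \<in> J 1" by (simp_all add: Xe)
    then have 0: "b = 0" "c = 0" "d = a"
      using S S_J1[of b] S_J1[of c] transversal_inj[OF S_transversal, of d a] by simp_all
    then have "a \<noteq> 0" using det J_closed(1)[of 1] by auto
    then show "X \<in> (\<lambda>(t, a). ?f (t, ((a, 0), (0, a)))) ` ((S - {0}) \<times> (S - {0}))"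
      using S 0 by (intro image_eqI[of _ _ "(t, a)"]) (simp_all add: Xe)
  next
    fix X assume "X \<in> (\<lambda>(t, a). ?f (t, ((a, 0), (0, a)))) ` ((S - {0}) \<times> (S - {0}))"
    then obtain t a where X: "X = ?f (t, ((a, 0), (0, a)))" and S: "t \<in> S - {0}" "a \<in> S - {0}" by auto
    have "a * a \<notin> J 1" using S S_J1 by (simp only: J1_prime) simp
    then have XC: "X \<in> ?C" unfolding eq X using S S_0 by (intro imageI) auto
    have "?r 0 = 0" using S_0 J_closed(1)[of 1] by (intro rep_eqI[OF S_transversal]) auto
    then have "\<exists>c d. X - (sc c + sc d * rank1 s y) \<in> JJ 1"
      using XC J_closed(1)[of 1] by (subst span2_rank1) (auto simp: X)
    with XC show "X \<in> {X \<in> ?C. \<exists>c d. X - (sc c + sc d * rank1 s y) \<in> JJ 1}" by blast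
  qed
  then show "card {X \<in> ?C. \<exists>c d. X - (sc c + sc d * rank1 s y) \<in> JJ 1} = (q - 1) ^ 2"
    by (simp only:) (subst card_image, auto simp: inj_on_def card_cartesian_product card_S' power2_eq_square)
qed


subsection \<open>Sums over the similarity types\<close>

abbreviation gcard :: "'a mat3 set \<Rightarrow> nat" where
  "gcard C \<equiv> card (C \<inter> Dig 1 \<inter> GL)"

definition kcard :: "'a mat3 set \<Rightarrow> 'a mat3 \<Rightarrow> nat" where
  "kcard C n = card {X \<in> C \<inter> Dig 1 \<inter> GL. \<exists>c d. X - (sc c + sc d * n) \<in> JJ 1}"

definition g_split :: nat where "g_split = (q - 1) * ((q ^ 2 - 1) * (q ^ 2 - q))"
definition g_nil :: nat where "g_nil = (q - 1) ^ 2 * q ^ 3"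

text \<open>The types \<open>1, 2, 3, 4\<close> index the rows and columns of the matrix \<open>T\<close> of the theorem.  They are
  the scalar, split and nilpotent types and the type with three-dimensional reduced centralizer.\<close>

definition cls :: "nat \<Rightarrow> 'a mat3 set \<Rightarrow> bool" where
  "cls k C = (if k = 1 then card (C \<inter> Dig 1) = q ^ 9
    else if k = 2 then card (C \<inter> Dig 1) = q ^ 5 \<and> gcard C = g_split
    else if k = 3 then card (C \<inter> Dig 1) = q ^ 5 \<and> gcard C = g_nil
    else card (C \<inter> Dig 1) = q ^ 3)"

text \<open>All families are indexed by triples, padded with 0, so that one statement covers every
  type. Types 2 and 3 share a normal form and are separated in \<open>nf_index\<close> by y \<noteq>
  0 and y = 0.\<close>

definition nf :: "nat \<Rightarrow> 'a \<times> 'a \<times> 'a \<Rightarrow> 'a mat3" where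
  "nf k = (\<lambda>(s, y, z). if k = 1 then sc s else if k = 2 \<or> k = 3 then rank1 s y else companion (s, y, z))"

definition nf_index :: "nat \<Rightarrow> ('a \<times> 'a \<times> 'a) set" where
  "nf_index k = (if k = 1 then S \<times> {0} \<times> {0} else if k = 2 then S \<times> (S - {0}) \<times> {0}
    else if k = 3 then S \<times> {0} \<times> {0} else SSS)"

abbreviation types :: "nat set" where "types \<equiv> {1, 2, 3, 4}"

lemma q_power_inj: "q ^ a = q ^ b \<longleftrightarrow> a = b"
  using q_gt_1 by (simp add: power_inject_exp)

text \<open>\<open>cls\<close> tells the two five-dimensional types apart by these numbers only.
  Divided by (q - 1)^2 q they are q^2 - 1 and q^2.\<close>

lemma g_split_nil: "g_split \<noteq> g_nil"
proof
  assume "g_split = g_nil"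
  moreover have "g_split = (q - 1) ^ 2 * (q * (q ^ 2 - 1))"
  proof -
    have "q ^ 2 - q = q * (q - 1)" by (simp add: power2_eq_square diff_mult_distrib2)
    then show ?thesis by (simp only: g_split_def power2_eq_square[of "q - 1"] mult_ac)
  qed
  ultimately have "q * (q ^ 2 - 1) = q ^ 3" using q_gt_1 by (simp add: g_nil_def)
  then have "q ^ 2 - 1 = q ^ 2" using q_gt_1 by (simp add: power3_eq_cube power2_eq_square)
  moreover have "0 < q ^ 2" using q_gt_1 by simp
  ultimately show False by linarith
qed

lemma cls_disjoint: "k \<in> types \<Longrightarrow> l \<in> types \<Longrightarrow> cls k C \<Longrightarrow> cls l C \<Longrightarrow> k = l"
  using g_split_nil by (auto simp: cls_def q_power_inj split: if_splits)

lemma cls_nf: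
  assumes k: "k \<in> types" and t: "t \<in> nf_index k" and c: "conj1 (nf k t) b"
  shows "cls k (cent 1 b)"
proof -
  obtain s y z where [simp]: "t = (s, y, z)" by (cases t)
  obtain x' y' z' where five: "five (cent 1 (rank1 s y)) (rank1 s y) x' y' z'" using five_rank1 by blast
  have "cls k (cent 1 (nf k t))"
  proof -
    consider "k = 1" | "k = 2" | "k = 3" | "k = 4" using k by blast
    then show ?thesis
    proof cases
      case 1
      then show ?thesis using card_Dig[OF L_pos] by (simp add: cls_def nf_def cent1_sc del: One_nat_def)
    next
      case 2
      then have "y \<notin> J 1" using t S_J1 by (auto simp: nf_index_def)
      then show ?thesis using 2 card_five[OF five] counts_semisimple(1)[of y s]
        by (simp add: cls_def nf_def g_split_def del: One_nat_def)
    next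
      case 3
      then have "y = 0" using t by (auto simp: nf_index_def)
      then show ?thesis using 3 card_five[OF five] counts_nilpotent(1)[of s]
        by (simp add: cls_def nf_def g_nil_def del: One_nat_def)
    next
      case 4
      then show ?thesis using card_cent1_companion by (simp add: cls_def nf_def del: One_nat_def)
    qed
  qed
  then show ?thesis unfolding cls_def conj1_card_cent(1,2)[OF c] .
qed

lemma nf_exists: "\<exists>k\<in>types. \<exists>t\<in>nf_index k. conj1 (nf k t) b"
proof (cases "nonscalar b")
  case True
  then consider c where "c \<in> SSS" "conj1 (companion c) b" | s y where "s \<in> S" "y \<in> S" "conj1 (rank1 s y) b"
    using classification by blast
  then show ?thesis
  proof cases
    case 1
    then have "c \<in> nf_index 4" "conj1 (nf 4 c) b" by (cases c; simp add: nf_index_def nf_def)+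
    then show ?thesis by blast
  next
    case 2
    then have "(s, y, 0) \<in> nf_index (if y = 0 then 3 else 2)" "conj1 (nf (if y = 0 then 3 else 2) (s, y, 0)) b"
      using S_0 by (auto simp: nf_index_def nf_def)
    then show ?thesis by (cases "y = 0") (auto simp del: One_nat_def)
  qed
next
  case False
  then obtain c where c: "b - sc c \<in> JJ 1" by (auto simp: nonscalar_def)
  let ?s = "rep (J 1) S c"
  have s: "?s \<in> S" "c - ?s \<in> J 1" using rep[OF S_transversal] by auto
  have "b - sc ?s \<in> JJ 1" using JJ_closed(4)[OF c sc_JJ[OF s(2)]] by (simp add: sc_diff)
  then have "conj1 (sc ?s) b" by (intro conj1_sym[OF conj1_cong])
  then have "(?s, 0, 0) \<in> nf_index 1" "conj1 (nf 1 (?s, 0, 0)) b" using s by (simp_all add: nf_index_def nf_def)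
  then show ?thesis by blast
qed

text \<open>Every b is similar to some normal form and the types exclude each other, so the counts
  in \<open>cls\<close> identify the family.\<close>

lemma cls_cent1: "k \<in> types \<Longrightarrow> cls k (cent 1 b) \<longleftrightarrow> (\<exists>t\<in>nf_index k. conj1 (nf k t) b)"
  using nf_exists[of b] cls_nf cls_disjoint by metis

lemma conj1_sc: "conj1 (sc s) (sc t) \<Longrightarrow> s - t \<in> J 1"
proof -
  assume "conj1 (sc s) (sc t)"
  then obtain g where g: "g \<in> GL" "g * sc s - sc t * g \<in> JJ 1" by (auto simp: conj1_def)
  then have "sc (s - t) * g \<in> JJ 1" by (simp add: sc_diff sc_commute left_diff_distrib)
  then show ?thesis using GL_cancel_right[OF g(1)] sc_JJ_iff by blast
qed

lemma nf_inj:
  assumes k: "k \<in> types" and t: "t \<in> nf_index k" "u \<in> nf_index k" and c: "conj1 (nf k t) (nf k u)"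
  shows "t = u"
proof -
  obtain s y z s' y' z' where [simp]: "t = (s, y, z)" "u = (s', y', z')" by (metis prod.exhaust)
  consider "k = 1" | "k = 2 \<or> k = 3" | "k = 4" using k by blast
  then show ?thesis
  proof cases
    case 1
    then show ?thesis using t c conj1_sc transversal_inj[OF S_transversal, of s s'] by (simp add: nf_index_def nf_def)
  next
    case 2
    then have "s \<in> S" "y \<in> S" "s' \<in> S" "y' \<in> S" "z = z'" "conj1 (rank1 s y) (rank1 s' y')"
      using t c S_0 by (auto simp: nf_index_def nf_def)
    then show ?thesis using rank1_inj[of s y s' y'] by simp
  next
    case 3
    then show ?thesis using t c companion_inj[of t u] by (simp add: nf_index_def nf_def)
  qed
qed

lemma finite_nf_index: "finite (nf_index k)"
  using S_finite by (simp add: nf_index_def)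

text \<open>The matrices of one type are the union of the orbits of its normal forms, and each orbit
  contributes the order of the group.\<close>

lemma sum_type:
  assumes k: "k \<in> types"
  shows "(\<Sum>b\<in>{b \<in> Dig 1. cls k (cent 1 b)}. gcard (cent 1 b)) = card (nf_index k) * card (Dig 1 \<inter> GL)"
    and "(\<Sum>b\<in>{b \<in> Dig 1 \<inter> GL. cls k (cent 1 b)}. gcard (cent 1 b)) = card {t \<in> nf_index k. nf k t \<in> GL} * card (Dig 1 \<inter> GL)"
proof -
  have "{b \<in> Dig 1. cls k (cent 1 b)} = {b \<in> Dig 1. \<exists>t\<in>nf_index k. conj1 (nf k t) b}"
    using cls_cent1[OF k] by blast
  then show "(\<Sum>b\<in>{b \<in> Dig 1. cls k (cent 1 b)}. gcard (cent 1 b)) = card (nf_index k) * card (Dig 1 \<inter> GL)"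
    using sum_centralizers[OF finite_nf_index nf_inj[OF k]] by simp
  have "{b \<in> Dig 1 \<inter> GL. cls k (cent 1 b)} = {b \<in> Dig 1. \<exists>t\<in>{t \<in> nf_index k. nf k t \<in> GL}. conj1 (nf k t) b}"
    using cls_cent1[OF k] conj1_GL by blast
  then show "(\<Sum>b\<in>{b \<in> Dig 1 \<inter> GL. cls k (cent 1 b)}. gcard (cent 1 b)) = card {t \<in> nf_index k. nf k t \<in> GL} * card (Dig 1 \<inter> GL)"
    using sum_centralizers[of "{t \<in> nf_index k. nf k t \<in> GL}" "nf k"] finite_nf_index[of k] nf_inj[OF k] by simp
qed

text \<open>These are the entries of \<open>v_M3\<close> and also the first column of T, because a
  lift of a scalar matrix amounts to an arbitrary matrix over the residue field.\<close>

lemma card_nf_index: "card (nf_index 1) = q" "card (nf_index 2) = q ^ 2 - q" "card (nf_index 3) = q" "card (nf_index 4) = q ^ 3"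
  by (simp_all add: nf_index_def card_cartesian_product card_S' power2_eq_square power3_eq_cube diff_mult_distrib2)

text \<open>The entries of \<open>v_GL3\<close>. The normal forms of rank-one type have the
  eigenvalues s and s + y; in the split type these are distinct and must both be nonzero, whence (q
  - 1)(q - 2). A companion matrix is invertible iff its entry c1 is nonzero modulo p.\<close>

lemma card_nf_index_GL:
  "card {t \<in> nf_index 1. nf 1 t \<in> GL} = q - 1"
  "card {t \<in> nf_index 2. nf 2 t \<in> GL} = (q - 1) * (q - 2)"
  "card {t \<in> nf_index 3. nf 3 t \<in> GL} = q - 1"
  "card {t \<in> nf_index 4. nf 4 t \<in> GL} = q ^ 3 - q ^ 2"
proof -
  have sc: "sc s \<in> GL \<longleftrightarrow> s \<notin> J 1" for s by (simp add: GL_def det3_def J1_prime del: One_nat_def)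
  have z: "0 \<notin> GL" using sc[of 0] J_closed(1)[of 1] by simp
  have r1: "rank1 s y \<in> GL \<longleftrightarrow> s \<notin> J 1 \<and> s + y \<notin> J 1" for s y
    by (simp add: GL_def det3_def rank1_def J1_prime del: One_nat_def)
  have co: "companion (c1, c2, c3) \<in> GL \<longleftrightarrow> c1 \<notin> J 1" for c1 c2 c3
    by (simp add: GL_def det3_def companion_def)
  have "{t \<in> nf_index 1. nf 1 t \<in> GL} = (S - {0}) \<times> {0} \<times> {0}"
    using S_J1 z by (auto simp: nf_index_def nf_def sc simp del: One_nat_def)
  then show "card {t \<in> nf_index 1. nf 1 t \<in> GL} = q - 1" by (simp add: card_cartesian_product card_S')
  have "{t \<in> nf_index 3. nf 3 t \<in> GL} = (S - {0}) \<times> {0} \<times> {0}"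
    using S_J1 by (auto simp: nf_index_def nf_def r1 simp del: One_nat_def)
  then show "card {t \<in> nf_index 3. nf 3 t \<in> GL} = q - 1" by (simp add: card_cartesian_product card_S')
  have "{t \<in> nf_index 4. nf 4 t \<in> GL} = (S - {0}) \<times> S \<times> S"
    using S_J1 by (auto simp: nf_index_def nf_def co simp del: One_nat_def)
  then show "card {t \<in> nf_index 4. nf 4 t \<in> GL} = q ^ 3 - q ^ 2"
    by (simp add: card_cartesian_product card_S' power2_eq_square power3_eq_cube diff_mult_distrib)
  let ?r = "\<lambda>s. rep (J 1) S (- s)"
  have r: "?r s \<in> S" "- s - ?r s \<in> J 1" for s using rep[OF S_transversal] by auto
  have iff: "s + y \<in> J 1 \<longleftrightarrow> y = ?r s" if "y \<in> S" for s y
  proof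
    assume "s + y \<in> J 1"
    then have "- (s + y) \<in> J 1" by (rule J_closed(3))
    then show "y = ?r s" using that by (intro rep_eqI[OF S_transversal, symmetric]) (simp_all add: algebra_simps)
  next
    assume "y = ?r s"
    then have "- (- s - y) \<in> J 1" using r(2)[of s] J_closed(3) by blast
    then show "s + y \<in> J 1" by (simp add: algebra_simps)
  qed
  have r0: "?r s \<noteq> 0" if "s \<in> S - {0}" for s
  proof
    assume "?r s = 0"
    then have "s + 0 \<in> J 1" using iff[OF S_0] by simp
    then show False using that S_J1 by simp
  qed
  have "{t \<in> nf_index 2. nf 2 t \<in> GL} = Sigma (S - {0}) (\<lambda>s. (S - {0, ?r s}) \<times> {0})"
    using S_J1 iff by (auto simp: nf_index_def nf_def r1 simp del: One_nat_def)
  moreover have "card ((S - {0, ?r s}) \<times> {0::'a}) = q - 2" if "s \<in> S - {0}" for s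
    using r0[OF that] r(1)[of s] S_0 S_finite by (simp add: card_cartesian_product card_Diff_subset)
  ultimately show "card {t \<in> nf_index 2. nf 2 t \<in> GL} = (q - 1) * (q - 2)"
    using S_finite by (simp add: card_SigmaI card_S')
qed

section \<open>Transition counts between the four centralizer types\<close>

section \<open>The branching rules\<close>

text \<open>The condition j < i makes n liftable by \<open>decompose_lift\<close>. The numbers
  \<gamma> of invertible elements of C and \<kappa> of those in the span of 1 and n are carried
  along, as they do not change while C persists.\<close>

definition five_type :: "nat \<Rightarrow> 'a mat3 \<Rightarrow> nat \<Rightarrow> nat \<Rightarrow> bool" where
  "five_type i a \<gamma> \<kappa> \<longleftrightarrow> (\<exists>s j n x y z. j < i \<and> a - (sc s + sc (p ^ j) * n) \<in> JJ i \<and> five (rcent i a) n x y z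
    \<and> gcard (rcent i a) = \<gamma> \<and> kcard (rcent i a) n = \<kappa>)"

definition typed :: "nat \<Rightarrow> 'a mat3 \<Rightarrow> bool" where
  "typed i a \<longleftrightarrow> (\<exists>c. a - sc c \<in> JJ i) \<or> card (rcent i a \<inter> Dig 1) = q ^ 3
    \<or> five_type i a g_split ((q - 1) ^ 2) \<or> five_type i a g_nil (q * (q - 1))"

lemma rcent_scalar: "a - sc c \<in> JJ i \<Longrightarrow> rcent i a = UNIV"
proof -
  assume "a - sc c \<in> JJ i"
  then have "rcent i a = rcent i (sc c)" by (rule rcent_cong)
  moreover have "cent i (sc c) = UNIV" using JJ_closed(1) by (simp add: cent_def)
  ultimately show ?thesis using cent_rcent by blast
qed

lemma card_UNIV_Dig1: "card (UNIV \<inter> Dig 1) = q ^ 9"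
  using card_Dig[OF L_pos] by simp

text \<open>The scalar part commutes with everything and p^i can be cancelled, so a lift of a scalar
  matrix has the centralizer of a residue matrix e + b, where b is the coefficient that was
  chosen.\<close>

lemma scalar_lift:
  assumes i: "i < L" and a: "a - sc s \<in> JJ i"
  obtains e where "\<And>b. a + sc (p ^ i) * b - (sc s + sc (p ^ i) * (e + b)) \<in> JJ (Suc i)"
    "\<And>b. rcent (Suc i) (a + sc (p ^ i) * b) = cent 1 (e + b)"
proof -
  obtain e where e: "a - sc s - sc (p ^ i) * e \<in> JJ L" using JJ_decompose[OF a] .
  have 1: "a + sc (p ^ i) * b - (sc s + sc (p ^ i) * (e + b)) \<in> JJ (Suc i)" for b
    using JJ_anti[OF _ e, of "Suc i"] i by (simp add: algebra_simps)
  have "X \<in> cent (Suc i) (a + sc (p ^ i) * b) \<longleftrightarrow> X \<in> cent 1 (e + b)" for X b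
  proof -
    have "X \<in> cent (Suc i) (a + sc (p ^ i) * b) \<longleftrightarrow> X \<in> cent (Suc i) (sc s + sc (p ^ i) * (e + b))"
      using cent_cong[OF 1] by simp
    also have "\<dots> \<longleftrightarrow> sc (p ^ i) * comm X (e + b) \<in> JJ (Suc i)"
      unfolding cent_def mem_Collect_eq comm_add_right[of X "sc s"] comm_sc_mult_right comm_sc by simp
    also have "\<dots> \<longleftrightarrow> X \<in> cent 1 (e + b)" using JJ_scale_iff[of i 1] i by (simp add: cent_def)
    finally show ?thesis .
  qed
  then have 2: "cent (Suc i) (a + sc (p ^ i) * b) = cent 1 (e + b)" for b by blast
  have 3: "rcent (Suc i) (a + sc (p ^ i) * b) = cent 1 (e + b)" for b
  proof
    show "rcent (Suc i) (a + sc (p ^ i) * b) \<subseteq> cent 1 (e + b)"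
      unfolding rcent_def 2 using cent1_cong by blast
    show "cent 1 (e + b) \<subseteq> rcent (Suc i) (a + sc (p ^ i) * b)" using cent_rcent 2 by blast
  qed
  show ?thesis by (rule that[OF 1 3])
qed

lemma kcard_cong:
  assumes "n - n' \<in> JJ 1"
  shows "kcard C n = kcard C n'"
proof -
  have "X - (sc c + sc d * n) \<in> JJ 1 \<longleftrightarrow> X - (sc c + sc d * n') \<in> JJ 1" for X c d
    using JJ_cong[of "X - (sc c + sc d * n')" "X - (sc c + sc d * n)" 1] JJ_mult[OF assms, of "sc d"] by (simp add: algebra_simps)
  then show ?thesis by (simp add: kcard_def)
qed

text \<open>The similarity class of the coefficient e modulo p decides: a scalar e leaves a scalar,
  and the other normal forms produce the remaining types, the five-dimensional ones with j = i and n
  = e.\<close>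

lemma typed_scalar_lift:
  assumes i: "i < L" and a: "a - sc s \<in> JJ i"
  shows "typed (Suc i) a"
proof -
  obtain e where e: "\<And>b. a + sc (p ^ i) * b - (sc s + sc (p ^ i) * (e + b)) \<in> JJ (Suc i)"
    "\<And>b. rcent (Suc i) (a + sc (p ^ i) * b) = cent 1 (e + b)" using scalar_lift[OF i a] by blast
  have e0: "a - (sc s + sc (p ^ i) * e) \<in> JJ (Suc i)" "rcent (Suc i) a = cent 1 e" using e[of 0] by simp_all
  obtain k t where k: "k \<in> types" and t: "t \<in> nf_index k" "conj1 (nf k t) e" using nf_exists by blast
  have cls: "cls k (cent 1 e)" by (rule cls_nf[OF k t])
  obtain s' y z where te: "t = (s', y, z)" by (cases t)
  have five: "five_type (Suc i) a \<gamma> \<kappa>" if "conj1 (rank1 s' y) e" "gcard (cent 1 (rank1 s' y)) = \<gamma>" "kcard (cent 1 (rank1 s' y)) (rank1 s' y) = \<kappa>" for \<gamma> \<kappa>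
  proof -
    obtain x1 y1 z1 where "five (cent 1 (rank1 s' y)) (rank1 s' y) x1 y1 z1" using five_rank1 by blast
    from conj1_five[OF that(1) this] obtain x'' y'' z'' where "five (cent 1 e) e x'' y'' z''" by blast
    moreover have "gcard (cent 1 e) = \<gamma>" using that(2) conj1_card_cent(2)[OF that(1)] by simp
    moreover have "kcard (cent 1 e) e = \<kappa>" using that(3) conj1_card_cent(3)[OF that(1)] by (simp add: kcard_def)
    ultimately show ?thesis unfolding five_type_def e0(2) using e0(1) lessI[of i] by blast
  qed
  consider "k = 1" | "k = 2" | "k = 3" | "k = 4" using k by blast
  then show ?thesis
  proof cases
    case 1
    then have "conj1 (sc s') e" using t by (simp add: te nf_def)
    then obtain g where g: "g \<in> GL" "g * sc s' - e * g \<in> JJ 1" by (auto simp: conj1_def)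
    then have "(sc s' - e) * g \<in> JJ 1" by (simp add: sc_commute left_diff_distrib)
    then have "sc s' - e \<in> JJ 1" using GL_cancel_right[OF g(1)] by blast
    then have "sc (p ^ i) * (sc s' - e) \<in> JJ (i + 1)" by (rule JJ_scale)
    then have "a - (sc s + sc (p ^ i) * e) - sc (p ^ i) * (sc s' - e) \<in> JJ (Suc i)"
      using JJ_closed(2)[OF e0(1)] by simp
    then have "a - sc (s + p ^ i * s') \<in> JJ (Suc i)" by (simp add: sc_add sc_mult right_diff_distrib diff_diff_eq)
    then show ?thesis unfolding typed_def by blast
  next
    case 2
    then have "y \<notin> J 1" "conj1 (rank1 s' y) e" using t S_J1 by (auto simp: te nf_index_def nf_def)
    then have "five_type (Suc i) a g_split ((q - 1) ^ 2)"
      using counts_semisimple[of y s'] by (intro five) (simp_all add: kcard_def g_split_def)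
    then show ?thesis by (simp add: typed_def)
  next
    case 3
    then have "y = 0" "conj1 (rank1 s' y) e" using t by (auto simp: te nf_index_def nf_def)
    then have "five_type (Suc i) a g_nil (q * (q - 1))"
      using counts_nilpotent[of s'] by (intro five) (simp_all add: kcard_def g_nil_def)
    then show ?thesis by (simp add: typed_def)
  next
    case 4
    then show ?thesis using cls e0(2) by (simp add: typed_def cls_def)
  qed
qed

text \<open>A matrix that is scalar modulo p^i has all q^9 residues in its reduced centralizer, so
  q^3 excludes this case and \<open>nonscalar_decompose\<close> supplies the n for
  \<open>rcent_Suc_card3\<close>.\<close>

lemma card3_lift:
  assumes i: "i < L" "i = Suc m" and c: "card (rcent i a \<inter> Dig 1) = q ^ 3"
  shows "rcent (Suc i) (a + sc (p ^ i) * b) = rcent i a"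
proof -
  let ?a = "a + sc (p ^ i) * b"
  have r: "rcent i ?a = rcent i a" by (rule rcent_cong) (simp add: pJJ)
  have ns: "?a - sc s \<notin> JJ i" for s
  proof
    assume "?a - sc s \<in> JJ i"
    then have "rcent i a = UNIV" using rcent_scalar r by simp
    then have "q ^ 9 = q ^ 3" using c card_UNIV_Dig1 by simp
    then show False by (simp add: q_power_inj)
  qed
  obtain j s n where n: "j < i" "?a - (sc s + sc (p ^ j) * n) \<in> JJ L" "nonscalar n"
    by (rule nonscalar_decompose[of i ?a]) (use i ns in auto)
  have "n \<in> cent (Suc i) (sc s + sc (p ^ j) * n)"
    using JJ_closed(1) by (simp add: cent_def comm_add_right comm_sc_mult_right)
  then have "n \<in> cent (Suc i) ?a" using cent_cong[OF JJ_anti[OF _ n(2), of "Suc i"]] i by simp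
  from rcent_Suc_card3[OF i n(3) this] show ?thesis using r c by simp
qed

text \<open>There are \<gamma> - \<kappa> invertible elements of C outside the span of 1 and n. In
  the last equation the term with q^7 stands on the left to avoid a truncated subtraction.\<close>

lemma five_type_lift:
  assumes i: "i < L" "i = Suc m" and f: "five_type i a \<gamma> \<kappa>"
  shows "card {b \<in> Dig 1. rcent (Suc i) (a + sc (p ^ i) * b) = rcent i a} = q ^ 6"
    and "rcent (Suc i) (a + sc (p ^ i) * b) = rcent i a \<Longrightarrow> five_type (Suc i) (a + sc (p ^ i) * b) \<gamma> \<kappa>"
    and "rcent (Suc i) (a + sc (p ^ i) * b) \<noteq> rcent i a \<Longrightarrow> card (rcent (Suc i) (a + sc (p ^ i) * b) \<inter> Dig 1) = q ^ 3"
    and "(\<Sum>b\<in>Dig 1. gcard (rcent (Suc i) (a + sc (p ^ i) * b))) + \<kappa> * q ^ 7 = \<kappa> * q ^ 9 + \<gamma> * q ^ 7"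
proof -
  obtain s j n x y z where j: "j < i" and a: "a - (sc s + sc (p ^ j) * n) \<in> JJ i" and five: "five (rcent i a) n x y z"
    and g: "gcard (rcent i a) = \<gamma>" "kcard (rcent i a) n = \<kappa>" using f unfolding five_type_def by blast
  have n: "\<exists>n'. n' - n \<in> JJ 1 \<and> a + sc (p ^ i) * b - (sc s + sc (p ^ j) * n') \<in> JJ (Suc i)
      \<and> n' \<in> cent (Suc i) (a + sc (p ^ i) * b)" for b
  proof -
    have "a + sc (p ^ i) * b - (sc s + sc (p ^ j) * n) \<in> JJ i"
      using JJ_closed(4)[OF a pJJ[of i b]] by (simp add: algebra_simps)
    from decompose_lift[OF _ j this] i JJ_anti[of "Suc i" L] show ?thesis by (metis Suc_leI less_imp_le)
  qed
  then have n': "\<exists>n'. n' - n \<in> JJ 1 \<and> n' \<in> cent (Suc i) (a + sc (p ^ i) * b)" for b by blast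
  note step = five_step[OF i five n']
  show "card {b \<in> Dig 1. rcent (Suc i) (a + sc (p ^ i) * b) = rcent i a} = q ^ 6" by (rule step(1))
  show "rcent (Suc i) (a + sc (p ^ i) * b) \<noteq> rcent i a \<Longrightarrow> card (rcent (Suc i) (a + sc (p ^ i) * b) \<inter> Dig 1) = q ^ 3"
    by (rule step(2))
  show "five_type (Suc i) (a + sc (p ^ i) * b) \<gamma> \<kappa>" if r: "rcent (Suc i) (a + sc (p ^ i) * b) = rcent i a"
  proof -
    obtain n1 where n1: "n1 - n \<in> JJ 1" "a + sc (p ^ i) * b - (sc s + sc (p ^ j) * n1) \<in> JJ (Suc i)" using n by blast
    have "five (rcent i a) n1 x y z" using five_cong[OF five JJ_sym[OF n1(1)]] JJ_closed(1) by simp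
    moreover have "kcard (rcent i a) n1 = \<kappa>" using kcard_cong[OF n1(1)] g by simp
    moreover have "j < Suc i" using j by simp
    ultimately show ?thesis unfolding five_type_def r using g(1) n1(2) by blast
  qed
  let ?X = "rcent i a \<inter> Dig 1 \<inter> GL" and ?P = "\<lambda>X. \<exists>c d. X - (sc c + sc d * n) \<in> JJ 1"
  have "card ?X = card ({X \<in> ?X. ?P X} \<union> {X \<in> ?X. \<not> ?P X})" by (rule arg_cong[of _ _ card]) blast
  also have "\<dots> = card {X \<in> ?X. ?P X} + card {X \<in> ?X. \<not> ?P X}"
    using finite_Dig[of 1] by (intro card_Un_disjoint) auto
  finally have "card ?X = card {X \<in> ?X. ?P X} + card {X \<in> ?X. \<not> ?P X}" .
  then have "\<gamma> = \<kappa> + card {X \<in> ?X. \<not> ?P X}" using g by (simp add: kcard_def)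
  then show "(\<Sum>b\<in>Dig 1. gcard (rcent (Suc i) (a + sc (p ^ i) * b))) + \<kappa> * q ^ 7 = \<kappa> * q ^ 9 + \<gamma> * q ^ 7"
    using step(3) g(2) unfolding kcard_def by (simp add: algebra_simps)
qed

lemma all_typed:
  assumes "1 \<le> i" "i \<le> L"
  shows "typed i a"
  using assms
proof (induction i rule: dec_induct)
  case base
  \<comment> \<open>Modulo p^0 every matrix is scalar, so level 1 is an instance of lifting a scalar
    matrix.\<close>
  have "a - sc 0 \<in> JJ 0" by simp
  then show ?case using typed_scalar_lift[of 0 a 0] L_pos by simp
next
  case (step i)
  then have i: "i < L" "typed i a" and m: "\<exists>m. i = Suc m" by (auto intro: Suc_le_D)
  then obtain m where m: "i = Suc m" by blast
  from i(2) consider c where "a - sc c \<in> JJ i" | "card (rcent i a \<inter> Dig 1) = q ^ 3"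
    | "five_type i a g_split ((q - 1) ^ 2)" | "five_type i a g_nil (q * (q - 1))" unfolding typed_def by blast
  then show ?case
  proof cases
    case 1
    then show ?thesis by (rule typed_scalar_lift[OF i(1)])
  next
    case 2
    then have "card (rcent (Suc i) a \<inter> Dig 1) = q ^ 3" using card3_lift[OF i(1) m 2, of 0] by simp
    then show ?thesis by (simp add: typed_def)
  next
    case 3
    from five_type_lift(2,3)[OF i(1) m 3, of 0] show ?thesis unfolding typed_def by auto
  next
    case 4
    from five_type_lift(2,3)[OF i(1) m 4, of 0] show ?thesis unfolding typed_def by auto
  qed
qed


text \<open>The matrix T over the natural numbers, with row k and column l.\<close>

definition branching :: "nat \<Rightarrow> nat \<Rightarrow> nat" where
  "branching k l =
    (if l = 1 then (if k = 1 then q else if k = 2 then q ^ 2 - q else if k = 3 then q else q ^ 3)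
     else if l = 2 then (if k = 2 then q ^ 2 else if k = 4 then q ^ 3 else 0)
     else if l = 3 then (if k = 3 then q ^ 2 else if k = 4 then q ^ 3 + q else 0)
     else (if k = 4 then q ^ 3 else 0))"

lemma sum_shift:
  assumes F: "\<And>b c. b - c \<in> JJ 1 \<Longrightarrow> F b = F c"
  shows "(\<Sum>b\<in>Dig 1. F (e + b)) = (\<Sum>b\<in>Dig 1. F b :: nat)"
proof -
  let ?r = "rep (JJ 1) (Dig 1)"
  have r: "?r x \<in> Dig 1" "x - ?r x \<in> JJ 1" for x by (rule rep[OF Dig1_transversal])+
  have "bij_betw (\<lambda>b. ?r (e + b)) (Dig 1) (Dig 1)"
  proof (rule bij_betwI[where g = "\<lambda>b. ?r (b - e)"])
    fix b assume b: "b \<in> Dig 1"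
    show "?r (?r (e + b) - e) = b"
      using JJ_closed(3)[OF r(2)[of "e + b"]] by (intro rep_eqI[OF Dig1_transversal b]) (simp add: algebra_simps)
    show "?r (e + ?r (b - e)) = b"
      using JJ_closed(3)[OF r(2)[of "b - e"]] by (intro rep_eqI[OF Dig1_transversal b]) (simp add: algebra_simps)
  qed (use r in auto)
  then have "(\<Sum>b\<in>Dig 1. F b) = (\<Sum>b\<in>Dig 1. F (?r (e + b)))" by (rule sum.reindex_bij_betw[symmetric])
  also have "\<dots> = (\<Sum>b\<in>Dig 1. F (e + b))" by (intro sum.cong refl F[symmetric] r)
  finally show ?thesis ..
qed

lemma five_type_card: "five_type i a \<gamma> \<kappa> \<Longrightarrow> card (rcent i a \<inter> Dig 1) = q ^ 5 \<and> gcard (rcent i a) = \<gamma>"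
  unfolding five_type_def using card_five by blast

text \<open>The lifts that keep C contribute q^6 \<gamma> to a total of \<gamma> q^7 + \<kappa> (q^9
  - q^7). For the split type the second term is exactly q^6 \<gamma>, which leaves \<gamma> q^7 for
  the lifts of type 4. For the nilpotent type it is (q^6 + q^5) \<gamma>, and the surplus q^5
  \<gamma> is the origin of the summand q in the entry q^3 + q of T.\<close>

lemma five_arith:
  "(q - 1) ^ 2 * q ^ 9 = (q - 1) ^ 2 * q ^ 7 + q ^ 6 * g_split"
  "q * (q - 1) * q ^ 9 = q * (q - 1) * q ^ 7 + (q ^ 6 + q ^ 5) * g_nil"
proof -
  obtain d where d: "q = d + 1" using q_gt_1 by (metis Suc_eq_plus1 less_imp_Suc_add)
  have e: "q - 1 = d" "q ^ 2 - 1 = d * (d + 2)" "q ^ 2 - q = q * d" "q ^ 2 = d * (d + 2) + 1"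
    using d by (simp_all add: power2_eq_square algebra_simps)
  have p: "q ^ 9 = q ^ 6 * q * q ^ 2" "q ^ 7 = q ^ 6 * q" "q ^ 6 = q ^ 5 * q" "q ^ 3 = q * q ^ 2"
    by (simp_all add: eval_nat_numeral)
  show "(q - 1) ^ 2 * q ^ 9 = (q - 1) ^ 2 * q ^ 7 + q ^ 6 * g_split"
  proof -
    have g: "g_split = d * ((d * (d + 2)) * (q * d))" by (simp only: g_split_def e(1-3))
    show ?thesis unfolding g p(1,2) e(1) e(4) by (simp add: power2_eq_square algebra_simps)
  qed
  have "q * d * (q ^ 5 * q * q * (d * (d + 2) + 1)) = q * d * (q ^ 5 * q * q) + (q ^ 5 * q + q ^ 5) * (d ^ 2 * (q * (q * q)))"
  proof -
    have "q * d * (q ^ 5 * q * q * (d * (d + 2) + 1)) = q * d * (q ^ 5 * q * q) + q ^ 5 * (q * q * q * d) * (d * (d + 2))"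
      by (simp add: algebra_simps)
    also have "q * d * (q ^ 5 * q * q) + q ^ 5 * (q * q * q * d) * (d * (d + 2))
        = q * d * (q ^ 5 * q * q) + (q ^ 5 * q + q ^ 5) * (d ^ 2 * (q * (q * q)))"
    proof -
      have "d + 2 = q + 1" using d by simp
      then show ?thesis by (simp only:) (simp add: power2_eq_square algebra_simps)
    qed
    finally show ?thesis .
  qed
  then show "q * (q - 1) * q ^ 9 = q * (q - 1) * q ^ 7 + (q ^ 6 + q ^ 5) * g_nil"
    by (simp only: g_nil_def p e(1) e(4)[symmetric] power2_eq_square[of q])
qed

text \<open>Here q^9 is the growth of the group order from one level to the next and q^5 is the
  order of C. The q^6 lifts that keep C give the entry q^2, since q^5 q^6 = q^9 q^2; all other lifts
  are of type 4.\<close>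

lemma branching_five:
  assumes i: "i < L" "i = Suc m" and f: "five_type i a \<gamma> \<kappa>"
    and l: "l = 2 \<and> \<gamma> = g_split \<and> \<kappa> = (q - 1) ^ 2 \<or> l = 3 \<and> \<gamma> = g_nil \<and> \<kappa> = q * (q - 1)" and k: "k \<in> types"
  shows "q ^ 5 * (\<Sum>b\<in>{b \<in> Dig 1. cls k (rcent (Suc i) (a + sc (p ^ i) * b))}. gcard (rcent (Suc i) (a + sc (p ^ i) * b)))
    = q ^ 9 * branching k l * \<gamma>" (is "q ^ 5 * ?s = _")
proof -
  let ?R = "\<lambda>b. rcent (Suc i) (a + sc (p ^ i) * b)" and ?C = "rcent i a"
  note lift = five_type_lift[OF i f]
  have l23: "l = 2 \<or> l = 3" using l by blast
  have C: "card (?C \<inter> Dig 1) = q ^ 5" "gcard ?C = \<gamma>" using five_type_card[OF f] by auto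
  have pw: "q ^ 5 \<noteq> q ^ 9" "q ^ 5 \<noteq> q ^ 3" by (simp_all add: q_power_inj)
  have "k = 1 \<or> k = 2 \<or> k = 3 \<or> k = 4" using k by simp
  then have cC: "cls k ?C \<longleftrightarrow> k = l"
    using l unfolding cls_def C
    by (elim disjE conjE) (simp_all add: pw g_split_nil g_split_nil[symmetric])
  have cR: "cls k (?R b) \<longleftrightarrow> k = 4" if "?R b \<noteq> ?C" for b
    using k lift(3)[OF that] by (auto simp: cls_def q_power_inj)
  have same: "(\<Sum>b\<in>{b \<in> Dig 1. ?R b = ?C}. gcard (?R b)) = q ^ 6 * \<gamma>"
  proof -
    have "(\<Sum>b\<in>{b \<in> Dig 1. ?R b = ?C}. gcard (?R b)) = (\<Sum>b\<in>{b \<in> Dig 1. ?R b = ?C}. \<gamma>)"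
      using C by (intro sum.cong refl) simp
    then show ?thesis using lift(1) by simp
  qed
  have tot: "(\<Sum>b\<in>Dig 1. gcard (?R b)) = q ^ 6 * \<gamma> + (\<Sum>b\<in>{b \<in> Dig 1. ?R b \<noteq> ?C}. gcard (?R b))"
  proof -
    have "Dig 1 = {b \<in> Dig 1. ?R b = ?C} \<union> {b \<in> Dig 1. ?R b \<noteq> ?C}" by blast
    then have "(\<Sum>b\<in>Dig 1. gcard (?R b)) = (\<Sum>b\<in>{b \<in> Dig 1. ?R b = ?C} \<union> {b \<in> Dig 1. ?R b \<noteq> ?C}. gcard (?R b))"
      by (rule sum.cong) simp
    also have "\<dots> = (\<Sum>b\<in>{b \<in> Dig 1. ?R b = ?C}. gcard (?R b)) + (\<Sum>b\<in>{b \<in> Dig 1. ?R b \<noteq> ?C}. gcard (?R b))"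
      using finite_Dig[of 1] by (intro sum.union_disjoint) auto
    finally show ?thesis by (simp only: same)
  qed
  have p9: "q ^ 5 * q ^ 6 = q ^ 9 * q ^ 2" by (simp flip: power_add)
  consider "k = l" | "k = 4" | "k \<noteq> l" "k \<noteq> 4" by blast
  then show ?thesis
  proof cases
    case 1
    then have "cls k (?R b) \<longleftrightarrow> ?R b = ?C" for b using cC cR[of b] l23 by (cases "?R b = ?C") (simp_all only:, auto)
    then have "{b \<in> Dig 1. cls k (?R b)} = {b \<in> Dig 1. ?R b = ?C}" by (simp only:)
    then have "?s = q ^ 6 * \<gamma>" using same by simp
    moreover have "branching k l = q ^ 2" using 1 l23 by (elim disjE) (simp_all add: branching_def)
    ultimately show ?thesis using p9 by (simp only: mult.assoc[symmetric])
  next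
    case 2
    then have "cls k (?R b) \<longleftrightarrow> ?R b \<noteq> ?C" for b using cC cR[of b] l23 by (cases "?R b = ?C") (simp_all only:, auto)
    then have "{b \<in> Dig 1. cls k (?R b)} = {b \<in> Dig 1. ?R b \<noteq> ?C}" by (simp only:)
    then have s: "(\<Sum>b\<in>Dig 1. gcard (?R b)) = q ^ 6 * \<gamma> + ?s" using tot by simp
    have t: "q ^ 6 * \<gamma> + ?s + \<kappa> * q ^ 7 = \<kappa> * q ^ 9 + \<gamma> * q ^ 7" using lift(4) s by simp
    from l show ?thesis
    proof
      assume l: "l = 2 \<and> \<gamma> = g_split \<and> \<kappa> = (q - 1) ^ 2"
      then have "?s = \<gamma> * q ^ 7" using t five_arith(1) by simp
      moreover have "branching k l = q ^ 3" using l 2 by (simp add: branching_def)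
      ultimately show ?thesis by (simp add: mult_ac flip: power_add)
    next
      assume l: "l = 3 \<and> \<gamma> = g_nil \<and> \<kappa> = q * (q - 1)"
      then have "?s = \<gamma> * q ^ 7 + q ^ 5 * \<gamma>" using t five_arith(2) by (simp add: distrib_right)
      moreover have "branching k l = q ^ 3 + q" using l 2 by (simp add: branching_def)
      moreover have "q ^ 5 * q ^ 7 = q ^ 9 * q ^ 3" "q ^ 5 * q ^ 5 = q ^ 9 * q" by (simp_all add: eval_nat_numeral)
      ultimately show ?thesis by (simp only: distrib_left distrib_right) (simp only: mult_ac)
    qed
  next
    case 3
    then have "\<not> cls k (?R b)" for b using cC cR[of b] by (cases "?R b = ?C") (simp_all only:, auto)
    then have "{b \<in> Dig 1. cls k (?R b)} = {}" by blast
    then have "?s = 0" by (simp only: sum.empty)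
    moreover have "branching k l = 0" using 3 l23 k by (elim disjE) (auto simp: branching_def)
    ultimately show ?thesis by simp
  qed
qed

text \<open>The identity holds with the residue set C in place of the centralizer; multiplying by
  \<open>ncent m a\<close> completes both \<open>ncent i a\<close> and
  \<open>ngcent i a\<close>.\<close>

lemma branching_rule:
  assumes i: "i < L" "i = Suc m" and k: "k \<in> types" and l: "l \<in> types" and c: "cls l (rcent i a)"
  shows "ncent i a * (\<Sum>b\<in>{b \<in> Dig 1. cls k (rcent (Suc i) (a + sc (p ^ i) * b))}. gcard (rcent (Suc i) (a + sc (p ^ i) * b)))
    = q ^ 9 * branching k l * ngcent i a" (is "_ * ?s = _")
proof -
  let ?R = "\<lambda>b. rcent (Suc i) (a + sc (p ^ i) * b)" and ?C = "rcent i a"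
  have n: "ncent i a = card (?C \<inter> Dig 1) * ncent m a" "ngcent i a = gcard ?C * ncent m a"
    using ncent_Suc[of m a] ngcent_Suc[of m a] i by simp_all
  have key: "card (?C \<inter> Dig 1) * ?s = q ^ 9 * branching k l * gcard ?C"
  proof -
    have "typed i a" using all_typed i by simp
    then consider s where "a - sc s \<in> JJ i" | "card (?C \<inter> Dig 1) = q ^ 3"
      | "five_type i a g_split ((q - 1) ^ 2)" | "five_type i a g_nil (q * (q - 1))" unfolding typed_def by blast
    then show ?thesis
    proof cases
      case 1
      have C: "?C = UNIV" by (rule rcent_scalar[OF 1])
      have "cls 1 ?C" unfolding C cls_def using card_UNIV_Dig1 by simp
      then have l1: "l = 1" using cls_disjoint[OF l _ c, of 1] by simp
      obtain e where e: "\<And>b. ?R b = cent 1 (e + b)" using scalar_lift[OF i(1) 1] by metis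
      have fin: "finite (Dig 1)" by (rule finite_Dig)
      \<comment> \<open>As b runs over the residues, so does e + b. The conditional puts the
        selection into the summand, to which \<open>sum_shift\<close> applies.\<close>
      have "?s = (\<Sum>b\<in>Dig 1. if cls k (cent 1 (e + b)) then gcard (cent 1 (e + b)) else 0)"
        unfolding e by (rule sum.inter_filter[OF fin])
      also have "\<dots> = (\<Sum>b\<in>Dig 1. if cls k (cent 1 b) then gcard (cent 1 b) else 0)"
      proof (rule sum_shift)
        fix b c assume "b - c \<in> JJ 1"
        then have "cent 1 b = cent 1 c" by (rule cent_cong)
        then show "(if cls k (cent 1 b) then gcard (cent 1 b) else 0) = (if cls k (cent 1 c) then gcard (cent 1 c) else 0)" by simp
      qed
      also have "\<dots> = (\<Sum>b\<in>{b \<in> Dig 1. cls k (cent 1 b)}. gcard (cent 1 b))" by (rule sum.inter_filter[OF fin, symmetric])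
      also have "\<dots> = card (nf_index k) * card (Dig 1 \<inter> GL)" by (rule sum_type(1)[OF k])
      finally have s: "?s = card (nf_index k) * card (Dig 1 \<inter> GL)" .
      have "branching k l = card (nf_index k)" using k card_nf_index l1 by (auto simp: branching_def)
      then show ?thesis using s card_UNIV_Dig1 by (simp add: C del: One_nat_def)
    next
      case 2
      have l4: "cls 4 ?C" using 2 by (simp add: cls_def)
      then have l: "l = 4" using cls_disjoint[OF l _ c, of 4] by simp
      have R: "?R b = ?C" for b by (rule card3_lift[OF i 2])
      show ?thesis
      proof (cases "k = 4")
        case True
        then have "?s = q ^ 9 * gcard ?C" unfolding R using l4 card_Dig[OF L_pos] by simp
        then show ?thesis using 2 True l by (simp add: branching_def)
      next
        case False
        then have "\<not> cls k ?C" using cls_disjoint[OF k _ _ l4] by auto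
        then have "?s = 0" unfolding R by simp
        then show ?thesis using False l by (simp add: branching_def)
      qed
    next
      case 3
      have "cls 2 ?C" using five_type_card[OF 3] by (simp add: cls_def)
      then have "l = 2" using cls_disjoint[OF l _ c, of 2] by simp
      then show ?thesis using branching_five[OF i 3 _ k, of l] five_type_card[OF 3] by simp
    next
      case 4
      have "cls 3 ?C" using five_type_card[OF 4] by (simp add: cls_def)
      then have "l = 3" using cls_disjoint[OF l _ c, of 3] by simp
      then show ?thesis using branching_five[OF i 4 _ k, of l] five_type_card[OF 4] by simp
    qed
  qed
  have "ncent i a * ?s = (card (?C \<inter> Dig 1) * ?s) * ncent m a" by (simp only: n mult_ac)
  also have "\<dots> = q ^ 9 * branching k l * ngcent i a" unfolding key by (simp only: n mult_ac)
  finally show ?thesis .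
qed

lemma typed_cls:
  assumes "1 \<le> i" "i \<le> L"
  shows "\<exists>k\<in>types. cls k (rcent i a)"
proof -
  from all_typed[OF assms] consider s where "a - sc s \<in> JJ i" | "card (rcent i a \<inter> Dig 1) = q ^ 3"
    | "five_type i a g_split ((q - 1) ^ 2)" | "five_type i a g_nil (q * (q - 1))" unfolding typed_def by blast
  then show ?thesis
  proof cases
    case 1
    have "cls 1 (rcent i a)" unfolding rcent_scalar[OF 1] cls_def using card_UNIV_Dig1 by simp
    then show ?thesis by blast
  next
    case 2
    then have "cls 4 (rcent i a)" by (simp add: cls_def)
    then show ?thesis by blast
  next
    case 3
    then have "cls 2 (rcent i a)" using five_type_card[OF 3] by (simp add: cls_def)
    then show ?thesis by blast
  next
    case 4
    then have "cls 3 (rcent i a)" using five_type_card[OF 4] by (simp add: cls_def)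
    then show ?thesis by blast
  qed
qed

section \<open>Burnside sums and their recursion\<close>

section \<open>The recursion for the class numbers\<close>

text \<open>The number of commuting pairs (X, a) at level i with X invertible and a of type k;
  divided by the order of the group it is the number of similarity classes of type k.
  \<open>U\<close> is the set of all matrices or \<open>GL\<close>.\<close>

definition type_sum :: "'a mat3 set \<Rightarrow> nat \<Rightarrow> nat \<Rightarrow> nat" where
  "type_sum U i k = (\<Sum>a\<in>{a \<in> Dig i \<inter> U. cls k (rcent i a)}. ngcent i a)"

lemma type_sum_total:
  assumes "1 \<le> i" "i \<le> L"
  shows "(\<Sum>a\<in>Dig i \<inter> U. ngcent i a) = (\<Sum>k\<in>types. type_sum U i k)"
proof -
  have "Dig i \<inter> U = (\<Union>k\<in>types. {a \<in> Dig i \<inter> U. cls k (rcent i a)})" using typed_cls[OF assms] by blast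
  then have "(\<Sum>a\<in>Dig i \<inter> U. ngcent i a) = (\<Sum>a\<in>(\<Union>k\<in>types. {a \<in> Dig i \<inter> U. cls k (rcent i a)}). ngcent i a)"
    by (rule sum.cong) simp
  also have "\<dots> = (\<Sum>k\<in>types. \<Sum>a\<in>{a \<in> Dig i \<inter> U. cls k (rcent i a)}. ngcent i a)"
  proof (rule sum.UNION_disjoint)
    show "\<forall>k\<in>types. \<forall>l\<in>types. k \<noteq> l \<longrightarrow> {a \<in> Dig i \<inter> U. cls k (rcent i a)} \<inter> {a \<in> Dig i \<inter> U. cls l (rcent i a)} = {}"
      using cls_disjoint by blast
  qed (use finite_Dig in auto)
  finally show ?thesis by (simp only: type_sum_def)
qed

lemma type_sum_Suc:
  assumes i: "i < L" "i = Suc m" and k: "k \<in> types"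
    and U: "\<And>X Y. X - Y \<in> JJ 1 \<Longrightarrow> X \<in> U \<longleftrightarrow> Y \<in> U"
  shows "type_sum U (Suc i) k = q ^ 9 * (\<Sum>l\<in>types. branching k l * type_sum U i l)"
proof -
  let ?R = "\<lambda>a b. rcent (Suc i) (a + sc (p ^ i) * b)"
  have fin: "finite (Dig j)" for j by (rule finite_Dig)
  have aU: "a + sc (p ^ i) * b \<in> U \<longleftrightarrow> a \<in> U" for a b
    using U[of "a + sc (p ^ i) * b" a] JJ_anti[OF _ pJJ[of i b], of 1] i by simp
  have ng: "ngcent (Suc i) (a + sc (p ^ i) * b) = gcard (?R a b) * ncent i a" for a b
    using ngcent_Suc[OF i(1), of "a + sc (p ^ i) * b"] ncent_cong[of "a + sc (p ^ i) * b" a i] pJJ by simp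
  have "type_sum U (Suc i) k = (\<Sum>a\<in>Dig (Suc i). if a \<in> U \<and> cls k (rcent (Suc i) a) then ngcent (Suc i) a else 0)"
    unfolding type_sum_def using sum.inter_filter[OF fin, of "ngcent (Suc i)" "Suc i" "\<lambda>a. a \<in> U \<and> cls k (rcent (Suc i) a)"]
    by (simp add: Int_def)
  also have "\<dots> = (\<Sum>a\<in>Dig i. \<Sum>b\<in>Dig 1. if a \<in> U \<and> cls k (?R a b) then gcard (?R a b) * ncent i a else 0)"
    unfolding sum_Dig_Suc[OF i(1)] aU ng ..
  also have "\<dots> = (\<Sum>a\<in>Dig i. if a \<in> U then q ^ 9 * (\<Sum>l\<in>types. if cls l (rcent i a) then branching k l * ngcent i a else 0) else 0)"
  proof (rule sum.cong[OF refl])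
    fix a
    show "(\<Sum>b\<in>Dig 1. if a \<in> U \<and> cls k (?R a b) then gcard (?R a b) * ncent i a else 0) =
      (if a \<in> U then q ^ 9 * (\<Sum>l\<in>types. if cls l (rcent i a) then branching k l * ngcent i a else 0) else 0)"
    proof (cases "a \<in> U")
      case True
      obtain l where l: "l \<in> types" "cls l (rcent i a)" using typed_cls[of i a] i by auto
      have "(\<Sum>b\<in>Dig 1. if a \<in> U \<and> cls k (?R a b) then gcard (?R a b) * ncent i a else 0)
        = ncent i a * (\<Sum>b\<in>Dig 1. if cls k (?R a b) then gcard (?R a b) else 0)"
        unfolding sum_distrib_left using True by (intro sum.cong refl) simp
      also have "\<dots> = ncent i a * (\<Sum>b\<in>{b \<in> Dig 1. cls k (?R a b)}. gcard (?R a b))"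
        by (simp only: sum.inter_filter[OF fin])
      also have "\<dots> = q ^ 9 * branching k l * ngcent i a" by (rule branching_rule[OF i k l])
      finally have 1: "(\<Sum>b\<in>Dig 1. if a \<in> U \<and> cls k (?R a b) then gcard (?R a b) * ncent i a else 0)
        = q ^ 9 * (branching k l * ngcent i a)" by (simp only: mult.assoc)
      \<comment> \<open>a has exactly one type, so its contribution is rewritten as a sum over all
        types, which can be exchanged with the sum over a.\<close>
      have "branching k l * ngcent i a = (\<Sum>l'\<in>types. if l' = l then branching k l' * ngcent i a else 0)"
        by (subst sum.delta) (use l(1) in auto)
      also have "\<dots> = (\<Sum>l'\<in>types. if cls l' (rcent i a) then branching k l' * ngcent i a else 0)"
        using cls_disjoint[OF _ l(1) _ l(2)] l(2) by (intro sum.cong refl) metis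
      finally have 2: "branching k l * ngcent i a
        = (\<Sum>l'\<in>types. if cls l' (rcent i a) then branching k l' * ngcent i a else 0)" .
      show ?thesis unfolding 1 2[symmetric] using True by simp
    qed simp
  qed
  also have "\<dots> = (\<Sum>a\<in>Dig i \<inter> U. q ^ 9 * (\<Sum>l\<in>types. if cls l (rcent i a) then branching k l * ngcent i a else 0))"
    using fin by (simp add: sum.If_cases Int_def)
  also have "\<dots> = q ^ 9 * (\<Sum>l\<in>types. \<Sum>a\<in>Dig i \<inter> U. if cls l (rcent i a) then branching k l * ngcent i a else 0)"
    unfolding sum_distrib_left[symmetric] by (subst sum.swap) simp
  also have "\<dots> = q ^ 9 * (\<Sum>l\<in>types. branching k l * type_sum U i l)"
  proof -
    have "(\<Sum>a\<in>Dig i \<inter> U. if cls l (rcent i a) then branching k l * ngcent i a else 0) = branching k l * type_sum U i l" for l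
      unfolding type_sum_def sum_distrib_left by (rule sum.inter_filter[symmetric]) (use fin in simp)
    then show ?thesis by (simp only:)
  qed
  finally show ?thesis .
qed

fun branch_vec :: "(nat \<Rightarrow> nat) \<Rightarrow> nat \<Rightarrow> nat \<Rightarrow> nat" where
  "branch_vec v 0 k = v k"
| "branch_vec v (Suc i) k = (\<Sum>l\<in>types. branching k l * branch_vec v i l)"

lemma card_GL_Suc:
  assumes i: "i < L" "i = Suc m"
  shows "card (Dig (Suc i) \<inter> GL) = q ^ 9 * card (Dig i \<inter> GL)"
proof -
  have fin: "finite (Dig j)" for j by (rule finite_Dig)
  have aU: "a + sc (p ^ i) * b \<in> GL \<longleftrightarrow> a \<in> GL" for a b
    using GL_cong[of "a + sc (p ^ i) * b" a] JJ_anti[OF _ pJJ[of i b], of 1] i by simp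
  have c: "card (Dig j \<inter> GL) = (\<Sum>a\<in>Dig j. if a \<in> GL then 1 else 0)" for j
    using fin[of j] by (simp add: sum.If_cases)
  show ?thesis
    unfolding c sum_Dig_Suc[OF i(1)] aU sum_distrib_left using card_Dig[OF L_pos] by simp
qed

text \<open>The factor q^9 of each step is also that of the group order, so the quotients obey the
  recursion of \<open>branch_vec\<close>, which is multiplication by T.\<close>

lemma type_sum_eq:
  assumes k: "k \<in> types" and i: "i < L"
    and U: "\<And>X Y. X - Y \<in> JJ 1 \<Longrightarrow> X \<in> U \<longleftrightarrow> Y \<in> U"
    and v: "\<And>k. k \<in> types \<Longrightarrow> type_sum U 1 k = v k * card (Dig 1 \<inter> GL)"
  shows "type_sum U (Suc i) k = branch_vec v i k * card (Dig (Suc i) \<inter> GL)"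
  using k i
proof (induction i arbitrary: k)
  case 0
  then show ?case using v by simp
next
  case (Suc i)
  have "type_sum U (Suc (Suc i)) k = q ^ 9 * (\<Sum>l\<in>types. branching k l * (branch_vec v i l * card (Dig (Suc i) \<inter> GL)))"
  proof -
    have "type_sum U (Suc (Suc i)) k = q ^ 9 * (\<Sum>l\<in>types. branching k l * type_sum U (Suc i) l)"
      by (rule type_sum_Suc[OF Suc.prems(2) refl Suc.prems(1)]) (rule U)
    also have "(\<Sum>l\<in>types. branching k l * type_sum U (Suc i) l)
        = (\<Sum>l\<in>types. branching k l * (branch_vec v i l * card (Dig (Suc i) \<inter> GL)))"
      by (rule sum.cong[OF refl]) (use Suc.IH Suc.prems in simp)
    finally show ?thesis .
  qed
  also have "\<dots> = branch_vec v (Suc i) k * card (Dig (Suc (Suc i)) \<inter> GL)"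
    unfolding card_GL_Suc[OF Suc.prems(2) refl] branch_vec.simps sum_distrib_left sum_distrib_right
    by (intro sum.cong refl) (simp only: mult_ac)
  finally show ?case .
qed

lemma type_sum_1:
  assumes "k \<in> types"
  shows "type_sum UNIV 1 k = card (nf_index k) * card (Dig 1 \<inter> GL)"
    and "type_sum GL 1 k = card {t \<in> nf_index k. nf k t \<in> GL} * card (Dig 1 \<inter> GL)"
proof -
  have r: "rcent 1 a = cent 1 a" for a
    using cent_rcent cent1_cong[of _ _ a] unfolding rcent_def by blast
  have n: "ngcent 1 a = gcard (cent 1 a)" for a by (simp only: ngcent_def)
  show "type_sum UNIV 1 k = card (nf_index k) * card (Dig 1 \<inter> GL)"
    unfolding type_sum_def r n Int_UNIV_right by (rule sum_type(1)[OF assms])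
  show "type_sum GL 1 k = card {t \<in> nf_index k. nf k t \<in> GL} * card (Dig 1 \<inter> GL)"
    unfolding type_sum_def r n by (rule sum_type(2)[OF assms])
qed

lemma commuting_pairs:
  "(\<Sum>a\<in>Dig L. card {X \<in> Dig L \<inter> GL. X * a - a * X \<in> JJ L})
    = (\<Sum>k\<in>types. branch_vec (\<lambda>k. card (nf_index k)) (L - 1) k) * card (Dig L \<inter> GL)" (is ?A)
  "(\<Sum>a\<in>Dig L \<inter> GL. card {X \<in> Dig L \<inter> GL. X * a - a * X \<in> JJ L})
    = (\<Sum>k\<in>types. branch_vec (\<lambda>k. card {t \<in> nf_index k. nf k t \<in> GL}) (L - 1) k) * card (Dig L \<inter> GL)" (is ?B)
proof -
  have L: "Suc (L - 1) = L" "L - 1 < L" using L_pos by auto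
  have n: "ngcent L a = card {X \<in> Dig L \<inter> GL. X * a - a * X \<in> JJ L}" for a
    unfolding ngcent_def cent_def comm_def by (rule arg_cong[of _ _ card]) blast
  have U: "type_sum UNIV L k = branch_vec (\<lambda>k. card (nf_index k)) (L - 1) k * card (Dig L \<inter> GL)" if "k \<in> types" for k
  proof -
    have "type_sum UNIV (Suc (L - 1)) k = branch_vec (\<lambda>k. card (nf_index k)) (L - 1) k * card (Dig (Suc (L - 1)) \<inter> GL)"
      by (rule type_sum_eq[OF that L(2)]) (simp, rule type_sum_1(1))
    then show ?thesis by (simp only: L(1))
  qed
  have G: "type_sum GL L k = branch_vec (\<lambda>k. card {t \<in> nf_index k. nf k t \<in> GL}) (L - 1) k * card (Dig L \<inter> GL)" if "k \<in> types" for k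
  proof -
    have "type_sum GL (Suc (L - 1)) k = branch_vec (\<lambda>k. card {t \<in> nf_index k. nf k t \<in> GL}) (L - 1) k * card (Dig (Suc (L - 1)) \<inter> GL)"
      by (rule type_sum_eq[OF that L(2)]) (rule GL_cong, assumption, rule type_sum_1(2))
    then show ?thesis by (simp only: L(1))
  qed
  show ?A
    using type_sum_total[OF L_pos order_refl, of UNIV] U unfolding n sum_distrib_right Int_UNIV_right
    by (metis (no_types, lifting) sum.cong)
  show ?B
    using type_sum_total[OF L_pos order_refl, of GL] G unfolding n sum_distrib_right
    by (metis (no_types, lifting) sum.cong)
qed

end

section \<open>From the type-based model to similarity classes of a carrier-based ring\<close>

section \<open>Class numbers of a presented ring\<close>

definition entry3 :: "'a mat3 \<Rightarrow> nat \<Rightarrow> nat \<Rightarrow> 'a" where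
  "entry3 X i j = [[m11 X, m12 X, m13 X], [m21 X, m22 X, m23 X], [m31 X, m32 X, m33 X]] ! i ! j"

lemma less_3_iff: "i < 3 \<longleftrightarrow> i = 0 \<or> i = 1 \<or> i = (2::nat)"
  by auto

lemma all_less_3: "(\<forall>i<3. P i) \<longleftrightarrow> P 0 \<and> P 1 \<and> P (2::nat)"
  unfolding less_3_iff by blast

definition mat_of :: "('a \<Rightarrow> 'r) \<Rightarrow> 'a mat3 \<Rightarrow> 'r mat" where
  "mat_of \<phi> X = mat 3 3 (\<lambda>(i, j). \<phi> (entry3 X i j))"

lemma mat_of_eq_iff: "mat_of \<phi> X = mat_of \<phi> Y \<longleftrightarrow> \<phi> (m11 X) = \<phi> (m11 Y) \<and> \<phi> (m12 X) = \<phi> (m12 Y)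
  \<and> \<phi> (m13 X) = \<phi> (m13 Y) \<and> \<phi> (m21 X) = \<phi> (m21 Y) \<and> \<phi> (m22 X) = \<phi> (m22 Y) \<and> \<phi> (m23 X) = \<phi> (m23 Y)
  \<and> \<phi> (m31 X) = \<phi> (m31 Y) \<and> \<phi> (m32 X) = \<phi> (m32 Y) \<and> \<phi> (m33 X) = \<phi> (m33 Y)"
proof -
  have "mat_of \<phi> X = mat_of \<phi> Y \<longleftrightarrow> (\<forall>i<3. \<forall>j<3. \<phi> (entry3 X i j) = \<phi> (entry3 Y i j))"
  proof
    assume e: "mat_of \<phi> X = mat_of \<phi> Y"
    show "\<forall>i<3. \<forall>j<3. \<phi> (entry3 X i j) = \<phi> (entry3 Y i j)"
    proof (intro allI impI)
      fix i j :: nat assume "i < 3" "j < 3"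
      then show "\<phi> (entry3 X i j) = \<phi> (entry3 Y i j)"
        using arg_cong[OF e, of "\<lambda>M. M $$ (i, j)"] by (simp add: mat_of_def)
    qed
  next
    assume "\<forall>i<3. \<forall>j<3. \<phi> (entry3 X i j) = \<phi> (entry3 Y i j)"
    then show "mat_of \<phi> X = mat_of \<phi> Y" by (intro eq_matI) (simp_all add: mat_of_def)
  qed
  also have "\<dots> \<longleftrightarrow> \<phi> (m11 X) = \<phi> (m11 Y) \<and> \<phi> (m12 X) = \<phi> (m12 Y)
    \<and> \<phi> (m13 X) = \<phi> (m13 Y) \<and> \<phi> (m21 X) = \<phi> (m21 Y) \<and> \<phi> (m22 X) = \<phi> (m22 Y) \<and> \<phi> (m23 X) = \<phi> (m23 Y)
    \<and> \<phi> (m31 X) = \<phi> (m31 Y) \<and> \<phi> (m32 X) = \<phi> (m32 Y) \<and> \<phi> (m33 X) = \<phi> (m33 Y)"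
    unfolding all_less_3 by (simp add: entry3_def conj_assoc)
  finally show ?thesis .
qed

text \<open>\<phi> identifies the carrier-based ring \<open>R\<close> with the type modulo
  \<open>K\<close>, so the similarity classes of \<open>R\<close> can be counted inside
  \<open>level_ring\<close>.\<close>

locale level_presentation = level_ring K p L S
  for K :: "'a::comm_ring_1 set" and p L S +
  fixes R :: "('r, 'm) ring_scheme" and \<phi> :: "'a \<Rightarrow> 'r"
  assumes R: "cring R" and \<phi>_closed: "\<phi> x \<in> carrier R"
    and \<phi>_add: "\<phi> (x + y) = \<phi> x \<oplus>\<^bsub>R\<^esub> \<phi> y" and \<phi>_mult: "\<phi> (x * y) = \<phi> x \<otimes>\<^bsub>R\<^esub> \<phi> y"
    and \<phi>_1: "\<phi> 1 = \<one>\<^bsub>R\<^esub>" and \<phi>_0: "\<phi> 0 = \<zero>\<^bsub>R\<^esub>"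
    and \<phi>_surj: "r \<in> carrier R \<Longrightarrow> \<exists>x. \<phi> x = r"
    and \<phi>_eq_iff: "\<phi> x = \<phi> y \<longleftrightarrow> x - y \<in> K"
begin

abbreviation \<Phi> :: "'a mat3 \<Rightarrow> 'r mat" where "\<Phi> \<equiv> mat_of \<phi>"

lemma \<Phi>_eq_iff: "\<Phi> X = \<Phi> Y \<longleftrightarrow> X - Y \<in> JJ L"
  by (simp add: mat_of_eq_iff \<phi>_eq_iff mat3_of_def J_L)

lemma M3_eq: "M3 R = range \<Phi>"
proof (intro equalityI subsetI)
  fix M assume M: "M \<in> M3 R"
  obtain g where g: "\<And>r. r \<in> carrier R \<Longrightarrow> \<phi> (g r) = r" using \<phi>_surj by metis
  let ?X = "Mat3 (g (M $$ (0, 0))) (g (M $$ (0, 1))) (g (M $$ (0, 2))) (g (M $$ (1, 0))) (g (M $$ (1, 1)))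
    (g (M $$ (1, 2))) (g (M $$ (2, 0))) (g (M $$ (2, 1))) (g (M $$ (2, 2)))"
  have M': "M \<in> carrier_mat 3 3" "\<And>i j. i < 3 \<Longrightarrow> j < 3 \<Longrightarrow> M $$ (i, j) \<in> carrier R"
    using M by (auto simp: matrix_ring_def)
  have "M = \<Phi> ?X"
  proof (rule eq_matI)
    fix i j assume "i < dim_row (\<Phi> ?X)" "j < dim_col (\<Phi> ?X)"
    then have ij: "i < 3" "j < 3" by (simp_all add: mat_of_def)
    then have "entry3 ?X i j = g (M $$ (i, j))" unfolding less_3_iff by (auto simp: entry3_def)
    then show "M $$ (i, j) = \<Phi> ?X $$ (i, j)" using ij M'(2) g by (simp add: mat_of_def)
  qed (use M' in \<open>auto simp: mat_of_def\<close>)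
  then show "M \<in> range \<Phi>" by blast
qed (auto simp: matrix_ring_def mat_of_def \<phi>_closed)

lemma \<Phi>_mult: "\<Phi> X \<otimes>\<^bsub>matrix_ring 3 R\<^esub> \<Phi> Y = \<Phi> (X * Y)"
proof -
  interpret cring R by (rule R)
  have s: "(\<Oplus>\<^bsub>R\<^esub>k\<in>{..<3}. f k) = f 0 \<oplus>\<^bsub>R\<^esub> f 1 \<oplus>\<^bsub>R\<^esub> f 2" if f: "\<And>k. f k \<in> carrier R" for f :: "nat \<Rightarrow> 'r"
  proof -
    have "{..<3} = {0, 1, 2::nat}" by auto
    then show ?thesis using f by (simp add: a_assoc)
  qed
  have e: "entry3 (X * Y) i j = entry3 X i 0 * entry3 Y 0 j + entry3 X i 1 * entry3 Y 1 j + entry3 X i 2 * entry3 Y 2 j"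
    if "i < 3" "j < 3" for i j
    using that unfolding less_3_iff by (auto simp: entry3_def)
  have "(\<Oplus>\<^bsub>R\<^esub>k\<in>{..<3}. \<Phi> X $$ (i, k) \<otimes>\<^bsub>R\<^esub> \<Phi> Y $$ (k, j)) = \<phi> (entry3 (X * Y) i j)" if ij: "i < 3" "j < 3" for i j
  proof -
    have "(\<Oplus>\<^bsub>R\<^esub>k\<in>{..<3}. \<Phi> X $$ (i, k) \<otimes>\<^bsub>R\<^esub> \<Phi> Y $$ (k, j))
      = (\<Oplus>\<^bsub>R\<^esub>k\<in>{..<3}. \<phi> (entry3 X i k) \<otimes>\<^bsub>R\<^esub> \<phi> (entry3 Y k j))"
      using ij by (intro finsum_cong') (auto simp: mat_of_def \<phi>_closed)
    also have "\<dots> = \<phi> (entry3 (X * Y) i j)" by (subst s) (simp_all add: \<phi>_closed e[OF ij] \<phi>_add \<phi>_mult)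
    finally show ?thesis .
  qed
  then show ?thesis
    by (intro eq_matI) (simp_all add: matrix_ring_def mat_of_def[of \<phi> "X * Y"])
qed

lemma \<Phi>_1: "\<one>\<^bsub>matrix_ring 3 R\<^esub> = \<Phi> 1"
proof -
  have "\<phi> (entry3 1 i j) = (if i = j then \<one>\<^bsub>R\<^esub> else \<zero>\<^bsub>R\<^esub>)" if "i < 3" "j < 3" for i j
    using that unfolding less_3_iff by (auto simp: entry3_def \<phi>_0 \<phi>_1)
  then show ?thesis by (intro eq_matI) (simp_all add: matrix_ring_def mat_of_def)
qed

lemma \<Phi>_GL: "\<Phi> X \<in> GL3 R \<longleftrightarrow> X \<in> GL"
proof
  assume "\<Phi> X \<in> GL3 R"
  then obtain M where "M \<in> M3 R" "\<Phi> X \<otimes>\<^bsub>matrix_ring 3 R\<^esub> M = \<one>\<^bsub>matrix_ring 3 R\<^esub>" by (auto simp: Units_def)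
  then obtain Y where "\<Phi> (X * Y) = \<Phi> 1" unfolding M3_eq \<Phi>_1 using \<Phi>_mult by auto
  then have "X * Y - 1 \<in> JJ 1" using JJ_anti[OF L_pos] \<Phi>_eq_iff by blast
  then show "X \<in> GL" using GL_cong GL_1 GL_mult by blast
next
  assume "X \<in> GL"
  then obtain Y where "X * Y - 1 \<in> JJ L" "Y * X - 1 \<in> JJ L" using GL_inverse by metis
  then have "\<Phi> (X * Y) = \<Phi> 1" "\<Phi> (Y * X) = \<Phi> 1" using \<Phi>_eq_iff by blast+
  then show "\<Phi> X \<in> GL3 R" using M3_eq by (auto simp: Units_def \<Phi>_1 \<Phi>_mult intro!: bexI[of _ "\<Phi> Y"])
qed

lemma GL3_eq: "GL3 R = \<Phi> ` GL"
  using M3_eq \<Phi>_GL by (auto simp: Units_def)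

lemma similarity3_iff: "(\<Phi> a, \<Phi> b) \<in> similarity3 R \<longleftrightarrow> conjg L a b"
proof -
  have "\<Phi> a \<in> M3 R" "\<Phi> b \<in> M3 R" using M3_eq by auto
  then show ?thesis
    unfolding similarity3_def conjg_def GL3_eq by (simp add: \<Phi>_mult \<Phi>_eq_iff)
qed

lemma similarity3_class: "similarity3 R `` {\<Phi> a} = {\<Phi> b | b. conjg L a b}"
proof (intro equalityI subsetI)
  fix M assume M: "M \<in> similarity3 R `` {\<Phi> a}"
  then have "M \<in> M3 R" by (auto simp: similarity3_def)
  then obtain b where "M = \<Phi> b" using M3_eq by auto
  then show "M \<in> {\<Phi> b | b. conjg L a b}" using M similarity3_iff by auto
qed (auto simp: similarity3_iff)

lemma L_pos': "0 < L"
  using L_pos by simp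

text \<open>Burnside's count: \<open>sum_centralizers_level\<close> applied to one representative of
  each class in \<open>U\<close>.\<close>

lemma card_similarity_classes:
  assumes U: "\<And>a b. conjg L a b \<Longrightarrow> a \<in> U \<Longrightarrow> b \<in> U"
  shows "card (\<Phi> ` U // similarity3 R) * card (Dig L \<inter> GL) = (\<Sum>b\<in>Dig L \<inter> U. card (cent L b \<inter> Dig L \<inter> GL))"
proof -
  note conj = conjgI[OF L_pos' order_refl] conjg_cong[OF L_pos' order_refl]
  note sym = conjg_sym[OF L_pos' order_refl]
  note trans = conjg_trans[OF L_pos' order_refl]
  have refl: "conjg L a a" for a using conj(2)[of a a] JJ_closed(1) by simp
  \<comment> \<open>Similar matrices satisfy the same predicate under \<open>SOME\<close>, so r is
    constant on classes and picks one representative of each.\<close>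
  define r where "r b = (SOME c. c \<in> Dig L \<and> conjg L b c)" for b
  have r: "r b \<in> Dig L \<and> conjg L b (r b)" for b
  proof -
    have "b - rep (JJ L) (Dig L) b \<in> JJ L" "rep (JJ L) (Dig L) b \<in> Dig L"
      using rep[OF Dig_transversal[OF order_refl]] by auto
    then have "\<exists>c. c \<in> Dig L \<and> conjg L b c" using conj(2) by blast
    then show ?thesis unfolding r_def by (rule someI_ex)
  qed
  have r_eq: "r b = r c" if "conjg L b c" for b c
  proof -
    have "conjg L b d \<longleftrightarrow> conjg L c d" for d using that trans sym by blast
    then show ?thesis by (simp add: r_def)
  qed
  let ?I = "r ` (Dig L \<inter> U)"
  have rU: "r b \<in> U" if "b \<in> U" for b using r U that by blast
  have fin: "finite ?I" using finite_Dig by simp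
  have inj: "i = j" if "i \<in> ?I" "j \<in> ?I" "conjg L i j" for i j
  proof -
    from that obtain b c where bc: "i = r b" "j = r c" by blast
    then have ri: "r i = i" "r j = j" using r r_eq by metis+
    show ?thesis using r_eq[OF that(3)] unfolding ri .
  qed
  have "bij_betw (\<lambda>i. similarity3 R `` {\<Phi> i}) ?I (\<Phi> ` U // similarity3 R)"
    unfolding bij_betw_def
  proof
    show "inj_on (\<lambda>i. similarity3 R `` {\<Phi> i}) ?I"
    proof (rule inj_onI)
      fix i j assume ij: "i \<in> ?I" "j \<in> ?I" "similarity3 R `` {\<Phi> i} = similarity3 R `` {\<Phi> j}"
      have "(\<Phi> j, \<Phi> j) \<in> similarity3 R" using similarity3_iff refl by blast
      then have "(\<Phi> i, \<Phi> j) \<in> similarity3 R" using ij(3) by blast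
      then show "i = j" using inj ij similarity3_iff by blast
    qed
    show "(\<lambda>i. similarity3 R `` {\<Phi> i}) ` ?I = \<Phi> ` U // similarity3 R"
    proof (intro equalityI subsetI)
      fix C assume "C \<in> (\<lambda>i. similarity3 R `` {\<Phi> i}) ` ?I"
      then obtain b where "b \<in> U" "C = similarity3 R `` {\<Phi> (r b)}" by blast
      then show "C \<in> \<Phi> ` U // similarity3 R" using rU by (auto intro: quotientI)
    next
      fix C assume "C \<in> \<Phi> ` U // similarity3 R"
      then obtain x where x: "x \<in> U" "C = similarity3 R `` {\<Phi> x}" by (auto simp: quotient_def)
      have "r x \<in> Dig L \<inter> U" using r rU x(1) by blast
      then have "r x \<in> ?I" using r r_eq[of x "r x"] by (intro image_eqI[of _ r "r x"]) auto
      moreover have "conjg L x b \<longleftrightarrow> conjg L (r x) b" for b using r trans sym by blast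
      then have "C = similarity3 R `` {\<Phi> (r x)}" unfolding x(2) similarity3_class by simp
      ultimately show "C \<in> (\<lambda>i. similarity3 R `` {\<Phi> i}) ` ?I" by blast
    qed
  qed
  then have "card (\<Phi> ` U // similarity3 R) = card ?I" by (rule bij_betw_same_card[symmetric])
  moreover have "{b \<in> Dig L. \<exists>i\<in>?I. conjg L i b} = Dig L \<inter> U"
  proof (intro equalityI subsetI)
    fix b assume "b \<in> {b \<in> Dig L. \<exists>i\<in>?I. conjg L i b}"
    then show "b \<in> Dig L \<inter> U" using rU U by blast
  next
    fix b assume "b \<in> Dig L \<inter> U"
    then show "b \<in> {b \<in> Dig L. \<exists>i\<in>?I. conjg L i b}" using r sym by blast
  qed
  ultimately show ?thesis
    using sum_centralizers_level[OF L_pos' order_refl fin, of "\<lambda>i. i"] inj by simp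
qed

lemma class_numbers:
  "card (Sim_M3 R) = (\<Sum>k\<in>types. branch_vec (\<lambda>k. card (nf_index k)) (L - 1) k)"
  "card (Sim_GL3 R) = (\<Sum>k\<in>types. branch_vec (\<lambda>k. card {t \<in> nf_index k. nf k t \<in> GL}) (L - 1) k)"
proof -
  have "1 - rep (JJ L) (Dig L) 1 \<in> JJ 1" "rep (JJ L) (Dig L) 1 \<in> Dig L"
    using rep[OF Dig_transversal[OF order_refl], of 1] JJ_anti[OF L_pos] by auto
  then have "rep (JJ L) (Dig L) 1 \<in> Dig L \<inter> GL" using GL_1 GL_cong by blast
  then have pos: "card (Dig L \<inter> GL) \<noteq> 0" using finite_Dig[of L] by (metis card_eq_0_iff empty_iff finite_Int)
  have n: "card (cent L a \<inter> Dig L \<inter> GL) = card {X \<in> Dig L \<inter> GL. X * a - a * X \<in> JJ L}" for a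
    unfolding cent_def comm_def by (rule arg_cong[of _ _ card]) blast
  have "card (Sim_M3 R) * card (Dig L \<inter> GL) = (\<Sum>k\<in>types. branch_vec (\<lambda>k. card (nf_index k)) (L - 1) k) * card (Dig L \<inter> GL)"
    using card_similarity_classes[of UNIV] unfolding Sim_M3_def M3_eq n commuting_pairs(1)[symmetric] by simp
  then show "card (Sim_M3 R) = (\<Sum>k\<in>types. branch_vec (\<lambda>k. card (nf_index k)) (L - 1) k)"
    by (rule mult_right_cancel[OF pos, THEN iffD1])
  have "card (\<Phi> ` GL // similarity3 R) * card (Dig L \<inter> GL) = (\<Sum>b\<in>Dig L \<inter> GL. card (cent L b \<inter> Dig L \<inter> GL))"
    by (rule card_similarity_classes) (use conjg_GL[OF L_pos' order_refl] in blast)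
  then have "card (Sim_GL3 R) * card (Dig L \<inter> GL) = (\<Sum>k\<in>types. branch_vec (\<lambda>k. card {t \<in> nf_index k. nf k t \<in> GL}) (L - 1) k) * card (Dig L \<inter> GL)"
    unfolding Sim_GL3_def GL3_eq n commuting_pairs(2)[symmetric] .
  then show "card (Sim_GL3 R) = (\<Sum>k\<in>types. branch_vec (\<lambda>k. card {t \<in> nf_index k. nf k t \<in> GL}) (L - 1) k)"
    by (rule mult_right_cancel[OF pos, THEN iffD1])
qed

end

section \<open>A surjection from a free commutative ring onto a given ring\<close>

section \<open>Presenting a ring by the free commutative ring on its elements\<close>

text \<open>Elements outside the carrier are skipped, so that the operation commutes with itself on
  the whole type, as folding over a multiset requires.\<close>

definition mult_or_skip :: "('r, 'm) ring_scheme \<Rightarrow> 'r \<Rightarrow> 'r \<Rightarrow> 'r" where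
  "mult_or_skip R x a = (if x \<in> carrier R \<and> a \<in> carrier R then x \<otimes>\<^bsub>R\<^esub> a else a)"

text \<open>Integer combinations of multisets form the polynomial ring over the integers with one
  variable for each element of the type; multisets are the monomials. A monomial goes to the product
  of its members in the carrier, and freeness as an abelian group extends this additively.
  Multiplicativity is checked on monomials in one argument after the other.\<close>

lemma free_commutative_ring_hom:
  fixes R :: "('r, 'm) ring_scheme"
  assumes "cring R"
  obtains h :: "('r multiset \<Rightarrow>\<^sub>0 int) \<Rightarrow> 'r" where "\<And>x. h x \<in> carrier R"
    "\<And>x y. h (x + y) = h x \<oplus>\<^bsub>R\<^esub> h y" "\<And>x y. h (x * y) = h x \<otimes>\<^bsub>R\<^esub> h y"
    "h 1 = \<one>\<^bsub>R\<^esub>" "h 0 = \<zero>\<^bsub>R\<^esub>" "\<And>x y. h (x - y) = h x \<ominus>\<^bsub>R\<^esub> h y" "\<And>r. r \<in> carrier R \<Longrightarrow> \<exists>x. h x = r"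
proof -
  interpret R: cring R by (rule assms)
  interpret f: comp_fun_commute "mult_or_skip R"
    by standard (auto simp: fun_eq_iff mult_or_skip_def R.m_lcomm)
  define mon where "mon M = fold_mset (mult_or_skip R) \<one>\<^bsub>R\<^esub> M" for M
  have mon_empty: "mon {#} = \<one>\<^bsub>R\<^esub>" by (simp add: mon_def)
  have mon_add1: "mon (add_mset x M) = mult_or_skip R x (mon M)" for x M by (simp add: mon_def)
  have mon_closed: "mon M \<in> carrier R" for M
    by (induction M) (auto simp: mon_empty mon_add1 mult_or_skip_def)
  have mon_add: "mon (M + N) = mon M \<otimes>\<^bsub>R\<^esub> mon N" for M N
    by (induction M) (auto simp: mon_empty mon_add1 mult_or_skip_def mon_closed R.m_assoc)
  have "comm_group (add_monoid R)" by (rule R.a_comm_group)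
  then obtain h where h: "h \<in> hom (free_Abelian_group (UNIV :: 'r multiset set)) (add_monoid R)"
    and hf: "\<And>M. h (frag_of M) = mon M"
    using comm_group.free_Abelian_group_universal[of "add_monoid R" mon UNIV] mon_closed
    by (auto simp: image_subset_iff)
  have closed: "h x \<in> carrier R" for x using h by (auto simp: hom_def free_Abelian_group_def Pi_def)
  have add: "h (x + y) = h x \<oplus>\<^bsub>R\<^esub> h y" for x y using h by (auto simp: hom_def free_Abelian_group_def)
  have zero: "h 0 = \<zero>\<^bsub>R\<^esub>"
    using add[of 0 0] closed[of 0] R.add.r_cancel_one' by simp
  have diff: "h (x - y) = h x \<ominus>\<^bsub>R\<^esub> h y" for x y
  proof -
    have "h x = h (x - y) \<oplus>\<^bsub>R\<^esub> h y" using add[of "x - y" y] by simp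
    then show ?thesis using closed[of "x - y"] closed[of y] by (simp add: R.minus_eq R.a_assoc R.r_neg)
  qed
  have frag_mult: "frag_of M * frag_of N = frag_of (M + N)" for M N :: "'r multiset"
    by (simp add: Poly_Mapping.mult_single)
  have mult1: "h (frag_of M * y) = h (frag_of M) \<otimes>\<^bsub>R\<^esub> h y" for M y
  proof (induction y rule: frag_induction[OF subset_UNIV])
    case 1
    then show ?case by (simp add: zero closed)
  next
    case (2 N)
    then show ?case by (simp add: frag_mult hf mon_add)
  next
    case (3 a b)
    then show ?case by (simp add: right_diff_distrib diff closed R.minus_eq R.r_distr R.r_minus)
  qed
  have mult: "h (x * y) = h x \<otimes>\<^bsub>R\<^esub> h y" for x y
  proof (induction x rule: frag_induction[OF subset_UNIV])
    case 1
    then show ?case by (simp add: zero closed)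
  next
    case (2 N)
    show ?case by (rule mult1)
  next
    case (3 a b)
    then show ?case by (simp add: left_diff_distrib diff closed R.minus_eq R.l_distr R.l_minus)
  qed
  have one: "h 1 = \<one>\<^bsub>R\<^esub>"
    using hf[of "{#}"] by (simp only: Poly_Mapping.single_one mon_empty)
  have surj: "\<exists>x. h x = r" if "r \<in> carrier R" for r
    using that hf[of "{#r#}"] by (auto simp: mon_add1 mon_empty mult_or_skip_def)
  show ?thesis by (rule that[of h]) (fact closed add mult one zero diff surj)+
qed

section \<open>Powers of the maximal ideal and the level quotients\<close>

section \<open>The levels as presented rings\<close>

lemma (in cring) cgenideal_mem: "x \<in> PIdl a \<longleftrightarrow> (\<exists>c\<in>carrier R. x = c \<otimes> a)"
  by (auto simp: cgenideal_def)

lemma (in cring) ideals_set_power_cgenideal: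
  assumes "a \<in> carrier R"
  shows "(PIdl a) [^]\<^bsub>ideals_set R\<^esub> (k::nat) = PIdl (a [^] k)"
proof (induction k)
  case 0
  have "PIdl \<one> = carrier R" by (auto simp: cgenideal_def) (metis r_one)
  then show ?case by (simp add: ideals_set_def)
next
  case (Suc k)
  have I: "ideal (PIdl (a [^] k)) R" "ideal (PIdl a) R" "ideal (PIdl (a [^] Suc k)) R"
    using assms by (auto intro: cgenideal_ideal)
  have "(PIdl a) [^]\<^bsub>ideals_set R\<^esub> Suc k = ideal_prod R (PIdl (a [^] k)) (PIdl a)"
    using Suc by (simp add: ideals_set_def)
  also have "\<dots> = Idl (PIdl (a [^] Suc k))"
    using ideal_prod_eq_genideal[OF I(1,2)] cgenideal_prod[of "a [^] k" a] assms by simp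
  also have "\<dots> = PIdl (a [^] Suc k)"
    using I(3) genideal_minimal[OF I(3) subset_refl] genideal_self[of "PIdl (a [^] Suc k)"] ideal.Icarr[OF I(3)] by blast
  finally show ?case .
qed

text \<open>Were x no unit, Zorn's lemma would put its principal ideal into a maximal ideal, which
  can only be \<mm>.\<close>

lemma local_ring_unit:
  assumes A: "local_principal_ideal_ring A \<mm>" and x: "x \<in> carrier A" "x \<notin> \<mm>"
  shows "\<exists>y\<in>carrier A. x \<otimes>\<^bsub>A\<^esub> y = \<one>\<^bsub>A\<^esub>"
proof -
  interpret cring A using A by (simp add: local_principal_ideal_ring_def)
  let ?I = "PIdl\<^bsub>A\<^esub> x"
  have I: "ideal ?I A" "x \<in> ?I" using x cgenideal_ideal cgenideal_self by auto
  have "\<one>\<^bsub>A\<^esub> \<in> ?I"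
  proof (rule ccontr)
    assume one: "\<one>\<^bsub>A\<^esub> \<notin> ?I"
    let ?S = "{J. ideal J A \<and> ?I \<subseteq> J \<and> \<one>\<^bsub>A\<^esub> \<notin> J}"
    have "\<exists>M\<in>?S. \<forall>J\<in>?S. M \<subseteq> J \<longrightarrow> J = M"
    proof (rule subset_Zorn_nonempty)
      show "?S \<noteq> {}" using I one by blast
      fix C assume C: "C \<noteq> {}" "subset.chain ?S C"
      have CS: "C \<subseteq> ?S" using C(2) unfolding subset.chain_def by (rule conjunct1)
      have "subset.chain {J. ideal J A} C" using C(2) unfolding subset.chain_def by blast
      from chain_Union_is_ideal[OF this] C(1) have "ideal (\<Union>C) A" by simp
      moreover obtain J where "J \<in> C" "?I \<subseteq> J" using C(1) CS by blast
      then have "?I \<subseteq> \<Union>C" by blast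
      moreover have "\<one>\<^bsub>A\<^esub> \<notin> \<Union>C" using CS by blast
      ultimately show "\<Union>C \<in> ?S" by (intro CollectI conjI)
    qed
    then obtain M where M_S: "M \<in> ?S" and max: "\<forall>J\<in>?S. M \<subseteq> J \<longrightarrow> J = M" by (rule bexE)
    then have M: "ideal M A" "?I \<subseteq> M" "\<one>\<^bsub>A\<^esub> \<notin> M" by simp_all
    have "maximalideal M A"
    proof (rule maximalidealI[OF M(1)])
      show "carrier A \<noteq> M" using M(3) by blast
      fix J assume J: "ideal J A" "M \<subseteq> J" "J \<subseteq> carrier A"
      show "J = M \<or> J = carrier A"
      proof (cases "\<one>\<^bsub>A\<^esub> \<in> J")
        case True
        then show ?thesis using ideal.one_imp_carrier[OF J(1)] by blast
      next
        case False
        then have "J \<in> ?S" using J(1,2) M(2) by simp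
        then show ?thesis using max J(2) by simp
      qed
    qed
    then have "M = \<mm>" using A by (auto simp: local_principal_ideal_ring_def)
    then show False using M(2) I(2) x(2) by blast
  qed
  then show ?thesis using x m_comm by (auto simp: cgenideal_mem)
qed

text \<open>\<open>K\<close> is the preimage of the i-th power of \<mm> under a surjection from the
  free ring, and \<open>p\<close> a preimage of a generator of \<mm>. The bound of i by the length
  yields \<open>p ^ (i - 1) \<notin> K\<close>.\<close>

lemma level_presentation_exists:
  fixes A :: "('a, 'b) ring_scheme"
  assumes A: "local_principal_ideal_ring A \<mm>" and fin: "finite (carrier (A Quot \<mm>))"
    and i: "1 \<le> i" "enat i \<le> pir_length A \<mm>"
  obtains K :: "('a multiset \<Rightarrow>\<^sub>0 int) set" and p S \<phi>
  where "level_presentation K p i S (level A \<mm> i) \<phi>" "card S = card (carrier (A Quot \<mm>))"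
proof -
  interpret cring A using A by (simp add: local_principal_ideal_ring_def)
  interpret m: maximalideal \<mm> A using A by (simp add: local_principal_ideal_ring_def)
  have "principalideal \<mm> A" using A m.is_ideal by (simp add: local_principal_ideal_ring_def)
  then obtain p0 where p0: "p0 \<in> carrier A" "\<mm> = PIdl\<^bsub>A\<^esub> p0"
    using principalideal.generate cgenideal_eq_genideal by metis
  have p0m: "p0 \<in> \<mm>" using p0 cgenideal_self by blast
  obtain h :: "('a multiset \<Rightarrow>\<^sub>0 int) \<Rightarrow> 'a" where h: "\<And>x. h x \<in> carrier A"
    "\<And>x y. h (x + y) = h x \<oplus>\<^bsub>A\<^esub> h y" "\<And>x y. h (x * y) = h x \<otimes>\<^bsub>A\<^esub> h y"
    "h 1 = \<one>\<^bsub>A\<^esub>" "h 0 = \<zero>\<^bsub>A\<^esub>" "\<And>x y. h (x - y) = h x \<ominus>\<^bsub>A\<^esub> h y" "\<And>r. r \<in> carrier A \<Longrightarrow> \<exists>x. h x = r"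
    using free_commutative_ring_hom[OF cring_axioms] by blast
  obtain p where p: "h p = p0" using h(7) p0(1) by blast
  have h_pow: "h (p ^ k) = p0 [^]\<^bsub>A\<^esub> k" for k
    by (induction k) (simp_all add: h(3,4) p m_comm p0(1))
  have pow: "\<mm> [^]\<^bsub>ideals_set A\<^esub> k = PIdl\<^bsub>A\<^esub> (p0 [^]\<^bsub>A\<^esub> k)" for k :: nat
    unfolding p0(2) by (rule ideals_set_power_cgenideal[OF p0(1)])
  define I where "I = \<mm> [^]\<^bsub>ideals_set A\<^esub> i"
  have Ip: "I = PIdl\<^bsub>A\<^esub> (p0 [^]\<^bsub>A\<^esub> i)" by (simp add: I_def pow)
  interpret I: ideal I A unfolding Ip using p0(1) by (intro cgenideal_ideal) simp
  have one_m: "\<one>\<^bsub>A\<^esub> \<notin> \<mm>" using m.one_imp_carrier m.I_notcarr by blast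
  have Im: "x \<in> \<mm>" if "x \<in> I" for x
  proof -
    obtain j where "i = Suc j" using i(1) by (cases i) auto
    then obtain c where "c \<in> carrier A" "x = c \<otimes>\<^bsub>A\<^esub> (p0 [^]\<^bsub>A\<^esub> j \<otimes>\<^bsub>A\<^esub> p0)"
      using \<open>x \<in> I\<close> unfolding Ip cgenideal_mem by auto
    then show ?thesis using p0(1) by (simp add: m.I_l_closed p0m)
  qed
  define K where "K = {x. h x \<in> I}"
  have lev1: "lev K p 1 = {x. h x \<in> \<mm>}"
  proof (intro equalityI subsetI CollectI)
    fix x assume "x \<in> lev K p 1"
    then obtain y where "h (x - p * y) \<in> I" by (auto simp: lev_def K_def)
    then have 1: "h (x - p * y) \<in> \<mm>" by (rule Im)
    have 2: "h (p * y) \<in> \<mm>" by (simp add: h(1,3) p m.I_r_closed p0m)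
    have "h x = h (x - p * y) \<oplus>\<^bsub>A\<^esub> h (p * y)" by (simp flip: h(2))
    then show "h x \<in> \<mm>" using m.a_closed[OF 1 2] by simp
  next
    fix x assume "x \<in> {x. h x \<in> \<mm>}"
    then obtain c where c: "c \<in> carrier A" "h x = c \<otimes>\<^bsub>A\<^esub> p0" unfolding p0(2) cgenideal_mem by auto
    then obtain y where "h y = c" using h(7) by blast
    then have "h (x - p ^ 1 * y) = \<zero>\<^bsub>A\<^esub>" using c p0(1) by (simp add: h(3,6) p m_comm r_neg minus_eq)
    then show "x \<in> lev K p 1" 
      using I.zero_closed unfolding lev_def K_def by (intro CollectI exI[of _ y]) simp
  qed
  have eq_iff: "(J +>\<^bsub>A\<^esub> h x = J +>\<^bsub>A\<^esub> h y) \<longleftrightarrow> h (x - y) \<in> J" if "ideal J A" for J x y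
    using quotient_eq_iff_same_a_r_cos[OF that h(1) h(1)] by (simp add: h(6))
  have carrier_Quot: "carrier (A Quot J) = range (\<lambda>x. J +>\<^bsub>A\<^esub> h x)" for J
  proof -
    have "carrier (A Quot J) = (\<lambda>a. J +>\<^bsub>A\<^esub> a) ` carrier A" by (auto simp: FactRing_def A_RCOSETS_def')
    moreover have "carrier A = range h" using h(1,7) by blast
    ultimately show ?thesis by (simp add: image_image)
  qed
  \<comment> \<open>The zero coset gets the representative 0, since \<open>level_ring\<close>
    demands \<open>0 \<in> S\<close>.\<close>
  define f where "f C = (if C = \<mm> then 0 else SOME x. \<mm> +>\<^bsub>A\<^esub> h x = C)" for C
  have f: "\<mm> +>\<^bsub>A\<^esub> h (f C) = C" if "C \<in> carrier (A Quot \<mm>)" for C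
  proof (cases "C = \<mm>")
    case True
    then show ?thesis using m.a_subset by (simp add: f_def h(5) a_coset_add_zero)
  next
    case False
    have "\<exists>x. \<mm> +>\<^bsub>A\<^esub> h x = C" using that carrier_Quot by auto
    from someI_ex[OF this] show ?thesis using False by (simp add: f_def)
  qed
  define S where "S = f ` carrier (A Quot \<mm>)"
  have inj: "inj_on f (carrier (A Quot \<mm>))" by (rule inj_on_inverseI[where g = "\<lambda>x. \<mm> +>\<^bsub>A\<^esub> h x"]) (rule f)
  have mQ: "\<mm> \<in> carrier (A Quot \<mm>)"
    using carrier_Quot[of \<mm>] m.a_subset h(5) a_coset_add_zero by (metis rangeI)
  have sub: "add_subgroup {x. h x \<in> J}" if "ideal J A" for J
  proof -
    interpret J: ideal J A by (rule that)
    show ?thesis using J.zero_closed by (auto simp: add_subgroup_def h(5,6) minus_eq)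
  qed
  have trans: "transversal (lev K p 1) S"
    unfolding transversal_def lev1
  proof (intro conjI allI sub m.is_ideal)
    fix x
    let ?C = "\<mm> +>\<^bsub>A\<^esub> h x"
    have C: "?C \<in> carrier (A Quot \<mm>)" using carrier_Quot by auto
    show "\<exists>!t. t \<in> S \<and> x - t \<in> {x. h x \<in> \<mm>}"
    proof (rule ex1I[of _ "f ?C"])
      show "f ?C \<in> S \<and> x - f ?C \<in> {x. h x \<in> \<mm>}"
        using C f[OF C] eq_iff[OF m.is_ideal, of x "f ?C"] by (auto simp: S_def)
      fix t assume t: "t \<in> S \<and> x - t \<in> {x. h x \<in> \<mm>}"
      then obtain D where D: "D \<in> carrier (A Quot \<mm>)" "t = f D" by (auto simp: S_def)
      have "?C = \<mm> +>\<^bsub>A\<^esub> h t" using t eq_iff[OF m.is_ideal] by blast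
      then show "t = f ?C" using D f by simp
    qed
  qed
  have p_L1: "p0 [^]\<^bsub>A\<^esub> (i - 1) \<notin> I"
  proof
    assume "p0 [^]\<^bsub>A\<^esub> (i - 1) \<in> I"
    show False
    \<comment> \<open>The length ranges over positive exponents, so i = 1 is settled by 1 \<notin>
      \<mm>. Otherwise let k = i - 1: from p0^k = c p0^(k+1) and the invertibility of 1 - c p0 it
      follows that p0^k = 0, which contradicts the length.\<close>
    proof (cases "i = 1")
      case True
      then show False using \<open>p0 [^]\<^bsub>A\<^esub> (i - 1) \<in> I\<close> Im one_m by simp
    next
      case False
      define k where "k = i - 1"
      have k: "0 < k" "i = Suc k" using False i(1) by (auto simp: k_def)
      let ?x = "p0 [^]\<^bsub>A\<^esub> k"
      obtain c where c: "c \<in> carrier A" "?x = c \<otimes>\<^bsub>A\<^esub> (?x \<otimes>\<^bsub>A\<^esub> p0)"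
        using \<open>p0 [^]\<^bsub>A\<^esub> (i - 1) \<in> I\<close> k unfolding Ip cgenideal_mem by auto
      have x: "?x \<in> carrier A" using p0(1) by simp
      define u where "u = \<one>\<^bsub>A\<^esub> \<ominus>\<^bsub>A\<^esub> c \<otimes>\<^bsub>A\<^esub> p0"
      have u: "u \<in> carrier A" using c p0(1) by (simp add: u_def)
      have cp: "c \<otimes>\<^bsub>A\<^esub> p0 \<in> \<mm>" using c(1) by (simp add: m.I_l_closed p0m)
      have "u \<notin> \<mm>"
      proof
        assume "u \<in> \<mm>"
        then have "u \<oplus>\<^bsub>A\<^esub> c \<otimes>\<^bsub>A\<^esub> p0 \<in> \<mm>" using cp by (rule m.a_closed)
        moreover have "u \<oplus>\<^bsub>A\<^esub> c \<otimes>\<^bsub>A\<^esub> p0 = \<one>\<^bsub>A\<^esub>"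
          using c(1) p0(1) by (simp add: u_def minus_eq a_assoc l_neg)
        ultimately show False using one_m by simp
      qed
      then obtain v where v: "v \<in> carrier A" "u \<otimes>\<^bsub>A\<^esub> v = \<one>\<^bsub>A\<^esub>" using local_ring_unit[OF A u] by blast
      have "?x \<otimes>\<^bsub>A\<^esub> (c \<otimes>\<^bsub>A\<^esub> p0) = ?x"
        using c x p0(1) m_lcomm[of ?x c p0] by simp
      then have "?x \<otimes>\<^bsub>A\<^esub> u = \<zero>\<^bsub>A\<^esub>" using x c(1) p0(1) by (simp add: u_def minus_eq r_distr r_minus r_neg)
      then have "?x \<otimes>\<^bsub>A\<^esub> (u \<otimes>\<^bsub>A\<^esub> v) = \<zero>\<^bsub>A\<^esub>" using x u v(1) by (simp add: m_assoc[symmetric])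
      then have "?x = \<zero>\<^bsub>A\<^esub>" using v x by simp
      then have "\<mm> [^]\<^bsub>ideals_set A\<^esub> k = {\<zero>\<^bsub>A\<^esub>}" unfolding pow by (auto simp: cgenideal_def intro: exI[of _ "\<zero>\<^bsub>A\<^esub>"])
      then have "pir_length A \<mm> \<le> enat k" unfolding pir_length_def using k(1) by (intro Inf_lower) auto
      with i(2) k(2) show False using order_trans by fastforce
    qed
  qed
  have "level_presentation K p i S (level A \<mm> i) (\<lambda>x. I +>\<^bsub>A\<^esub> h x)"
  proof (intro level_presentation.intro level_ring.intro level_presentation_axioms.intro)
    show "add_subgroup K" unfolding K_def by (rule sub[OF I.is_ideal])
    show "a * x \<in> K" if "x \<in> K" for a x using that h(1) by (simp add: K_def h(3) I.I_l_closed)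
    show "1 \<le> i" by (rule i(1))
    show "p ^ i \<in> K" using cgenideal_self[of "p0 [^]\<^bsub>A\<^esub> i"] p0(1) by (simp add: K_def h_pow Ip)
    show "p ^ (i - 1) \<notin> K" using p_L1 by (simp add: K_def h_pow)
    show "\<exists>y. x * y - 1 \<in> lev K p 1" if x: "x \<notin> lev K p 1" for x
    proof -
      obtain y0 where y0: "y0 \<in> carrier A" "h x \<otimes>\<^bsub>A\<^esub> y0 = \<one>\<^bsub>A\<^esub>" using local_ring_unit[OF A h(1)] x unfolding lev1 by blast
      then obtain y where "h y = y0" using h(7) by blast
      then have "h (x * y - 1) = \<zero>\<^bsub>A\<^esub>" using y0 by (simp add: h(3,4,6) minus_eq r_neg)
      then show ?thesis unfolding lev1 using m.zero_closed by (intro exI[of _ y]) simp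
    qed
    show "transversal (lev K p 1) S" by (rule trans)
    show "finite S" using fin by (simp add: S_def)
    show "0 \<in> S" using mQ unfolding S_def by (intro image_eqI[of _ _ \<mm>]) (simp_all add: f_def)
    show "cring (level A \<mm> i)" unfolding level_def I_def[symmetric] by (rule I.quotient_is_cring[OF cring_axioms])
    note hom = ring_hom_memE[OF I.rcos_ring_hom]
    show "I +>\<^bsub>A\<^esub> h x \<in> carrier (level A \<mm> i)" for x
      unfolding level_def I_def[symmetric] by (rule hom(1)[OF h(1)])
    show "I +>\<^bsub>A\<^esub> h (x + y) = (I +>\<^bsub>A\<^esub> h x) \<oplus>\<^bsub>level A \<mm> i\<^esub> (I +>\<^bsub>A\<^esub> h y)" for x y
      unfolding level_def I_def[symmetric] h(2) by (rule hom(3)[OF h(1) h(1)])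
    show "I +>\<^bsub>A\<^esub> h (x * y) = (I +>\<^bsub>A\<^esub> h x) \<otimes>\<^bsub>level A \<mm> i\<^esub> (I +>\<^bsub>A\<^esub> h y)" for x y
      unfolding level_def I_def[symmetric] h(3) by (rule hom(2)[OF h(1) h(1)])
    show "I +>\<^bsub>A\<^esub> h 1 = \<one>\<^bsub>level A \<mm> i\<^esub>"
      unfolding level_def I_def[symmetric] h(4) by (rule hom(4))
    show "I +>\<^bsub>A\<^esub> h 0 = \<zero>\<^bsub>level A \<mm> i\<^esub>"
      unfolding level_def I_def[symmetric] h(5) using I.a_subset by (simp add: FactRing_def a_coset_add_zero)
    show "\<exists>x. I +>\<^bsub>A\<^esub> h x = r" if "r \<in> carrier (level A \<mm> i)" for r
      using that unfolding level_def I_def[symmetric] carrier_Quot by auto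
    show "I +>\<^bsub>A\<^esub> h x = I +>\<^bsub>A\<^esub> h y \<longleftrightarrow> x - y \<in> K" for x y
      unfolding K_def using eq_iff[OF I.is_ideal] by simp
  qed
  then show ?thesis using that card_image[OF inj] unfolding S_def by blast
qed

section \<open>Closed forms of the orbits of T and the generating functions\<close>

section \<open>The transfer matrix\<close>

definition T_inv :: "rat \<Rightarrow> rat mat" where
  "T_inv q = mat_of_rows_list 4
     [[1 / q, 0, 0, 0],
      [- (q - 1) / q ^ 2, 1 / q ^ 2, 0, 0],
      [- 1 / q ^ 2, 0, 1 / q ^ 2, 0],
      [1 / q ^ 4, - 1 / q ^ 2, - (q ^ 2 + 1) / q ^ 4, 1 / q ^ 3]]"

lemma less_4_iff: "i < 4 \<longleftrightarrow> i = 0 \<or> i = 1 \<or> i = 2 \<or> i = (3::nat)"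
  by auto

lemma sum_4: "(\<Sum>i = 0..<4. f i) = f 0 + f 1 + f 2 + f (3::nat)"
  by (simp add: eval_nat_numeral)

lemma T_mat_carrier: "T_mat q \<in> carrier_mat 4 4" and T_inv_carrier: "T_inv q \<in> carrier_mat 4 4"
  by (auto intro!: carrier_matI simp: T_mat_def T_inv_def mat_of_rows_list_def)

lemma T_inv:
  assumes "q \<noteq> 0"
  shows "T_mat q * T_inv q = 1\<^sub>m 4" "T_inv q * T_mat q = 1\<^sub>m 4"
proof -
  have "(T_mat q * T_inv q) $$ (i, j) = 1\<^sub>m 4 $$ (i, j) \<and> (T_inv q * T_mat q) $$ (i, j) = 1\<^sub>m 4 $$ (i, j)"
    if "i < 4" "j < 4" for i j
    using that assms unfolding less_4_iff
    by (elim disjE) (simp_all add: T_mat_def T_inv_def mat_of_rows_list_def scalar_prod_def sum_4 field_simps eval_nat_numeral)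
  then show "T_mat q * T_inv q = 1\<^sub>m 4" "T_inv q * T_mat q = 1\<^sub>m 4"
    using T_mat_carrier[of q] T_inv_carrier[of q] by (auto intro!: eq_matI)
qed

definition vec4 :: "rat \<Rightarrow> rat \<Rightarrow> rat \<Rightarrow> rat \<Rightarrow> rat vec" where
  "vec4 a b c d = vec_of_list [a, b, c, d]"

lemma vec4_index: "vec4 a b c d $ 0 = a" "vec4 a b c d $ 1 = b" "vec4 a b c d $ 2 = c" "vec4 a b c d $ 3 = d"
  by (simp_all add: vec4_def vec_of_list_index del: vec_of_list_Cons)

lemma vec4_carrier: "vec4 a b c d \<in> carrier_vec 4" and vec4_dim: "dim_vec (vec4 a b c d) = 4"
  by (rule carrier_vecI; simp add: vec4_def) (simp add: vec4_def)

lemma T_mat_mult_vec4: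
  "T_mat q *\<^sub>v vec4 a b c d =
    vec4 (q * a) ((q ^ 2 - q) * a + q ^ 2 * b) (q * a + q ^ 2 * c) (q ^ 3 * a + q ^ 3 * b + (q ^ 3 + q) * c + q ^ 3 * d)"
proof -
  have "(T_mat q *\<^sub>v vec4 a b c d) $ i = vec4 (q * a) ((q ^ 2 - q) * a + q ^ 2 * b) (q * a + q ^ 2 * c)
    (q ^ 3 * a + q ^ 3 * b + (q ^ 3 + q) * c + q ^ 3 * d) $ i" if "i < 4" for i
    using that unfolding less_4_iff
    by (elim disjE)
      (simp_all add: T_mat_def mat_of_rows_list_def scalar_prod_def vec4_dim sum_4 vec4_index vec4_index(2)[simplified])
  then show ?thesis using T_mat_carrier[of q] by (intro eq_vecI) (simp_all add: vec4_dim)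
qed

lemma eps_vec4: "eps_vec \<bullet> vec4 a b c d = a + b + c + d"
proof -
  have eps: "eps_vec = vec4 1 1 1 1" by (simp add: eps_vec_def vec4_def)
  show ?thesis
    unfolding eps scalar_prod_def vec4_dim sum_4 by (simp only: vec4_index mult_1)
qed

text \<open>A sequence with f (i+1) = T f i that starts at index 0 also covers the exponent -1,
  because f 0 is the inverse of T applied to f 1.\<close>

lemma T_power_orbit:
  assumes q: "q \<noteq> 0" and f: "\<And>i. f (Suc i) = T_mat q *\<^sub>v f i" and f0: "f 0 \<in> carrier_vec 4"
  shows "T_power q (int i - 1) *\<^sub>v f 1 = f i"
proof -
  interpret ring "ring_mat TYPE(rat) 4 ()" by (rule ring_mat)
  note s = ring_mat_simps[of "TYPE(rat)" 4 "()"]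
  have T: "T_mat q \<in> carrier (ring_mat TYPE(rat) 4 ())" using T_mat_carrier by (simp add: s)
  have fc: "f i \<in> carrier_vec 4" for i
    by (induction i) (simp_all add: f f0 mult_mat_vec_carrier[OF T_mat_carrier])
  have pow: "T_mat q [^]\<^bsub>ring_mat TYPE(rat) 4 ()\<^esub> k *\<^sub>v f 1 = f (Suc k)" for k :: nat
  proof (induction k)
    case 0
    then show ?case using fc[of 1] by (simp add: s)
  next
    case (Suc k)
    have P: "T_mat q [^]\<^bsub>ring_mat TYPE(rat) 4 ()\<^esub> k \<in> carrier_mat 4 4" using nat_pow_closed[OF T, of k] by (simp add: s)
    have "T_mat q [^]\<^bsub>ring_mat TYPE(rat) 4 ()\<^esub> Suc k = T_mat q * (T_mat q [^]\<^bsub>ring_mat TYPE(rat) 4 ()\<^esub> k)"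
      using nat_pow_Suc2[OF T, of k] by (simp add: s)
    then have "T_mat q [^]\<^bsub>ring_mat TYPE(rat) 4 ()\<^esub> Suc k *\<^sub>v f 1
      = T_mat q *\<^sub>v ((T_mat q [^]\<^bsub>ring_mat TYPE(rat) 4 ()\<^esub> k) *\<^sub>v f 1)"
      using assoc_mult_mat_vec[OF T_mat_carrier P fc] by simp
    then show ?case using Suc f by simp
  qed
  show ?thesis
  proof (cases i)
    case 0
    have U: "T_mat q \<in> Units (ring_mat TYPE(rat) 4 ())"
      unfolding Units_def using T_inv[OF q] T_mat_carrier T_inv_carrier by (auto simp: s intro!: bexI[of _ "T_inv q"])
    have inv: "inv\<^bsub>ring_mat TYPE(rat) 4 ()\<^esub> (T_mat q) = T_inv q"
      by (rule inv_unique'[symmetric]) (use T_inv[OF q] T_mat_carrier T_inv_carrier in \<open>auto simp: s\<close>)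
    have "T_power q (int i - 1) = inv\<^bsub>ring_mat TYPE(rat) 4 ()\<^esub> (T_mat q)"
      using T 0 by (simp add: T_power_def int_pow_def2)
    then have "T_power q (int i - 1) *\<^sub>v f 1 = T_inv q *\<^sub>v (T_mat q *\<^sub>v f 0)" using inv f[of 0] by simp
    also have "\<dots> = (T_inv q * T_mat q) *\<^sub>v f 0"
      using assoc_mult_mat_vec[OF T_inv_carrier T_mat_carrier fc] by simp
    finally show ?thesis using T_inv[OF q] fc[of 0] 0 by simp
  next
    case (Suc k)
    then show ?thesis using pow[of k] by (simp add: T_power_def int_pow_int)
  qed
qed

lemma s_M3_orbit:
  assumes q: "q \<noteq> 0" "q \<noteq> 1" "q ^ 2 \<noteq> 1"
  shows "s_M3 q i = (1 / ((q - 1) * (q ^ 2 - 1))) *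
    ((q ^ 3 + 1 / q) * (q ^ 3) ^ i - (q ^ 2 + q + 1 + 1 / q) * (q ^ 2) ^ i + 2 * q ^ i)"
proof -
  define s where "s i = (1 / ((q - 1) * (q ^ 2 - 1))) *
    ((q ^ 3 + 1 / q) * (q ^ 3) ^ i - (q ^ 2 + q + 1 + 1 / q) * (q ^ 2) ^ i + 2 * q ^ i)" for i :: nat
  \<comment> \<open>T is lower triangular, so the first three components are solved row by row; the
    last is what remains of the closed form of the sum. At i = 0 the vector is (1, 0, 0, 0), which T
    sends to its first column, and this is \<open>v_M3 q\<close>.\<close>
  define n1 n2 n3 where n: "n1 i = q ^ i" "n2 i = (q ^ 2) ^ i - q ^ i" "n3 i = ((q ^ 2) ^ i - q ^ i) / (q - 1)" for i :: nat
  define f where "f i = vec4 (n1 i) (n2 i) (n3 i) (s i - n1 i - n2 i - n3 i)" for i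
  have q1: "q - 1 \<noteq> 0" "q ^ 2 - 1 \<noteq> 0" using q by auto
  have rec: "f (Suc i) = T_mat q *\<^sub>v f i" for i
  proof -
    define x where "x = q ^ i"
    have p: "(q ^ 2) ^ i = x ^ 2" "(q ^ 3) ^ i = x ^ 3" "q ^ i = x"
      by (simp_all add: x_def mult.commute flip: power_mult)
    have "n1 (Suc i) = q * n1 i" by (simp add: n)
    moreover have "n2 (Suc i) = (q ^ 2 - q) * n1 i + q ^ 2 * n2 i" by (simp add: n algebra_simps)
    moreover have "n3 (Suc i) = q * n1 i + q ^ 2 * n3 i"
      using q1 by (simp add: n field_simps) (simp add: power2_eq_square algebra_simps)
    moreover have "s (Suc i) - n1 (Suc i) - n2 (Suc i) - n3 (Suc i) = q ^ 3 * n1 i + q ^ 3 * n2 i + (q ^ 3 + q) * n3 i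
      + q ^ 3 * (s i - n1 i - n2 i - n3 i)"
      unfolding s_def n power_Suc p using q q1
      by (simp add: divide_simps) (simp add: eval_nat_numeral algebra_simps)
    ultimately show ?thesis unfolding f_def T_mat_mult_vec4 by simp
  qed
  have "s 0 = 1" using q q1 by (simp add: s_def divide_simps) (simp add: eval_nat_numeral algebra_simps)
  then have "f 1 = v_M3 q"
    using rec[of 0] unfolding One_nat_def f_def T_mat_mult_vec4 by (simp add: n v_M3_def vec4_def)
  then have "s_M3 q i = eps_vec \<bullet> f i"
    using T_power_orbit[of q f i, OF q(1) rec] by (simp add: s_M3_def f_def vec4_carrier)
  then show ?thesis unfolding f_def eps_vec4 by (simp add: s_def)
qed

lemma s_GL3_orbit:
  assumes q: "q \<noteq> 0" "q \<noteq> 1" "q ^ 2 \<noteq> 1"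
  shows "s_GL3 q i = (1 / (q ^ 2 - 1)) *
    ((q ^ 2 - 1 + 2 / q ^ 2) * (q ^ 3) ^ i - (q + 1 / q + 2 / q ^ 2) * (q ^ 2) ^ i + 2 / q * q ^ i)"
proof -
  define s where "s i = (1 / (q ^ 2 - 1)) *
    ((q ^ 2 - 1 + 2 / q ^ 2) * (q ^ 3) ^ i - (q + 1 / q + 2 / q ^ 2) * (q ^ 2) ^ i + 2 / q * q ^ i)" for i :: nat
  \<comment> \<open>The same triangular solution, now with the initial vector 1 - 1/q, - (q -
    1)/q^2, 0, (q - 1)/q^2. It is the inverse of T applied to \<open>v_GL3 q\<close>, and its
    entries add up to 1 - 1/q.\<close>
  define n1 n2 n3 where n: "n1 i = (1 - 1 / q) * q ^ i" "n2 i = (q - 1) ^ 2 / q ^ 2 * (q ^ 2) ^ i - (1 - 1 / q) * q ^ i"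
    "n3 i = ((q ^ 2) ^ i - q ^ i) / q" for i :: nat
  define f where "f i = vec4 (n1 i) (n2 i) (n3 i) (s i - n1 i - n2 i - n3 i)" for i
  have q1: "q - 1 \<noteq> 0" "q ^ 2 - 1 \<noteq> 0" using q by auto
  have rec: "f (Suc i) = T_mat q *\<^sub>v f i" for i
  proof -
    define x where "x = q ^ i"
    have p: "(q ^ 2) ^ i = x ^ 2" "(q ^ 3) ^ i = x ^ 3" "q ^ i = x"
      by (simp_all add: x_def mult.commute flip: power_mult)
    have "n1 (Suc i) = q * n1 i" by (simp add: n)
    moreover have "n2 (Suc i) = (q ^ 2 - q) * n1 i + q ^ 2 * n2 i"
      unfolding n power_Suc p using q by (simp add: divide_simps) (simp add: eval_nat_numeral algebra_simps)
    moreover have "n3 (Suc i) = q * n1 i + q ^ 2 * n3 i"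
      unfolding n power_Suc p using q by (simp add: divide_simps) (simp add: eval_nat_numeral algebra_simps)
    moreover have "s (Suc i) - n1 (Suc i) - n2 (Suc i) - n3 (Suc i) = q ^ 3 * n1 i + q ^ 3 * n2 i + (q ^ 3 + q) * n3 i
      + q ^ 3 * (s i - n1 i - n2 i - n3 i)"
      unfolding s_def n power_Suc p using q q1
      by (simp add: divide_simps) (simp add: eval_nat_numeral algebra_simps)
    ultimately show ?thesis unfolding f_def T_mat_mult_vec4 by simp
  qed
  have s0: "s 0 - n1 0 - n2 0 - n3 0 = (q - 1) / q ^ 2"
    using q q1 by (simp add: s_def n divide_simps) (simp add: eval_nat_numeral algebra_simps)
  have n0: "n1 0 = 1 - 1 / q" "n2 0 = - (q - 1) / q ^ 2" "n3 0 = 0"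
    using q by (simp_all add: n divide_simps) (simp add: eval_nat_numeral algebra_simps)
  have "q * n1 0 = q - 1" "(q ^ 2 - q) * n1 0 + q ^ 2 * n2 0 = (q - 1) * (q - 2)"
    "q * n1 0 + q ^ 2 * n3 0 = q - 1"
    "q ^ 3 * n1 0 + q ^ 3 * n2 0 + (q ^ 3 + q) * n3 0 + q ^ 3 * (s 0 - n1 0 - n2 0 - n3 0) = q ^ 3 - q ^ 2"
    unfolding s0 unfolding n0 using q(1) by (simp_all add: divide_simps) (simp_all add: eval_nat_numeral algebra_simps)
  then have "f 1 = v_GL3 q"
    using rec[of 0] unfolding One_nat_def f_def T_mat_mult_vec4 by (simp only: v_GL3_def vec4_def)
  then have "s_GL3 q i = eps_vec \<bullet> f i"
    using T_power_orbit[of q f i, OF q(1) rec] by (simp add: s_GL3_def f_def vec4_carrier)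
  then show ?thesis unfolding f_def eps_vec4 by (simp add: s_def)
qed

lemma fps_geometric: "fps_const c / (1 - fps_const a * fps_X) = Abs_fps (\<lambda>n. c * a ^ n :: rat)"
proof -
  let ?y = "1 - fps_const a * fps_X :: rat fps"
  have "Abs_fps (\<lambda>n. c * a ^ n) * ?y = fps_const c"
  proof (rule fps_ext)
    fix n
    show "fps_nth (Abs_fps (\<lambda>n. c * a ^ n) * ?y) n = fps_nth (fps_const c) n"
      by (cases n) (simp_all add: right_diff_distrib mult.assoc[symmetric] fps_mult_right_const_nth)
  qed
  moreover have "fps_nth ?y 0 \<noteq> 0" by simp
  then have "?y \<noteq> 0" by (metis fps_zero_nth)
  ultimately show ?thesis by (metis nonzero_mult_div_cancel_right)
qed

lemma (in level_ring) branch_vec_T: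
  fixes v :: "nat \<Rightarrow> nat"
  defines "f \<equiv> \<lambda>i. vec4 (of_nat (branch_vec v i 1)) (of_nat (branch_vec v i 2)) (of_nat (branch_vec v i 3)) (of_nat (branch_vec v i 4))"
  shows "f (Suc i) = T_mat (of_nat q) *\<^sub>v f i"
proof -
  have "q \<le> q ^ 2" by (simp add: power2_eq_square)
  then have "(of_nat (q ^ 2 - q) :: rat) = of_nat q ^ 2 - of_nat q" by (simp add: of_nat_diff)
  then show ?thesis
    unfolding f_def T_mat_mult_vec4 by (simp add: branching_def del: One_nat_def) (simp add: algebra_simps)
qed

lemma (in level_ring) branch_vec_sum:
  fixes v :: "nat \<Rightarrow> nat"
  shows "of_nat (\<Sum>k\<in>types. branch_vec v (L - 1) k) = eps_vec \<bullet>
    (T_power (of_nat q) (int L - 1) *\<^sub>v vec4 (of_nat (v 1)) (of_nat (v 2)) (of_nat (v 3)) (of_nat (v 4)))"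
proof -
  define f where "f i = vec4 (of_nat (branch_vec v i 1)) (of_nat (branch_vec v i 2)) (of_nat (branch_vec v i 3)) (of_nat (branch_vec v i 4))" for i
  have q0: "(of_nat q :: rat) \<noteq> 0" using q_gt_1 by simp
  \<comment> \<open>\<open>branch_vec\<close> has index 0 at level 1. The sequence is shifted by one
    and extended to level 0 by the inverse of T, to match the indexing of
    \<open>T_power_orbit\<close>.\<close>
  define g where "g i = (case i of 0 \<Rightarrow> T_inv (of_nat q) *\<^sub>v f 0 | Suc j \<Rightarrow> f j)" for i
  have "g (Suc i) = T_mat (of_nat q) *\<^sub>v g i" for i
  proof (cases i)
    case 0
    have "T_mat (of_nat q) *\<^sub>v (T_inv (of_nat q) *\<^sub>v f 0) = (T_mat (of_nat q) * T_inv (of_nat q)) *\<^sub>v f 0"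
      by (rule assoc_mult_mat_vec[OF T_mat_carrier T_inv_carrier, symmetric]) (simp add: f_def vec4_carrier)
    then show ?thesis using 0 T_inv[OF q0] by (simp add: g_def f_def vec4_carrier)
  next
    case (Suc j)
    then show ?thesis using branch_vec_T[of v j] by (simp add: g_def f_def)
  qed
  moreover have "g 0 \<in> carrier_vec 4" using T_inv_carrier by (simp add: g_def f_def mult_mat_vec_carrier[OF T_inv_carrier vec4_carrier])
  ultimately have "T_power (of_nat q) (int L - 1) *\<^sub>v g 1 = g L" by (rule T_power_orbit[OF q0])
  moreover have "g L = f (L - 1)" using L_pos by (cases L) (simp_all add: g_def)
  moreover have "g 1 = vec4 (of_nat (v 1)) (of_nat (v 2)) (of_nat (v 3)) (of_nat (v 4))" by (simp add: g_def f_def)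
  ultimately show ?thesis by (simp add: f_def eps_vec4 del: One_nat_def)
qed

theorem mainTheorem3:
  fixes A :: "('a, 'b) ring_scheme" and \<mm> :: "'a set" and q :: rat
  assumes "local_principal_ideal_ring A \<mm>"
    and "finite (carrier (A Quot \<mm>))"
    and "q = of_nat (card (carrier (A Quot \<mm>)))"
  shows "(\<forall>i. 1 \<le> i \<and> enat i \<le> pir_length A \<mm> \<longrightarrow>
            of_nat (card (Sim_M3 (level A \<mm> i))) = s_M3 q i \<and>
            of_nat (card (Sim_GL3 (level A \<mm> i))) = s_GL3 q i) \<and>
         Abs_fps (s_M3 q) =
           fps_const (1 / ((q - 1) * (q^2 - 1))) *
             (fps_const (q^3 + 1/q) / (1 - fps_const (q^3) * fps_X)
              - fps_const (q^2 + q + 1 + 1/q) / (1 - fps_const (q^2) * fps_X)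
              + fps_const 2 / (1 - fps_const q * fps_X)) \<and>
         Abs_fps (s_GL3 q) =
           fps_const (1 / (q^2 - 1)) *
             (fps_const (q^2 - 1 + 2 / q^2) / (1 - fps_const (q^3) * fps_X)
              - fps_const (q + 1/q + 2 / q^2) / (1 - fps_const (q^2) * fps_X)
              + fps_const (2 / q) / (1 - fps_const q * fps_X))"
proof -
  have A: "local_principal_ideal_ring A \<mm>" and fin: "finite (carrier (A Quot \<mm>))"
    and q: "q = of_nat (card (carrier (A Quot \<mm>)))" by (fact assms)+
  have levels: "of_nat (card (Sim_M3 (level A \<mm> i))) = s_M3 q i \<and> of_nat (card (Sim_GL3 (level A \<mm> i))) = s_GL3 q i"
    and q_gt_1: "1 < card (carrier (A Quot \<mm>))"
    if i: "1 \<le> i" "enat i \<le> pir_length A \<mm>" for i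
  proof -
    obtain K :: "('a multiset \<Rightarrow>\<^sub>0 int) set" and p S \<phi>
      where P: "level_presentation K p i S (level A \<mm> i) \<phi>" and card_S: "card S = card (carrier (A Quot \<mm>))"
      using level_presentation_exists[OF A fin i] by blast
    interpret level_presentation K p i S "level A \<mm> i" \<phi> by (rule P)
    show card_gt: "1 < card (carrier (A Quot \<mm>))" using q_gt_1 card_S by simp
    have qS: "q = of_nat (card S)" using q card_S by simp
    \<comment> \<open>These bounds turn the truncated subtractions in the cardinalities into
      rational ones.\<close>
    have le: "card S \<le> card S ^ 2" "card S ^ 2 \<le> card S ^ 3" "1 \<le> card S" "2 \<le> card S"
      using q_gt_1 by (auto simp: power2_eq_square power3_eq_cube)
    have v: "vec4 (of_nat (card (nf_index 1))) (of_nat (card (nf_index 2))) (of_nat (card (nf_index 3)))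
        (of_nat (card (nf_index 4))) = v_M3 q"
      "vec4 (of_nat (card {t \<in> nf_index 1. nf 1 t \<in> GL})) (of_nat (card {t \<in> nf_index 2. nf 2 t \<in> GL}))
        (of_nat (card {t \<in> nf_index 3. nf 3 t \<in> GL})) (of_nat (card {t \<in> nf_index 4. nf 4 t \<in> GL})) = v_GL3 q"
      unfolding card_nf_index card_nf_index_GL vec4_def v_M3_def v_GL3_def qS
      using le by (simp_all only: of_nat_mult of_nat_diff of_nat_power of_nat_1 of_nat_numeral)
    show "of_nat (card (Sim_M3 (level A \<mm> i))) = s_M3 q i \<and> of_nat (card (Sim_GL3 (level A \<mm> i))) = s_GL3 q i"
      unfolding class_numbers branch_vec_sum v s_M3_def s_GL3_def qS[symmetric] by simp
  qed
  \<comment> \<open>The length is an infimum of positive numbers, so level 1 always exists. It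
    supplies q > 1, which keeps the denominators in the closed forms nonzero.\<close>
  have "enat 1 \<le> pir_length A \<mm>"
    unfolding pir_length_def by (intro Inf_greatest) (auto simp: Suc_le_eq)
  then have "1 < card (carrier (A Quot \<mm>))" by (rule q_gt_1[OF order_refl])
  then have q1: "1 < q" unfolding q by simp
  then have "1 < q ^ 2" by (rule one_less_power) simp
  then have qs: "q \<noteq> 0" "q \<noteq> 1" "q ^ 2 \<noteq> 1" using q1 by (metis less_irrefl not_one_less_zero)+
  have "Abs_fps (s_M3 q) =
           fps_const (1 / ((q - 1) * (q^2 - 1))) *
             (fps_const (q^3 + 1/q) / (1 - fps_const (q^3) * fps_X)
              - fps_const (q^2 + q + 1 + 1/q) / (1 - fps_const (q^2) * fps_X)
              + fps_const 2 / (1 - fps_const q * fps_X))"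
    unfolding fps_geometric by (rule fps_ext) (simp add: s_M3_orbit[OF qs])
  moreover have "Abs_fps (s_GL3 q) =
           fps_const (1 / (q^2 - 1)) *
             (fps_const (q^2 - 1 + 2 / q^2) / (1 - fps_const (q^3) * fps_X)
              - fps_const (q + 1/q + 2 / q^2) / (1 - fps_const (q^2) * fps_X)
              + fps_const (2 / q) / (1 - fps_const q * fps_X))"
    unfolding fps_geometric by (rule fps_ext) (simp add: s_GL3_orbit[OF qs])
  ultimately show ?thesis using levels by blast
qed

end
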